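(* Assume that for all $1\le j\le i$, $\mathbb{E}(X_{ij}\mid\mathcal{F}_{ij}^{1})=0$ a.s. Assume also that for some non-decreasing function $h:[0,\infty)\to[1,\infty)$ such that $x^{-1}h(x)$ is non-increasing and $\sum_{n\ge1}(nh(n))^{-1}<\infty$, there exists a positive constant $C$ such that $$\sup_{i,j}\mathbb{E}\big(X_{ij}^{2}h(|X_{ij}|)\big)\le C,$$ and that $$\lim_{a\to\infty}\limsup_{n\to\infty}\frac{1}{n^{2}}\sum_{1\le j\le i\le n}\big|\mathbb{E}(X_{ij}^{2}-\sigma_{ij}^{2}\mid\mathcal{F}_{ij}^{a})\big|=0\quad\text{a.s.}$$ Then for all $z\in\mathbb{C}^{+}$, $$S^{\mathbb{X}_{n}}(z)-S^{\mathbb{Y}_{n}}(z)\to0\quad\text{a.s. as }n\to\infty .$$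
   Context: All random variables are defined on one probability space $(\Omega,\mathcal{F},\mathbb{P})$. $(X_{ij})_{(i,j)\in\mathbb{Z}^{2}}$ are real-valued random variables with $\mathbb{E}(X_{ij})=0$ and $\mathbb{E}(X_{ij}^{2})=\sigma_{ij}^{2}<\infty$. $(Y_{ij})_{(i,j)\in\mathbb{N}^{2}}$ is a family of independent centered real-valued Gaussian random variables with $\mathbb{E}(Y_{ij}^{2})=\sigma_{ij}^{2}$, independent of $(X_{ij})_{(i,j)\in\mathbb{Z}^2}$. $\mathbf{X}_{n}$ is the symmetric $n\times n$ matrix with $(\mathbf{X}_{n})_{ij}=X_{ij}$ for $i\ge j$ and $(\mathbf{X}_{n})_{ij}=X_{ji}$ for $i<j$; $\mathbb{X}_{n}=n^{-1/2}\mathbf{X}_{n}$. $\mathbf{Y}_{n}$ and $\mathbb{Y}_{n}=n^{-1/2}\mathbf{Y}_n$ are defined in the same way from the $Y_{ij}$. For a symmetric $n\times n$ matrix $A$ and $z\in\mathbb{C}^{+}=\{z\in\mathbb{C}:\operatorname{Im}z>0\}$, $S^{A}(z)=\frac1n\mathrm{Tr}(A-z\mathbf{I}_{n})^{-1}$ is the Stieltjes transform of its empirical spectral distribution. Lexicographic order on $\mathbb{Z}^{2}$: $(u,v)\le_{\mathrm{lex}}(i,j)$ means $u<i$, or $u=i$ and $v\le j$. For a non-negative integer $a$, let $B_{ij}^{a}=\{(u,v)\in\mathbb{Z}^{2}:\max(|u-i|,|v-j|)\ge a,\ (u,v)\le_{\mathrm{lex}}(i,j)\}$, and for $i\ge j$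 let $\mathcal{F}_{ij}^{a}=\sigma(X_{uv}:(u,v)\in B_{ij}^{a}\text{ and }v\le u)$ (the trivial $\sigma$-algebra if $B_{ij}^a=\emptyset$). *)

theory Defs
  imports "HOL-Probability.Probability" "Jordan_Normal_Form.Gauss_Jordan_Elimination"
begin

definition generated_algebra :: "'a measure \<Rightarrow> ('i \<Rightarrow> 'a \<Rightarrow> real) \<Rightarrow> 'i set \<Rightarrow> 'a measure" where
  "generated_algebra M Z I =
     sigma (space M) (\<Union>k\<in>I. {Z k -` A \<inter> space M | A. A \<in> sets borel})"

text \<open>The centered Gaussian law of variance \<open>v \<ge> 0\<close>. The value \<open>v = 0\<close> is allowed and
  gives the Dirac mass at \<open>0\<close>, where \<^const>\<open>normal_density\<close> would not be a density.\<close>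

definition centered_gaussian :: "real \<Rightarrow> real measure" where
  "centered_gaussian v =
     (if v = 0 then return borel 0
      else density lborel (\<lambda>x. ennreal (normal_density 0 (sqrt v) x)))"

definition lex_le :: "int \<times> int \<Rightarrow> int \<times> int \<Rightarrow> bool" where
  "lex_le = (\<lambda>(u, v) (i, j). u < i \<or> (u = i \<and> v \<le> j))"

definition past_region :: "nat \<Rightarrow> int \<times> int \<Rightarrow> (int \<times> int) set" where
  "past_region a = (\<lambda>(i, j).
     {(u, v). max \<bar>u - i\<bar> \<bar>v - j\<bar> \<ge> int a \<and> lex_le (u, v) (i, j)})"

definition past_algebra ::
    "'a measure \<Rightarrow> (int \<times> int \<Rightarrow> 'a \<Rightarrow> real) \<Rightarrow> nat \<Rightarrow> int \<times> int \<Rightarrow> 'a measure" where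
  "past_algebra M X a p = generated_algebra M X {(u, v). (u, v) \<in> past_region a p \<and> v \<le> u}"

text \<open>Matrix indices of \<^const>\<open>mat\<close> start at \<open>0\<close>, the indices of the array \<open>x\<close> at \<open>1\<close>.\<close>

definition symmetric_array_mat :: "nat \<Rightarrow> (nat \<times> nat \<Rightarrow> real) \<Rightarrow> real mat" where
  "symmetric_array_mat n x =
     mat n n (\<lambda>(i, j). if j \<le> i then x (i + 1, j + 1) else x (j + 1, i + 1))"

definition normalized_array_mat :: "nat \<Rightarrow> (nat \<times> nat \<Rightarrow> real) \<Rightarrow> real mat" where
  "normalized_array_mat n x = (1 / sqrt (real n)) \<cdot>\<^sub>m symmetric_array_mat n x"

text \<open>Used for symmetric \<open>A\<close> and \<open>Im z > 0\<close>; then \<open>A - z I\<close> is invertible, so that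
  \<^const>\<open>the\<close> is applied to a value other than \<^const>\<open>None\<close>.\<close>

definition stieltjes :: "real mat \<Rightarrow> complex \<Rightarrow> complex" where
  "stieltjes A z =
     (let n = dim_row A;
          R = the (mat_inverse (map_mat complex_of_real A - z \<cdot>\<^sub>m 1\<^sub>m n))
      in 1 / of_nat n * (\<Sum>i<n. R $$ (i, i)))"

end

theory Submission
  imports Defs "Jordan_Normal_Form.Determinant"
begin

text \<open>
  The Stieltjes transform of the \<open>n \<times> n\<close> matrix is a smooth function of its entries whose first three
  derivatives in one entry are of order \<open>n\<^sup>-\<^sup>3\<^sup>/\<^sup>2\<close>, \<open>n\<^sup>-\<^sup>2\<close> and \<open>n\<^sup>-\<^sup>5\<^sup>/\<^sup>2\<close>. The entries of \<open>X\<close> are replaced by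
  those of \<open>Y\<close> one at a time in lexicographic order, without taking expectations over \<open>Y\<close>. In the
  Taylor expansion the first order terms and the second order terms in \<open>Y\<close> are orthogonal, with second
  moment \<open>O(1/n)\<close>. In the second order terms in \<open>X\<close> the coefficient is first made measurable with
  respect to the past at distance \<open>a\<close> (and \<open>Y\<close>) by zeroing the few entries that are too close. After
  truncation of \<open>X\<^sup>2\<close> at level \<open>n\<close>, the deviations from the conditional expectations are orthogonal for
  entries whose rows are at least \<open>a\<close> apart, and only \<open>O(n\<^sup>3)\<close> pairs violate this. What remains is
  dominated by the averaged conditional variances of the hypothesis. All other errors are of order
  \<open>1 / h (sqrt n) + 1 / sqrt n\<close>, which is summable along \<open>n = c * 4 ^ j\<close> for every \<open>c\<close>. For large \<open>L\<close> the
  sequences with \<open>L \<le> c < 4 * L\<close> together have gaps of relative size at most \<open>1 / L\<close>. A Hilbert-Schmidt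
  perturbation bound fills these gaps. It needs a law of large numbers for the squares of the entries,
  which is the same orthogonality argument with constant coefficients.
\<close>


section \<open>Resolvents of symmetric matrices\<close>

text \<open>The control of the conditional variances holds almost surely and without a rate, so that
  term is kept pathwise; every other error needs moment bounds that are summable along the
  subsequences. Keeping \<open>Y\<close> random makes the coefficients depend on the entries of
  \<open>Y\<close> not yet replaced, and this dictates two directions of conditioning: the
  \<open>X\<close> terms are conditioned on the past of \<open>X\<close> together with all of
  \<open>Y\<close>, while the \<open>Y\<close> terms run backwards, given all of \<open>X\<close>
  and every entry of \<open>Y\<close> except the earlier one of the pair. The past at distance
  \<open>a\<close> is not monotone in the lexicographic order, only between rows at least
  \<open>a\<close> apart, so \<open>O(n^3)\<close> correlated pairs have to be afforded. With
  weights of order \<open>n^-2\<close> this is possible once the second moment of a summand is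
  \<open>o(n)\<close>, which truncation achieves with the bound \<open>n / h (sqrt n)\<close>. The
  ratio 4 also comes from \<open>h (sqrt n)\<close>: by condensation, summability of
  \<open>1 / (n * h n)\<close> is that of \<open>1 / h (2 ^ j)\<close>, and
  \<open>sqrt (4 ^ j) = 2 ^ j\<close>.\<close>

type_synonym cmatrix = "nat \<Rightarrow> nat \<Rightarrow> complex"

definition mmult :: "nat \<Rightarrow> cmatrix \<Rightarrow> cmatrix \<Rightarrow> cmatrix" where
  "mmult n P Q = (\<lambda>i j. \<Sum>l<n. P i l * Q l j)"

definition mapply :: "nat \<Rightarrow> cmatrix \<Rightarrow> (nat \<Rightarrow> complex) \<Rightarrow> nat \<Rightarrow> complex" where
  "mapply n P v = (\<lambda>i. \<Sum>l<n. P i l * v l)"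

definition mtrace :: "nat \<Rightarrow> cmatrix \<Rightarrow> complex" where
  "mtrace n P = (\<Sum>i<n. P i i)"

definition vnorm :: "nat \<Rightarrow> (nat \<Rightarrow> complex) \<Rightarrow> real" where
  "vnorm n v = L2_set (\<lambda>i. cmod (v i)) {..<n}"

text \<open>A bound on the spectral norm as a predicate: no supremum is formed, and products and
  multiples inherit explicit constants. Vectors are total functions of which only the values below
  \<open>n\<close> count.\<close>

definition op_bounded :: "nat \<Rightarrow> real \<Rightarrow> cmatrix \<Rightarrow> bool" where
  "op_bounded n c P \<longleftrightarrow> 0 \<le> c \<and> (\<forall>v. vnorm n (mapply n P v) \<le> c * vnorm n v)"

text \<open>A crude bound for the trace norm, meant for matrices with at most two nonzero
  entries.\<close>

definition entry_norm :: "nat \<Rightarrow> cmatrix \<Rightarrow> real" where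
  "entry_norm n P = (\<Sum>i<n. \<Sum>j<n. cmod (P i j))"

section \<open>Matrix algebra, spectral bounds and traces\<close>

lemma mmult_assoc: "mmult n (mmult n P Q) R = mmult n P (mmult n Q R)"
proof (intro ext)
  fix i j
  have "(\<Sum>l<n. (\<Sum>k<n. P i k * Q k l) * R l j) = (\<Sum>l<n. \<Sum>k<n. P i k * Q k l * R l j)"
    by (simp add: sum_distrib_right)
  also have "\<dots> = (\<Sum>k<n. \<Sum>l<n. P i k * Q k l * R l j)" by (rule sum.swap)
  also have "\<dots> = (\<Sum>k<n. P i k * (\<Sum>l<n. Q k l * R l j))"
    by (simp add: sum_distrib_left mult.assoc)
  finally show "mmult n (mmult n P Q) R i j = mmult n P (mmult n Q R) i j"
    by (simp add: mmult_def)
qed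

lemma mapply_mmult: "mapply n (mmult n P Q) v = mapply n P (mapply n Q v)"
proof
  fix i
  have "(\<Sum>l<n. (\<Sum>k<n. P i k * Q k l) * v l) = (\<Sum>l<n. \<Sum>k<n. P i k * Q k l * v l)"
    by (simp add: sum_distrib_right)
  also have "\<dots> = (\<Sum>k<n. \<Sum>l<n. P i k * Q k l * v l)" by (rule sum.swap)
  also have "\<dots> = (\<Sum>k<n. P i k * (\<Sum>l<n. Q k l * v l))"
    by (simp add: sum_distrib_left mult.assoc)
  finally show "mapply n (mmult n P Q) v i = mapply n P (mapply n Q v) i"
    by (simp add: mapply_def mmult_def)
qed

lemma mmult_diff_left: "mmult n (\<lambda>i j. P i j - P' i j) Q = (\<lambda>i j. mmult n P Q i j - mmult n P' Q i j)"
  by (simp add: mmult_def fun_eq_iff left_diff_distrib sum_subtractf)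

lemma mmult_diff_right: "mmult n Q (\<lambda>i j. P i j - P' i j) = (\<lambda>i j. mmult n Q P i j - mmult n Q P' i j)"
  by (simp add: mmult_def fun_eq_iff right_diff_distrib sum_subtractf)

lemma mmult_scale_left: "mmult n (\<lambda>i j. c * P i j) Q = (\<lambda>i j. c * mmult n P Q i j)"
  by (simp add: mmult_def fun_eq_iff sum_distrib_left mult.assoc)

lemma mmult_scale_right: "mmult n Q (\<lambda>i j. c * P i j) = (\<lambda>i j. c * mmult n Q P i j)"
  by (simp add: mmult_def fun_eq_iff sum_distrib_left mult_ac)

lemma mtrace_diff: "mtrace n (\<lambda>i j. P i j - Q i j) = mtrace n P - mtrace n Q"
  by (simp add: mtrace_def sum_subtractf)

lemma mtrace_scale: "mtrace n (\<lambda>i j. c * P i j) = c * mtrace n P"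
  by (simp add: mtrace_def sum_distrib_left)

lemma mtrace_comm: "mtrace n (mmult n P Q) = mtrace n (mmult n Q P)"
  unfolding mtrace_def mmult_def by (subst sum.swap) (simp add: mult.commute)

lemma vnorm_nonneg: "0 \<le> vnorm n v"
  by (simp add: vnorm_def)

lemma norm_le_vnorm: "i < n \<Longrightarrow> cmod (v i) \<le> vnorm n v"
  unfolding vnorm_def by (rule member_le_L2_set) auto

lemma op_bounded_mono: "op_bounded n c P \<Longrightarrow> c \<le> d \<Longrightarrow> op_bounded n d P"
  unfolding op_bounded_def using mult_right_mono[OF _ vnorm_nonneg] order_trans by blast

lemma op_bounded_mmult:
  assumes "op_bounded n c P" "op_bounded n d Q"
  shows "op_bounded n (c * d) (mmult n P Q)"
  unfolding op_bounded_def
proof (intro conjI allI)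
  show "0 \<le> c * d" using assms by (simp add: op_bounded_def)
  fix v
  have "vnorm n (mapply n (mmult n P Q) v) \<le> c * vnorm n (mapply n Q v)"
    using assms(1) by (simp add: mapply_mmult op_bounded_def)
  also have "\<dots> \<le> c * (d * vnorm n v)"
    using assms by (intro mult_left_mono) (auto simp: op_bounded_def)
  finally show "vnorm n (mapply n (mmult n P Q) v) \<le> c * d * vnorm n v" by simp
qed

lemma op_bounded_scale:
  assumes "op_bounded n c P"
  shows "op_bounded n (cmod a * c) (\<lambda>i j. a * P i j)"
  unfolding op_bounded_def
proof (intro conjI allI)
  show "0 \<le> cmod a * c" using assms by (simp add: op_bounded_def)
  fix v
  have "mapply n (\<lambda>i j. a * P i j) v = (\<lambda>i. a * mapply n P v i)"
    by (simp add: mapply_def sum_distrib_left mult.assoc)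
  then have "vnorm n (mapply n (\<lambda>i j. a * P i j) v) = cmod a * vnorm n (mapply n P v)"
    by (simp add: vnorm_def norm_mult L2_set_right_distrib)
  also have "\<dots> \<le> cmod a * (c * vnorm n v)"
    using assms by (intro mult_left_mono) (auto simp: op_bounded_def)
  finally show "vnorm n (mapply n (\<lambda>i j. a * P i j) v) \<le> cmod a * c * vnorm n v" by simp
qed

lemma op_bounded_entry_norm: "op_bounded n (entry_norm n P) P"
  unfolding op_bounded_def
proof (intro conjI allI)
  show "0 \<le> entry_norm n P" by (simp add: entry_norm_def sum_nonneg)
  fix v
  have "vnorm n (mapply n P v) \<le> (\<Sum>i<n. cmod (mapply n P v i))"
    unfolding vnorm_def by (rule L2_set_le_sum) auto
  also have "\<dots> \<le> (\<Sum>i<n. \<Sum>j<n. cmod (P i j) * vnorm n v)"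
  proof (rule sum_mono)
    fix i
    have "cmod (mapply n P v i) \<le> (\<Sum>j<n. cmod (P i j * v j))"
      unfolding mapply_def by (rule norm_sum)
    also have "\<dots> \<le> (\<Sum>j<n. cmod (P i j) * vnorm n v)"
      by (rule sum_mono) (simp add: norm_mult mult_left_mono norm_le_vnorm)
    finally show "cmod (mapply n P v i) \<le> (\<Sum>j<n. cmod (P i j) * vnorm n v)" .
  qed
  also have "\<dots> = entry_norm n P * vnorm n v"
    by (simp add: entry_norm_def sum_distrib_right)
  finally show "vnorm n (mapply n P v) \<le> entry_norm n P * vnorm n v" .
qed

text \<open>A column is the image of a standard basis vector, which has norm one.\<close>

lemma op_bounded_column:
  assumes "op_bounded n c P" "j < n"
  shows "vnorm n (\<lambda>i. P i j) \<le> c"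
proof -
  define e where "e = (\<lambda>i. if i = j then 1 else 0 :: complex)"
  have "mapply n P e = (\<lambda>i. P i j)"
    using assms(2) by (simp add: mapply_def e_def if_distrib sum.delta' cong: if_cong)
  moreover have "vnorm n e = 1"
  proof -
    have "(\<Sum>i<n. (cmod (e i))\<^sup>2) = (\<Sum>i<n. if i = j then 1 else 0)"
      by (rule sum.cong) (auto simp: e_def)
    then show ?thesis using assms(2) by (simp add: vnorm_def L2_set_def sum.delta)
  qed
  ultimately show ?thesis using assms(1) unfolding op_bounded_def by (metis mult.right_neutral)
qed

lemma op_bounded_entry:
  assumes "op_bounded n c P" "i < n" "j < n"
  shows "cmod (P i j) \<le> c"
  using op_bounded_column[OF assms(1,3)] norm_le_vnorm[OF assms(2), of "\<lambda>i. P i j"] by linarith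

text \<open>Entries are bounded by the operator norm, so the trace against a matrix with few entries
  costs no factor \<open>n\<close>. This is why derivatives in a single entry keep the factor
  \<open>1 / n\<close> of the normalized trace.\<close>

lemma norm_mtrace_entry_norm:
  assumes "op_bounded n c P"
  shows "cmod (mtrace n (mmult n P E)) \<le> c * entry_norm n E"
proof -
  have "cmod (mtrace n (mmult n P E)) \<le> (\<Sum>i<n. \<Sum>l<n. cmod (P i l) * cmod (E l i))"
    unfolding mtrace_def mmult_def
    by (rule order_trans[OF norm_sum sum_mono], rule order_trans[OF norm_sum sum_mono])
       (simp add: norm_mult)
  also have "\<dots> \<le> (\<Sum>i<n. \<Sum>l<n. c * cmod (E l i))"
    by (intro sum_mono mult_right_mono op_bounded_entry[OF assms]) auto
  also have "\<dots> = c * entry_norm n E"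
    unfolding entry_norm_def by (subst sum.swap) (simp add: sum_distrib_left)
  finally show ?thesis .
qed

lemma norm_mtrace_sandwich:
  assumes "op_bounded n c P" "op_bounded n d Q"
  shows "cmod (mtrace n (mmult n P (mmult n E Q))) \<le> c * d * entry_norm n E"
proof -
  have "mtrace n (mmult n P (mmult n E Q)) = mtrace n (mmult n (mmult n Q P) E)"
    by (metis mmult_assoc mtrace_comm)
  then show ?thesis
    using norm_mtrace_entry_norm[OF op_bounded_mmult[OF assms(2,1)], of E] by (simp add: mult.commute)
qed

text \<open>Cauchy-Schwarz for the Frobenius inner product; the Frobenius norm of \<open>P\<close>
  is at most \<open>c * sqrt n\<close>, since each of its \<open>n\<close> columns has norm at most
  \<open>c\<close>.\<close>

lemma norm_mtrace_hs:
  assumes "op_bounded n c P"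
  shows "cmod (mtrace n (mmult n P D)) \<le> c * sqrt (real n) * sqrt (\<Sum>i<n. \<Sum>j<n. (cmod (D i j))\<^sup>2)"
proof -
  have c: "0 \<le> c" using assms by (simp add: op_bounded_def)
  let ?I = "{..<n} \<times> {..<n}"
  have "cmod (mtrace n (mmult n P D)) \<le> (\<Sum>i<n. \<Sum>l<n. cmod (P i l) * cmod (D l i))"
    unfolding mtrace_def mmult_def
    by (rule order_trans[OF norm_sum sum_mono], rule order_trans[OF norm_sum sum_mono])
       (simp add: norm_mult)
  also have "\<dots> = (\<Sum>l<n. \<Sum>i<n. cmod (P i l) * cmod (D l i))"
    by (rule sum.swap)
  also have "\<dots> = (\<Sum>p\<in>?I. \<bar>cmod (P (snd p) (fst p))\<bar> * \<bar>cmod (D (fst p) (snd p))\<bar>)"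
    by (simp add: sum.cartesian_product case_prod_unfold)
  also have "\<dots> \<le> L2_set (\<lambda>p. cmod (P (snd p) (fst p))) ?I * L2_set (\<lambda>p. cmod (D (fst p) (snd p))) ?I"
    by (rule L2_set_mult_ineq)
  also have "L2_set (\<lambda>p. cmod (P (snd p) (fst p))) ?I \<le> c * sqrt (real n)"
  proof -
    have "(\<Sum>p\<in>?I. (cmod (P (snd p) (fst p)))\<^sup>2) = (\<Sum>l<n. \<Sum>i<n. (cmod (P i l))\<^sup>2)"
      by (simp add: sum.cartesian_product case_prod_unfold)
    also have "\<dots> = (\<Sum>l<n. (vnorm n (\<lambda>i. P i l))\<^sup>2)"
      by (simp add: vnorm_def L2_set_def sum_nonneg)
    also have "\<dots> \<le> (\<Sum>l<n. c\<^sup>2)"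
      by (intro sum_mono power_mono op_bounded_column[OF assms] vnorm_nonneg) auto
    also have "\<dots> = (c * sqrt (real n))\<^sup>2" by (simp add: power_mult_distrib)
    finally show ?thesis unfolding L2_set_def using c by (intro real_le_lsqrt) (auto intro: sum_nonneg)
  qed
  also have "L2_set (\<lambda>p. cmod (D (fst p) (snd p))) ?I = sqrt (\<Sum>i<n. \<Sum>j<n. (cmod (D i j))\<^sup>2)"
    by (simp add: L2_set_def sum.cartesian_product case_prod_unfold)
  finally show ?thesis
    by (simp add: mult_right_mono sum_nonneg)
qed

section \<open>The resolvent: existence, norm, perturbation and measurability\<close>

definition shifted :: "(nat \<Rightarrow> nat \<Rightarrow> real) \<Rightarrow> complex \<Rightarrow> cmatrix" where
  "shifted a z = (\<lambda>i j. of_real (a i j) - (if i = j then z else 0))"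

text \<open>Zero outside the \<open>n \<times> n\<close> block, so that the resolvent identity
  becomes an equation between total functions.\<close>

definition resolvent :: "nat \<Rightarrow> (nat \<Rightarrow> nat \<Rightarrow> real) \<Rightarrow> complex \<Rightarrow> cmatrix" where
  "resolvent n a z = (\<lambda>i j. if i < n \<and> j < n
     then the (mat_inverse (mat n n (\<lambda>(i, j). shifted a z i j))) $$ (i, j) else 0)"

text \<open>The quadratic form of a real symmetric matrix is real, so only the shift contributes an
  imaginary part, \<open>- Im z\<close> times the squared norm of \<open>v\<close>. Cauchy-Schwarz
  bounds its modulus by the product of the norms of \<open>v\<close> and of its image.\<close>

lemma vnorm_shifted_ge:
  assumes sym: "\<And>i j. i < n \<Longrightarrow> j < n \<Longrightarrow> a i j = a j i" and z: "0 < Im z"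
  shows "Im z * vnorm n v \<le> vnorm n (mapply n (shifted a z) v)"
proof -
  define w where "w = mapply n (shifted a z) v"
  define S where "S = (\<Sum>i<n. w i * cnj (v i))"
  define T where "T = (\<Sum>i<n. \<Sum>j<n. of_real (a i j) * v j * cnj (v i))"
  have w: "w i = (\<Sum>j<n. of_real (a i j) * v j) - z * v i" if "i < n" for i
  proof -
    have "(\<Sum>l<n. (if i = l then z else 0) * v l) = (\<Sum>l<n. if i = l then z * v l else 0)"
      by (rule sum.cong) auto
    then show ?thesis using that unfolding w_def mapply_def shifted_def
      by (simp only: left_diff_distrib sum_subtractf) (simp add: sum.delta)
  qed
  have nn: "(\<Sum>i<n. v i * cnj (v i)) = of_real ((vnorm n v)\<^sup>2)"
    by (simp add: vnorm_def L2_set_def sum_nonneg complex_norm_square del: of_real_power)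
  have "S = T - z * of_real ((vnorm n v)\<^sup>2)"
  proof -
    have "S = (\<Sum>i<n. (\<Sum>j<n. of_real (a i j) * v j) * cnj (v i) - z * (v i * cnj (v i)))"
      unfolding S_def by (rule sum.cong) (auto simp: w left_diff_distrib mult.assoc)
    then show ?thesis
      unfolding T_def nn[symmetric] by (simp add: sum_subtractf sum_distrib_left sum_distrib_right)
  qed
  moreover have "cnj T = T"
  proof -
    have "cnj T = (\<Sum>i<n. \<Sum>j<n. of_real (a i j) * cnj (v j) * v i)" by (simp add: T_def)
    also have "\<dots> = (\<Sum>j<n. \<Sum>i<n. of_real (a i j) * cnj (v j) * v i)" by (rule sum.swap)
    also have "\<dots> = T" unfolding T_def by (intro sum.cong) (auto simp: sym)
    finally show ?thesis .
  qed
  then have "Im T = 0" by (simp add: complex_eq_iff)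
  ultimately have "Im S = - Im z * (vnorm n v)\<^sup>2" by simp
  then have "Im z * (vnorm n v)\<^sup>2 \<le> cmod S"
    using abs_Im_le_cmod[of S] z by simp
  also have "cmod S \<le> (\<Sum>i<n. \<bar>cmod (w i)\<bar> * \<bar>cmod (v i)\<bar>)"
    unfolding S_def by (rule order_trans[OF norm_sum]) (simp add: norm_mult)
  also have "\<dots> \<le> vnorm n w * vnorm n v"
    unfolding vnorm_def by (rule L2_set_mult_ineq)
  finally have "(Im z * vnorm n v) * vnorm n v \<le> vnorm n w * vnorm n v"
    by (simp add: power2_eq_square)
  then show ?thesis
    unfolding w_def[symmetric] using vnorm_nonneg[of n v] vnorm_nonneg[of n w]
    by (cases "vnorm n v = 0") auto
qed

text \<open>A null vector of the shifted matrix would contradict the lower bound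
  \<open>vnorm_shifted_ge\<close>.\<close>

lemma shifted_det_nonzero:
  assumes sym: "\<And>i j. i < n \<Longrightarrow> j < n \<Longrightarrow> a i j = a j i" and z: "0 < Im z"
  shows "Determinant.det (mat n n (\<lambda>(i, j). shifted a z i j)) \<noteq> 0"
proof
  let ?H = "mat n n (\<lambda>(i, j). shifted a z i j)"
  assume "Determinant.det ?H = 0"
  then obtain v where v: "v \<in> carrier_vec n" "v \<noteq> 0\<^sub>v n" "?H *\<^sub>v v = 0\<^sub>v n"
    using det_0_iff_vec_prod_zero_field[of ?H n] by auto
  let ?v = "\<lambda>i. vec_index v i"
  have "mapply n (shifted a z) ?v i = 0" if "i < n" for i
  proof -
    have "vec_index (?H *\<^sub>v v) i = 0" using v(3) that by simp
    then show ?thesis using that v(1)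
      by (simp add: mapply_def scalar_prod_def lessThan_atLeast0)
  qed
  then have "vnorm n (mapply n (shifted a z) ?v) = 0"
    by (simp add: vnorm_def L2_set_def)
  then have "vnorm n ?v = 0"
    using vnorm_shifted_ge[where a = a and n = n and z = z and v = ?v, OF sym z] z vnorm_nonneg[of n ?v]
    by (auto simp: mult_le_0_iff)
  then have "vec_index v i = 0" if "i < n" for i
    using that norm_le_vnorm[OF that, of ?v] by simp
  then show False using v(1,2) by (auto intro: eq_vecI)
qed

lemma mat_inverse_shifted:
  assumes sym: "\<And>i j. i < n \<Longrightarrow> j < n \<Longrightarrow> a i j = a j i" and z: "0 < Im z"
  obtains R where "mat_inverse (mat n n (\<lambda>(i, j). shifted a z i j)) = Some R"
    "R \<in> carrier_mat n n" "mat n n (\<lambda>(i, j). shifted a z i j) * R = 1\<^sub>m n"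
    "R * mat n n (\<lambda>(i, j). shifted a z i j) = 1\<^sub>m n"
proof -
  let ?H = "mat n n (\<lambda>(i, j). shifted a z i j)"
  have H: "?H \<in> carrier_mat n n" by simp
  have "?H \<in> Units (ring_mat TYPE(complex) n ())"
    by (rule det_non_zero_imp_unit[OF H shifted_det_nonzero[where a = a, OF sym z]])
  then have "mat_inverse ?H \<noteq> None"
    using mat_inverse(1)[OF H, where b = "()"] by blast
  then obtain R where R: "mat_inverse ?H = Some R" by blast
  show ?thesis using that[OF R] mat_inverse(2)[OF H R] by blast
qed

lemma resolvent_inverse:
  assumes sym: "\<And>i j. i < n \<Longrightarrow> j < n \<Longrightarrow> a i j = a j i" and z: "0 < Im z"
    and ij: "i < n" "j < n"
  shows "mmult n (shifted a z) (resolvent n a z) i j = (if i = j then 1 else 0)"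
    and "mmult n (resolvent n a z) (shifted a z) i j = (if i = j then 1 else 0)"
proof -
  let ?H = "mat n n (\<lambda>(i, j). shifted a z i j)"
  obtain R where R: "mat_inverse ?H = Some R"
    "R \<in> carrier_mat n n" "?H * R = 1\<^sub>m n" "R * ?H = 1\<^sub>m n"
    using mat_inverse_shifted[where a = a, OF sym z] by blast
  have "(?H * R) $$ (i, j) = (if i = j then 1 else 0)" using R(3) ij by simp
  then show "mmult n (shifted a z) (resolvent n a z) i j = (if i = j then 1 else 0)"
    using ij R(1,2) by (simp add: mmult_def resolvent_def scalar_prod_def lessThan_atLeast0)
  have "(R * ?H) $$ (i, j) = (if i = j then 1 else 0)" using R(4) ij by simp
  then show "mmult n (resolvent n a z) (shifted a z) i j = (if i = j then 1 else 0)"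
    using ij R(1,2) by (simp add: mmult_def resolvent_def scalar_prod_def lessThan_atLeast0)
qed

lemma resolvent_outside: "\<not> (i < n \<and> j < n) \<Longrightarrow> resolvent n a z i j = 0"
  by (auto simp: resolvent_def)

text \<open>Cramer's rule. It exhibits the entries of the resolvent as rational functions of the
  matrix, from which their measurability follows.\<close>

lemma resolvent_cofactor:
  assumes sym: "\<And>i j. i < n \<Longrightarrow> j < n \<Longrightarrow> a i j = a j i" and z: "0 < Im z"
    and ij: "i < n" "j < n"
  shows "resolvent n a z i j =
    cofactor (mat n n (\<lambda>(i, j). shifted a z i j)) j i / Determinant.det (mat n n (\<lambda>(i, j). shifted a z i j))"
proof -
  let ?H = "mat n n (\<lambda>(i, j). shifted a z i j)"
  have H: "?H \<in> carrier_mat n n" by simp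
  obtain R where R: "mat_inverse ?H = Some R"
    "R \<in> carrier_mat n n" "?H * R = 1\<^sub>m n" "R * ?H = 1\<^sub>m n"
    using mat_inverse_shifted[where a = a, OF sym z] by blast
  note adj = adj_mat[OF H]
  have "adj_mat ?H = (R * ?H) * adj_mat ?H" using R(4) adj(1) by simp
  also have "\<dots> = R * (?H * adj_mat ?H)" using R(2) H adj(1) by (intro assoc_mult_mat) auto
  also have "\<dots> = Determinant.det ?H \<cdot>\<^sub>m R"
    using R(2) adj(2) by (simp add: mult_smult_distrib[OF R(2), of "1\<^sub>m n" n])
  finally have "adj_mat ?H $$ (i, j) = Determinant.det ?H * R $$ (i, j)"
    using R(2) ij by simp
  moreover have "adj_mat ?H $$ (i, j) = cofactor ?H j i"
    using ij by (simp add: adj_mat_def)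
  ultimately show ?thesis
    using shifted_det_nonzero[where a = a, OF sym z] ij R(1) by (simp add: resolvent_def field_simps)
qed

text \<open>The lower bound for the shifted matrix, applied to the vector \<open>?w\<close> that it
  maps to \<open>v\<close>.\<close>

lemma op_bounded_resolvent:
  assumes sym: "\<And>i j. i < n \<Longrightarrow> j < n \<Longrightarrow> a i j = a j i" and z: "0 < Im z"
  shows "op_bounded n (1 / Im z) (resolvent n a z)"
  unfolding op_bounded_def
proof (intro conjI allI)
  show "0 \<le> 1 / Im z" using z by simp
  fix v
  let ?w = "mapply n (resolvent n a z) v"
  have "mapply n (shifted a z) ?w i = v i" if "i < n" for i
  proof -
    have "mapply n (shifted a z) ?w i = (\<Sum>l<n. mmult n (shifted a z) (resolvent n a z) i l * v l)"
      by (simp add: mapply_mmult[symmetric]) (simp add: mapply_def)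
    also have "\<dots> = (\<Sum>l<n. (if i = l then 1 else 0) * v l)"
      using that by (intro sum.cong) (auto simp: resolvent_inverse[where a = a, OF sym z])
    finally show ?thesis using that by (simp add: if_distrib if_distribR sum.delta cong: if_cong)
  qed
  then have "vnorm n (mapply n (shifted a z) ?w) = vnorm n v"
    by (auto simp: vnorm_def intro: L2_set_cong)
  then have "Im z * vnorm n ?w \<le> vnorm n v"
    using vnorm_shifted_ge[where a = a and n = n and z = z and v = ?w, OF sym z] by simp
  then show "vnorm n ?w \<le> 1 / Im z * vnorm n v" using z by (simp add: field_simps)
qed

text \<open>The difference of the two matrices is that of the shifted ones; multiplied by one
  resolvent from each side it leaves the difference of the resolvents. Iterating this identity
  replaces differentiation of the resolvent.\<close>

lemma resolvent_identity:
  assumes a: "\<And>i j. i < n \<Longrightarrow> j < n \<Longrightarrow> a i j = a j i"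
    and b: "\<And>i j. i < n \<Longrightarrow> j < n \<Longrightarrow> b i j = b j i" and z: "0 < Im z"
  shows "resolvent n b z = (\<lambda>i j. resolvent n a z i j
    - mmult n (resolvent n a z) (mmult n (\<lambda>i j. of_real (b i j - a i j)) (resolvent n b z)) i j)"
proof (intro ext)
  fix i j
  let ?Ga = "resolvent n a z" and ?Gb = "resolvent n b z"
  have D: "(\<lambda>i j. complex_of_real (b i j - a i j)) = (\<lambda>i j. shifted b z i j - shifted a z i j)"
    by (simp add: shifted_def fun_eq_iff)
  show "?Gb i j = ?Ga i j - mmult n ?Ga (mmult n (\<lambda>i j. of_real (b i j - a i j)) ?Gb) i j"
  proof (cases "i < n \<and> j < n")
    case False
    then have "mmult n ?Ga (mmult n (\<lambda>i j. of_real (b i j - a i j)) ?Gb) i j = 0"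
      by (auto simp: mmult_def resolvent_outside)
    with False show ?thesis by (simp add: resolvent_outside)
  next
    case True
    have 1: "mmult n ?Ga (mmult n (shifted b z) ?Gb) i j = ?Ga i j"
    proof -
      have "mmult n ?Ga (mmult n (shifted b z) ?Gb) i j = (\<Sum>l<n. ?Ga i l * (if l = j then 1 else 0))"
        unfolding mmult_def[of n ?Ga] using True
        by (intro sum.cong) (auto simp: resolvent_inverse[where a = b, OF b z])
      then show ?thesis using True by (simp add: if_distrib sum.delta cong: if_cong)
    qed
    have 2: "mmult n ?Ga (mmult n (shifted a z) ?Gb) i j = ?Gb i j"
    proof -
      have "mmult n (mmult n ?Ga (shifted a z)) ?Gb i j = (\<Sum>l<n. (if i = l then 1 else 0) * ?Gb l j)"
        unfolding mmult_def[of n "mmult n ?Ga (shifted a z)"] using True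
        by (intro sum.cong) (auto simp: resolvent_inverse[where a = a, OF a z])
      then show ?thesis using True
        by (simp add: mmult_assoc if_distrib if_distribR sum.delta cong: if_cong)
    qed
    show ?thesis unfolding D mmult_diff_left mmult_diff_right 1 2 by simp
  qed
qed

lemma resolvent_measurable:
  assumes sym: "\<And>\<omega> i j. i < n \<Longrightarrow> j < n \<Longrightarrow> a \<omega> i j = a \<omega> j i" and z: "0 < Im z"
    and meas: "\<And>i j. i < n \<Longrightarrow> j < n \<Longrightarrow> (\<lambda>\<omega>. a \<omega> i j) \<in> borel_measurable J"
  shows "(\<lambda>\<omega>. resolvent n (a \<omega>) z i j) \<in> borel_measurable J"
proof (cases "i < n \<and> j < n")
  case False
  then show ?thesis by (simp add: resolvent_outside)
next
  case True
  let ?H = "\<lambda>\<omega>. mat n n (\<lambda>(i, j). shifted (a \<omega>) z i j)"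
  \<comment> \<open>The Leibniz formula makes a determinant a polynomial in its entries. The size
    \<open>m\<close> is separate from \<open>n\<close> because cofactors are determinants of size
    \<open>n - 1\<close>.\<close>
  have mdet: "(\<lambda>\<omega>. Determinant.det (B \<omega>)) \<in> borel_measurable J"
    if B: "\<And>\<omega>. B \<omega> \<in> carrier_mat m m"
      "\<And>i j. i < m \<Longrightarrow> j < m \<Longrightarrow> (\<lambda>\<omega>. B \<omega> $$ (i, j)) \<in> borel_measurable J"
    for B :: "'a \<Rightarrow> complex mat" and m
  proof -
    have perm: "p i < m" if "p permutes {0..<m}" "i < m" for p i
      using permutes_in_image[OF that(1), of i] that(2) by simp
    show ?thesis unfolding det_def'[OF B(1)]
      by (intro borel_measurable_sum borel_measurable_times borel_measurable_prod borel_measurable_const B(2))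
         (auto simp: perm)
  qed
  have sh: "(\<lambda>\<omega>. shifted (a \<omega>) z k l) \<in> borel_measurable J" if "k < n" "l < n" for k l
    unfolding shifted_def using meas[OF that]
    by (intro borel_measurable_diff borel_measurable_const)
      (auto intro!: borel_measurable_of_real)
  have "(\<lambda>\<omega>. Determinant.det (?H \<omega>)) \<in> borel_measurable J"
    by (rule mdet[of _ n]) (auto simp: sh)
  moreover have "(\<lambda>\<omega>. cofactor (?H \<omega>) j i) \<in> borel_measurable J"
    unfolding cofactor_def
    by (intro borel_measurable_times borel_measurable_const mdet[of _ "n - 1"] mat_delete_carrier)
       (auto simp: mat_delete_def sh)
  ultimately show ?thesis
    using True by (simp add: resolvent_cofactor[where a = "a _", OF sym z])
qed

section \<open>Stieltjes transforms of triangular arrays\<close>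

definition triangle :: "nat \<Rightarrow> (nat \<times> nat) set" where
  "triangle n = {(i, j). 1 \<le> j \<and> j \<le> i \<and> i \<le> n}"

text \<open>Matrix positions are counted from \<open>0\<close>, array indices from \<open>1\<close>.\<close>

definition sym_index :: "nat \<Rightarrow> nat \<Rightarrow> nat \<times> nat" where
  "sym_index i j = (if j \<le> i then (i + 1, j + 1) else (j + 1, i + 1))"

definition scaled_entry :: "nat \<Rightarrow> (nat \<times> nat \<Rightarrow> real) \<Rightarrow> nat \<Rightarrow> nat \<Rightarrow> real" where
  "scaled_entry n x i j = x (sym_index i j) / sqrt (real n)"

definition array_resolvent :: "nat \<Rightarrow> complex \<Rightarrow> (nat \<times> nat \<Rightarrow> real) \<Rightarrow> cmatrix" where
  "array_resolvent n z x = resolvent n (scaled_entry n x) z"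

definition array_stieltjes :: "nat \<Rightarrow> complex \<Rightarrow> (nat \<times> nat \<Rightarrow> real) \<Rightarrow> complex" where
  "array_stieltjes n z x = stieltjes (normalized_array_mat n x) z"

text \<open>The derivative of the symmetric matrix in the array entry \<open>k\<close>, up to the
  factor \<open>1 / sqrt n\<close>: two ones off the diagonal, a single one on it.\<close>

definition sym_unit :: "nat \<times> nat \<Rightarrow> cmatrix" where
  "sym_unit k i j = (if sym_index i j = k then 1 else 0)"

lemma finite_triangle: "finite (triangle n)"
  by (rule finite_subset[of _ "{..n} \<times> {..n}"]) (auto simp: triangle_def)

lemma card_triangle_le: "card (triangle n) \<le> n\<^sup>2"
proof -
  have "card (triangle n) \<le> card ({1..n} \<times> {1..n})"
    by (rule card_mono) (auto simp: triangle_def)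
  then show ?thesis by (simp add: power2_eq_square)
qed

lemma sym_index_in_triangle: "i < n \<Longrightarrow> j < n \<Longrightarrow> sym_index i j \<in> triangle n"
  by (auto simp: sym_index_def triangle_def)

lemma sym_index_in_triangle_iff: "sym_index i j \<in> triangle n \<longleftrightarrow> i < n \<and> j < n"
  by (auto simp: sym_index_def triangle_def)

lemma sym_index_commute: "sym_index i j = sym_index j i"
  by (auto simp: sym_index_def)

lemma scaled_entry_sym: "scaled_entry n x i j = scaled_entry n x j i"
  by (simp add: scaled_entry_def sym_index_commute)

lemma array_stieltjes_eq:
  "array_stieltjes n z x = mtrace n (array_resolvent n z x) / of_nat n"
proof -
  have "map_mat complex_of_real (normalized_array_mat n x) - z \<cdot>\<^sub>m 1\<^sub>m n
      = mat n n (\<lambda>(i, j). shifted (scaled_entry n x) z i j)"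
    by (rule eq_matI)
      (auto simp: normalized_array_mat_def symmetric_array_mat_def shifted_def scaled_entry_def sym_index_def)
  moreover have "dim_row (normalized_array_mat n x) = n"
    by (simp add: normalized_array_mat_def symmetric_array_mat_def)
  ultimately show ?thesis
    by (simp add: array_stieltjes_def stieltjes_def mtrace_def array_resolvent_def resolvent_def)
qed

lemma array_resolvent_cong:
  assumes "\<And>p. p \<in> triangle n \<Longrightarrow> x p = y p"
  shows "array_resolvent n z x = array_resolvent n z y"
proof -
  have "mat n n (\<lambda>(i, j). shifted (scaled_entry n x) z i j) = mat n n (\<lambda>(i, j). shifted (scaled_entry n y) z i j)"
    by (rule eq_matI) (auto simp: shifted_def scaled_entry_def assms sym_index_in_triangle)
  then show ?thesis unfolding array_resolvent_def resolvent_def by (simp only:)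
qed

lemma array_stieltjes_cong:
  "(\<And>p. p \<in> triangle n \<Longrightarrow> x p = y p) \<Longrightarrow> array_stieltjes n z x = array_stieltjes n z y"
  by (simp add: array_stieltjes_eq array_resolvent_cong[of n x y])

lemma op_bounded_array_resolvent: "0 < Im z \<Longrightarrow> op_bounded n (1 / Im z) (array_resolvent n z x)"
  unfolding array_resolvent_def by (rule op_bounded_resolvent) (rule scaled_entry_sym)

text \<open>An array index occurs at no more than two positions, mirror images of each other; for a
  diagonal index they coincide and are counted twice.\<close>

lemma entry_norm_sym_unit: "entry_norm n (sym_unit k) \<le> 2"
proof -
  \<comment> \<open>Positions start at 0 and array indices at 1. An index with a zero coordinate
    occurs at no position, so truncated subtraction does no harm.\<close>
  define p q where "p = fst k - 1" and "q = snd k - 1"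
  have le: "cmod (sym_unit k i j) \<le> (if j = q then if i = p then 1 else 0 else 0)
           + (if j = p then if i = q then 1 else 0 else 0)" for i j
  proof (cases "sym_index i j = k")
    case True
    then have "i = p \<and> j = q \<or> i = q \<and> j = p"
      unfolding p_def q_def sym_index_def by (cases "j \<le> i") auto
    then show ?thesis by (auto simp: sym_unit_def)
  qed (simp add: sym_unit_def)
  have "(\<Sum>i<n. \<Sum>j<n. cmod (sym_unit k i j))
      \<le> (\<Sum>i<n. \<Sum>j<n. (if j = q then if i = p then 1 else 0 else 0)
           + (if j = p then if i = q then 1 else 0 else 0))"
    by (intro sum_mono le)
  also have "\<dots> = (if q < n then if p < n then 1 else 0 else 0) + (if p < n then if q < n then 1 else 0 else 0)"
    by (simp only: sum.distrib sum.delta finite_lessThan lessThan_iff) (simp add: sum.delta)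
  also have "\<dots> \<le> 2" by simp
  finally show ?thesis by (simp add: entry_norm_def)
qed

lemma op_bounded_sym_unit: "op_bounded n 2 (sym_unit k)"
  by (rule op_bounded_mono[OF op_bounded_entry_norm entry_norm_sym_unit])

lemma norm_mtrace_sym_unit:
  assumes "op_bounded n c P" "op_bounded n d Q"
  shows "cmod (mtrace n (mmult n P (mmult n (sym_unit k) Q))) \<le> 2 * (c * d)"
proof -
  have "c * d * entry_norm n (sym_unit k) \<le> c * d * 2"
    using assms by (intro mult_left_mono entry_norm_sym_unit) (auto simp: op_bounded_def)
  then show ?thesis using norm_mtrace_sandwich[OF assms, of "sym_unit k"] by linarith
qed

section \<open>Expansion of the Stieltjes transform in one entry\<close>

lemma array_resolvent_update:
  assumes z: "0 < Im z"
  shows "array_resolvent n z (x(k := t)) = (\<lambda>i j. array_resolvent n z x i j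
    - of_real ((t - x k) / sqrt (real n)) *
      mmult n (array_resolvent n z x) (mmult n (sym_unit k) (array_resolvent n z (x(k := t)))) i j)"
proof -
  have D: "(\<lambda>i j. complex_of_real (scaled_entry n (x(k := t)) i j - scaled_entry n x i j))
      = (\<lambda>i j. of_real ((t - x k) / sqrt (real n)) * sym_unit k i j)"
    by (auto simp: fun_eq_iff scaled_entry_def sym_unit_def diff_divide_distrib)
  show ?thesis
    unfolding array_resolvent_def
    by (subst resolvent_identity[where a = "scaled_entry n x", OF scaled_entry_sym scaled_entry_sym z])
       (simp only: D mmult_scale_left mmult_scale_right)
qed

text \<open>The derivative of the resolvent \<open>G\<close> along \<open>E = sym_unit k\<close> is
  \<open>- G E G\<close>; the denominator collects \<open>n\<close> from the normalized trace and
  \<open>sqrt n\<close> from the scaling. Expanding around the value 0 of entry \<open>k\<close>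
  makes the coefficient independent of that entry.\<close>

definition lin_coeff :: "nat \<Rightarrow> complex \<Rightarrow> nat \<times> nat \<Rightarrow> (nat \<times> nat \<Rightarrow> real) \<Rightarrow> complex" where
  "lin_coeff n z k x = (let G = array_resolvent n z (x(k := 0)) in
     - mtrace n (mmult n G (mmult n (sym_unit k) G)) / of_real (real n * sqrt (real n)))"

text \<open>Half the second derivative in entry \<open>k\<close>.\<close>

definition quad_coeff :: "nat \<Rightarrow> complex \<Rightarrow> nat \<times> nat \<Rightarrow> (nat \<times> nat \<Rightarrow> real) \<Rightarrow> complex" where
  "quad_coeff n z k x = (let G = array_resolvent n z (x(k := 0)) in
     mtrace n (mmult n G (mmult n (sym_unit k) (mmult n G (mmult n (sym_unit k) G))))
       / of_real ((real n)\<^sup>2))"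

text \<open>One constant for all estimates. The first summand bounds the first order trace, the
  second is twice the bound \<open>4 / (Im z)^3\<close> for the second order trace, and the third is
  three times the bound \<open>8 / (Im z)^4\<close> for traces with one more resolvent.\<close>

definition coeff_bound :: "complex \<Rightarrow> real" where
  "coeff_bound z = 2 / (Im z)^2 + 8 / (Im z)^3 + 24 / (Im z)^4"

text \<open>The scale of every truncation error: a cubic Taylor remainder below the level
  \<open>sqrt n\<close>, a quadratic one above it.\<close>

definition trunc_square :: "nat \<Rightarrow> real \<Rightarrow> real" where
  "trunc_square n t = t\<^sup>2 * min 1 (\<bar>t\<bar> / sqrt (real n))"

lemma coeff_bound_ge:
  assumes "0 < Im z"
  shows "2 / (Im z)^2 \<le> coeff_bound z" "8 / (Im z)^3 \<le> coeff_bound z" "24 / (Im z)^4 \<le> coeff_bound z"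
    "0 < coeff_bound z"
  using assms by (auto simp: coeff_bound_def intro!: add_pos_pos)

lemma norm_lin_coeff:
  assumes z: "0 < Im z" and n: "0 < n"
  shows "cmod (lin_coeff n z k x) \<le> coeff_bound z / (real n * sqrt (real n))"
proof -
  have "cmod (lin_coeff n z k x) \<le> 2 * (1 / Im z * (1 / Im z)) / (real n * sqrt (real n))"
  proof -
    let ?G = "array_resolvent n z (x(k := 0))"
    note G = op_bounded_array_resolvent[OF z, of n "x(k := 0)"]
    have "cmod (lin_coeff n z k x) = cmod (mtrace n (mmult n ?G (mmult n (sym_unit k) ?G))) / (real n * sqrt (real n))"
      by (simp add: lin_coeff_def Let_def norm_divide norm_mult)
    also have "\<dots> \<le> 2 * (1 / Im z * (1 / Im z)) / (real n * sqrt (real n))"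
      by (intro divide_right_mono norm_mtrace_sym_unit G) simp
    finally show ?thesis .
  qed
  also have "\<dots> \<le> coeff_bound z / (real n * sqrt (real n))"
    using coeff_bound_ge(1)[OF z] by (intro divide_right_mono) (auto simp: power2_eq_square)
  finally show ?thesis .
qed

lemma norm_quad_coeff:
  assumes z: "0 < Im z" and n: "0 < n"
  shows "cmod (quad_coeff n z k x) \<le> coeff_bound z / (real n)\<^sup>2"
proof -
  let ?G = "array_resolvent n z (x(k := 0))"
  note G = op_bounded_array_resolvent[OF z, of n "x(k := 0)"]
  have "cmod (quad_coeff n z k x) \<le> 2 * (1 / Im z * (1 / Im z * (2 * (1 / Im z)))) / (real n)\<^sup>2"
  proof -
    have "cmod (quad_coeff n z k x) = cmod (mtrace n (mmult n ?G (mmult n (sym_unit k)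
        (mmult n ?G (mmult n (sym_unit k) ?G))))) / (real n)\<^sup>2"
      by (simp add: quad_coeff_def Let_def norm_divide norm_power)
    moreover have "cmod (mtrace n (mmult n ?G (mmult n (sym_unit k) (mmult n ?G (mmult n (sym_unit k) ?G)))))
        \<le> 2 * (1 / Im z * (1 / Im z * (2 * (1 / Im z))))"
      by (rule norm_mtrace_sym_unit[OF G op_bounded_mmult[OF G op_bounded_mmult[OF op_bounded_sym_unit G]]])
    ultimately show ?thesis by (simp only: divide_right_mono zero_le_power2)
  qed
  also have "2 * (1 / Im z * (1 / Im z * (2 * (1 / Im z)))) = 4 / (Im z)^3"
    by (simp add: power3_eq_cube)
  also have "\<dots> \<le> 8 / (Im z)^3" using z by (intro divide_right_mono) auto
  also have "\<dots> \<le> coeff_bound z" by (rule coeff_bound_ge(2)[OF z])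
  finally show ?thesis by (simp add: divide_right_mono)
qed

text \<open>The resolvent identity yields exact remainders. With \<open>s = t / sqrt n\<close>, one
  form of the remainder is \<open>s\<^sup>2\<close> times a difference of two traces, the other is
  \<open>s\<^sup>3\<close> times a single trace. Using the better bound for each \<open>t\<close>
  gives \<open>trunc_square\<close>, so that moments little beyond the second suffice.\<close>

lemma array_stieltjes_taylor:
  assumes z: "0 < Im z" and n: "0 < n"
  shows "cmod (array_stieltjes n z (x(k := t)) - array_stieltjes n z (x(k := 0))
      - lin_coeff n z k x * of_real t - quad_coeff n z k x * of_real (t\<^sup>2))
    \<le> coeff_bound z / (real n)\<^sup>2 * trunc_square n t"
proof -
  define E where "E = sym_unit k"
  define G where "G = array_resolvent n z (x(k := 0))"
  define H where "H = array_resolvent n z (x(k := t))"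
  define r where "r = sqrt (real n)"
  define s where "s = complex_of_real (t / r)"
  define y where "y = Im z"
  have r: "0 < r" "r * r = real n" using n by (auto simp: r_def)
  have nr: "(real n)\<^sup>2 = r ^ 4" unfolding r(2)[symmetric] by (simp add: power4_eq_xxxx power2_eq_square)
  have y: "0 < y" using z by (simp add: y_def)
  \<comment> \<open>\<open>U1\<close>, \<open>U2\<close>, \<open>U3\<close> end in the resolvent
    \<open>H\<close> at \<open>t\<close>, while \<open>V1\<close>, \<open>V2\<close> contain only
    the resolvent \<open>G\<close> at 0. Each of \<open>U1\<close>, \<open>U2\<close> equals the
    matching \<open>V\<close> up to \<open>s\<close> times the next \<open>U\<close>.\<close>
  define U1 where "U1 = mmult n G (mmult n E H)"
  define U2 where "U2 = mmult n G (mmult n E U1)"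
  define U3 where "U3 = mmult n G (mmult n E U2)"
  define V1 where "V1 = mmult n G (mmult n E G)"
  define V2 where "V2 = mmult n G (mmult n E V1)"
  have H: "H = (\<lambda>i j. G i j - s * U1 i j)"
    using array_resolvent_update[OF z, of n "x(k := 0)" k t]
    by (simp add: H_def G_def U1_def E_def s_def r_def)
  have U1: "U1 = (\<lambda>i j. V1 i j - s * U2 i j)"
    unfolding U2_def V1_def by (subst U1_def, subst H) (simp only: mmult_diff_right mmult_scale_right)
  have U2: "U2 = (\<lambda>i j. V2 i j - s * U3 i j)"
    unfolding U3_def V2_def by (subst U2_def, subst U1) (simp only: mmult_diff_right mmult_scale_right)
  have tH: "mtrace n H = mtrace n G - s * mtrace n U1"
    by (subst H) (simp only: mtrace_diff mtrace_scale)
  have t1: "mtrace n U1 = mtrace n V1 - s * mtrace n U2"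
    by (subst U1) (simp only: mtrace_diff mtrace_scale)
  have t2: "mtrace n U2 = mtrace n V2 - s * mtrace n U3"
    by (subst U2) (simp only: mtrace_diff mtrace_scale)
  define Rem where "Rem = array_stieltjes n z (x(k := t)) - array_stieltjes n z (x(k := 0))
      - lin_coeff n z k x * of_real t - quad_coeff n z k x * of_real (t\<^sup>2)"
  have lin: "lin_coeff n z k x * of_real t = - s * mtrace n V1 / of_nat n"
    unfolding lin_coeff_def Let_def G_def[symmetric] E_def[symmetric] V1_def[symmetric] r_def[symmetric] s_def
    using r by (simp add: field_simps)
  have quad: "quad_coeff n z k x * of_real (t\<^sup>2) = s\<^sup>2 * mtrace n V2 / of_nat n"
  proof -
    have "quad_coeff n z k x = mtrace n V2 / of_real ((real n)\<^sup>2)"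
      unfolding quad_coeff_def Let_def G_def[symmetric] E_def[symmetric] V1_def[symmetric] V2_def[symmetric] ..
    moreover have "of_real (t\<^sup>2) = s\<^sup>2 * of_nat n"
    proof -
      have "t\<^sup>2 = (t / r)\<^sup>2 * real n" using r by (simp add: power_divide power2_eq_square flip: r(2))
      then show ?thesis unfolding s_def by (metis of_real_mult of_real_of_nat_eq of_real_power)
    qed
    ultimately show ?thesis using n by (simp add: power2_eq_square)
  qed
  have Rem: "Rem = (mtrace n H - mtrace n G + s * mtrace n V1 - s\<^sup>2 * mtrace n V2) / of_nat n"
    unfolding Rem_def lin quad by (simp add: array_stieltjes_eq G_def H_def diff_divide_distrib add_divide_distrib)
  have Rem2: "Rem = s\<^sup>2 * (mtrace n U2 - mtrace n V2) / of_nat n"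
    unfolding Rem tH t1 by (simp add: algebra_simps power2_eq_square)
  have Rem3: "Rem = - (s^3 * mtrace n U3) / of_nat n"
    unfolding Rem2 t2 by (simp add: algebra_simps power2_eq_square power3_eq_cube)
  have s: "cmod s = \<bar>t\<bar> / r" using r by (simp add: s_def norm_divide)
  have opG: "op_bounded n (1 / y) G" "op_bounded n (1 / y) H"
    using op_bounded_array_resolvent[OF z] by (auto simp: G_def H_def y_def)
  have opE: "op_bounded n 2 E" by (simp add: E_def op_bounded_sym_unit)
  have opU1: "op_bounded n (1/y * (2 * (1/y))) U1" and opV1: "op_bounded n (1/y * (2 * (1/y))) V1"
    unfolding U1_def V1_def by (intro op_bounded_mmult opG opE)+
  have opU2: "op_bounded n (1/y * (2 * (1/y * (2 * (1/y))))) U2"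
    unfolding U2_def by (intro op_bounded_mmult opG opE opU1)
  have bU2: "cmod (mtrace n U2) \<le> 4 / y^3"
    using norm_mtrace_sym_unit[OF opG(1) opU1, of k] by (simp add: U2_def E_def power3_eq_cube)
  have bV2: "cmod (mtrace n V2) \<le> 4 / y^3"
    using norm_mtrace_sym_unit[OF opG(1) opV1, of k] by (simp add: V2_def E_def power3_eq_cube)
  have bU3: "cmod (mtrace n U3) \<le> 8 / y^4"
    using norm_mtrace_sym_unit[OF opG(1) opU2, of k] by (simp add: U3_def E_def power4_eq_xxxx)
  have "cmod Rem \<le> (\<bar>t\<bar> / r)\<^sup>2 * (8 / y^3) / real n"
  proof -
    have "cmod (mtrace n U2 - mtrace n V2) \<le> 8 / y^3"
      using norm_triangle_ineq4[of "mtrace n U2" "mtrace n V2"] bU2 bV2 by simp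
    then have "(\<bar>t\<bar> / r)\<^sup>2 * cmod (mtrace n U2 - mtrace n V2) / real n \<le> (\<bar>t\<bar> / r)\<^sup>2 * (8 / y^3) / real n"
      by (intro divide_right_mono mult_left_mono) auto
    then show ?thesis unfolding Rem2 norm_divide norm_mult norm_power s by simp
  qed
  also have "\<dots> \<le> (\<bar>t\<bar> / r)\<^sup>2 * coeff_bound z / real n"
    using coeff_bound_ge[OF z] by (intro divide_right_mono mult_left_mono) (auto simp: y_def)
  also have "\<dots> = coeff_bound z / (real n)\<^sup>2 * (t\<^sup>2 * 1)"
    using r n by (simp add: field_simps power2_eq_square)
  finally have 1: "cmod Rem \<le> coeff_bound z / (real n)\<^sup>2 * (t\<^sup>2 * 1)" .
  have "cmod Rem \<le> (\<bar>t\<bar> / r)^3 * (8 / y^4) / real n"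
  proof -
    have "(\<bar>t\<bar> / r)^3 * cmod (mtrace n U3) / real n \<le> (\<bar>t\<bar> / r)^3 * (8 / y^4) / real n"
      using r bU3 by (intro divide_right_mono mult_left_mono) auto
    then show ?thesis unfolding Rem3 norm_divide norm_minus_cancel norm_mult norm_power s by simp
  qed
  also have "\<dots> \<le> (\<bar>t\<bar> / r)^3 * coeff_bound z / real n"
  proof -
    have "8 / y^4 \<le> 24 / y^4" using y by (intro divide_right_mono) auto
    also have "\<dots> \<le> coeff_bound z" using coeff_bound_ge(3)[OF z] by (simp add: y_def)
    finally show ?thesis using r by (intro divide_right_mono mult_left_mono) auto
  qed
  also have "\<dots> = coeff_bound z / (real n)\<^sup>2 * (t\<^sup>2 * (\<bar>t\<bar> / r))"
  proof -
    have "(\<bar>t\<bar> / r)^3 = t\<^sup>2 * \<bar>t\<bar> / r ^ 3"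
      unfolding power_divide by (simp add: power3_eq_cube power2_eq_square)
    then show ?thesis unfolding nr r(2)[symmetric] using r(1)
      by (simp add: power3_eq_cube power4_eq_xxxx power2_eq_square mult_ac)
  qed
  finally have 2: "cmod Rem \<le> coeff_bound z / (real n)\<^sup>2 * (t\<^sup>2 * (\<bar>t\<bar> / r))" .
  show ?thesis unfolding Rem_def[symmetric] trunc_square_def r_def[symmetric] using 1 2
    unfolding min_def by (split if_split) blast
qed

lemma norm_add3_le:
  fixes a b c :: complex
  assumes "cmod a \<le> u" "cmod b \<le> u" "cmod c \<le> u"
  shows "cmod (a + b + c) \<le> 3 * u"
  using norm_triangle_ineq[of "a + b" c] norm_triangle_ineq[of a b] assms by linarith

text \<open>Only the three resolvents depend on entry \<open>m\<close>. Replacing them one at a time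
  leaves three traces, each with one difference of resolvents, which is of order
  \<open>\<bar>x m\<bar> / sqrt n\<close>. The alternative 1 in the minimum comes from bounding the
  two traces separately.\<close>

lemma norm_quad_coeff_diff:
  assumes z: "0 < Im z" and n: "0 < n"
  shows "cmod (quad_coeff n z k x - quad_coeff n z k (x(m := 0)))
    \<le> coeff_bound z / (real n)\<^sup>2 * min 1 (\<bar>x m\<bar> / sqrt (real n))"
proof (cases "m = k")
  case True
  then show ?thesis using coeff_bound_ge(4)[OF z] by (simp add: quad_coeff_def Let_def)
next
  case False
  define E where "E = sym_unit k"
  define G where "G = array_resolvent n z (x(k := 0))"
  define H where "H = array_resolvent n z (x(m := 0, k := 0))"
  define y where "y = Im z"
  have y: "0 < y" using z by (simp add: y_def)
  define b where "b = \<bar>x m\<bar> / sqrt (real n)"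
  have b: "0 \<le> b" by (simp add: b_def)
  define D where "D = (\<lambda>i j. G i j - H i j)"
  have opG: "op_bounded n (1 / y) G" "op_bounded n (1 / y) H"
    using op_bounded_array_resolvent[OF z] by (auto simp: G_def H_def y_def)
  have opE: "op_bounded n 2 E" by (simp add: E_def op_bounded_sym_unit)
  have opD: "op_bounded n (b * (1 / y * (2 * (1 / y)))) D"
  proof -
    define U where "U = mmult n G (mmult n (sym_unit m) H)"
    define c where "c = complex_of_real ((0 - x m) / sqrt (real n))"
    have "H = (\<lambda>i j. G i j - c * U i j)"
      using array_resolvent_update[OF z, of n "x(k := 0)" m 0] False
      by (simp add: H_def G_def U_def c_def fun_upd_twist)
    then have "D = (\<lambda>i j. c * U i j)" unfolding D_def by simp
    moreover have "cmod c = b" by (simp add: b_def c_def norm_divide)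
    moreover have "op_bounded n (1 / y * (2 * (1 / y))) U"
      unfolding U_def by (intro op_bounded_mmult opG op_bounded_sym_unit)
    ultimately show ?thesis using op_bounded_scale by metis
  qed
  let ?t = "mtrace n"
  have d1: "?t (mmult n D X) = ?t (mmult n G X) - ?t (mmult n H X)" for X
    unfolding D_def by (simp only: mmult_diff_left mtrace_diff)
  have d2: "?t (mmult n H (mmult n E (mmult n D X)))
      = ?t (mmult n H (mmult n E (mmult n G X))) - ?t (mmult n H (mmult n E (mmult n H X)))" for X
    unfolding D_def by (simp only: mmult_diff_left mmult_diff_right mtrace_diff)
  have d3: "?t (mmult n H (mmult n E (mmult n H (mmult n E D))))
      = ?t (mmult n H (mmult n E (mmult n H (mmult n E G)))) - ?t (mmult n H (mmult n E (mmult n H (mmult n E H))))"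
    unfolding D_def by (simp only: mmult_diff_right mtrace_diff)
  have e: "?t (mmult n G (mmult n E (mmult n G (mmult n E G)))) - ?t (mmult n H (mmult n E (mmult n H (mmult n E H))))
      = ?t (mmult n D (mmult n E (mmult n G (mmult n E G)))) + ?t (mmult n H (mmult n E (mmult n D (mmult n E G))))
        + ?t (mmult n H (mmult n E (mmult n H (mmult n E D))))"
    unfolding d3 d2 d1 by simp
  have n1: "cmod (?t (mmult n D (mmult n E (mmult n G (mmult n E G))))) \<le> 8 * b / y^4"
    using norm_mtrace_sym_unit[OF opD op_bounded_mmult[OF opG(1) op_bounded_mmult[OF opE opG(1)]], of k]
    by (simp add: E_def power4_eq_xxxx)
  have n2: "cmod (?t (mmult n H (mmult n E (mmult n D (mmult n E G))))) \<le> 8 * b / y^4"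
    using norm_mtrace_sym_unit[OF opG(2) op_bounded_mmult[OF opD op_bounded_mmult[OF opE opG(1)]], of k]
    by (simp add: E_def power4_eq_xxxx)
  have n3: "cmod (?t (mmult n H (mmult n E (mmult n H (mmult n E D))))) \<le> 8 * b / y^4"
    using norm_mtrace_sym_unit[OF opG(2) op_bounded_mmult[OF opG(2) op_bounded_mmult[OF opE opD]], of k]
    by (simp add: E_def power4_eq_xxxx)
  have A: "cmod (?t (mmult n G (mmult n E (mmult n G (mmult n E G))))
      - ?t (mmult n H (mmult n E (mmult n H (mmult n E H))))) \<le> 24 / y^4 * b"
    unfolding e using norm_add3_le[OF n1 n2 n3] by simp
  have "cmod (?t (mmult n P (mmult n E (mmult n P (mmult n E P))))) \<le> 4 / y^3" if "op_bounded n (1 / y) P" for P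
    using norm_mtrace_sym_unit[OF that op_bounded_mmult[OF that op_bounded_mmult[OF opE that]], of k]
    by (simp add: E_def power3_eq_cube)
  from this[OF opG(1)] this[OF opG(2)]
  have B: "cmod (?t (mmult n G (mmult n E (mmult n G (mmult n E G))))
      - ?t (mmult n H (mmult n E (mmult n H (mmult n E H))))) \<le> 8 / y^3"
    using norm_triangle_ineq4[of "?t (mmult n G (mmult n E (mmult n G (mmult n E G))))"
      "?t (mmult n H (mmult n E (mmult n H (mmult n E H))))"] by linarith
  have "cmod (?t (mmult n G (mmult n E (mmult n G (mmult n E G))))
      - ?t (mmult n H (mmult n E (mmult n H (mmult n E H))))) \<le> coeff_bound z * min 1 b"
    using A B coeff_bound_ge[OF z] mult_right_mono[OF coeff_bound_ge(3)[OF z] b]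
    by (auto simp: min_def y_def)
  then have "cmod (?t (mmult n G (mmult n E (mmult n G (mmult n E G))))
      - ?t (mmult n H (mmult n E (mmult n H (mmult n E H))))) / (real n)\<^sup>2
      \<le> coeff_bound z * min 1 b / (real n)\<^sup>2" by (rule divide_right_mono) simp
  then show ?thesis
    unfolding quad_coeff_def Let_def G_def[symmetric] H_def[symmetric] E_def[symmetric] b_def[symmetric]
      diff_divide_distrib[symmetric] norm_divide norm_of_real by simp
qed

section \<open>Measurability of the transform and of its coefficients\<close>

lemma array_resolvent_measurable:
  assumes z: "0 < Im z" and "\<And>p. p \<in> triangle n \<Longrightarrow> (\<lambda>\<omega>. x \<omega> p) \<in> borel_measurable J"
  shows "(\<lambda>\<omega>. array_resolvent n z (x \<omega>) i j) \<in> borel_measurable J"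
  unfolding array_resolvent_def using assms(2)
  by (intro resolvent_measurable scaled_entry_sym z)
     (auto simp: scaled_entry_def sym_index_in_triangle intro!: borel_measurable_divide)

lemma array_stieltjes_measurable:
  assumes "0 < Im z" and "\<And>p. p \<in> triangle n \<Longrightarrow> (\<lambda>\<omega>. x \<omega> p) \<in> borel_measurable J"
  shows "(\<lambda>\<omega>. array_stieltjes n z (x \<omega>)) \<in> borel_measurable J"
  unfolding array_stieltjes_eq mtrace_def
  by (intro borel_measurable_divide borel_measurable_sum borel_measurable_const
      array_resolvent_measurable[OF assms])

lemma array_resolvent_zero_measurable:
  assumes "0 < Im z" and "\<And>p. p \<in> triangle n \<Longrightarrow> (\<lambda>\<omega>. x \<omega> p) \<in> borel_measurable J"
  shows "(\<lambda>\<omega>. array_resolvent n z ((x \<omega>)(k := 0)) i j) \<in> borel_measurable J"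
proof (rule array_resolvent_measurable[OF assms(1)])
  fix p assume "p \<in> triangle n"
  then show "(\<lambda>\<omega>. ((x \<omega>)(k := 0)) p) \<in> borel_measurable J"
    using assms(2) by (cases "p = k") auto
qed

lemma lin_coeff_measurable:
  assumes "0 < Im z" and "\<And>p. p \<in> triangle n \<Longrightarrow> (\<lambda>\<omega>. x \<omega> p) \<in> borel_measurable J"
  shows "(\<lambda>\<omega>. lin_coeff n z k (x \<omega>)) \<in> borel_measurable J"
  unfolding lin_coeff_def Let_def mtrace_def mmult_def
  by (intro borel_measurable_divide borel_measurable_sum borel_measurable_const borel_measurable_times
      borel_measurable_uminus array_resolvent_zero_measurable[OF assms])

lemma quad_coeff_measurable:
  assumes "0 < Im z" and "\<And>p. p \<in> triangle n \<Longrightarrow> (\<lambda>\<omega>. x \<omega> p) \<in> borel_measurable J"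
  shows "(\<lambda>\<omega>. quad_coeff n z k (x \<omega>)) \<in> borel_measurable J"
  unfolding quad_coeff_def Let_def mtrace_def mmult_def
  by (intro borel_measurable_divide borel_measurable_sum borel_measurable_const borel_measurable_times
      array_resolvent_zero_measurable[OF assms])

section \<open>Comparison of different dimensions\<close>

lemma sum_sym_index_le:
  fixes g :: "nat \<times> nat \<Rightarrow> real"
  assumes "\<And>p. 0 \<le> g p"
  shows "(\<Sum>i<n. \<Sum>j<n. g (sym_index i j)) \<le> 2 * (\<Sum>p\<in>triangle n. g p)"
proof -
  let ?S = "{..<n} \<times> {..<n}"
  let ?A = "{p \<in> ?S. snd p \<le> fst p}" and ?B = "{p \<in> ?S. fst p \<le> snd p}"
  let ?h = "\<lambda>p. sym_index (fst p) (snd p)"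
  have "(\<Sum>i<n. \<Sum>j<n. g (sym_index i j)) = (\<Sum>p\<in>?S. g (?h p))"
    by (simp add: sum.cartesian_product case_prod_unfold)
  also have "\<dots> = (\<Sum>p\<in>?A \<union> ?B. g (?h p))"
    by (rule sum.cong) auto
  \<comment> \<open>The diagonal belongs to both halves, hence only an inequality.\<close>
  also have "\<dots> \<le> (\<Sum>p\<in>?A. g (?h p)) + (\<Sum>p\<in>?B. g (?h p))"
  proof -
    have "0 \<le> (\<Sum>p\<in>?A \<inter> ?B. g (?h p))" by (intro sum_nonneg assms)
    then show ?thesis using sum.union_inter[of ?A ?B "\<lambda>p. g (?h p)"] by simp
  qed
  also have "(\<Sum>p\<in>?A. g (?h p)) = sum g (?h ` ?A)"
    by (subst sum.reindex) (auto simp: inj_on_def sym_index_def split: if_splits)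
  also have "\<dots> \<le> (\<Sum>p\<in>triangle n. g p)"
    using assms by (intro sum_mono2 finite_triangle) (auto simp: sym_index_in_triangle)
  also have "(\<Sum>p\<in>?B. g (?h p)) = sum g (?h ` ?B)"
    by (subst sum.reindex) (auto simp: inj_on_def sym_index_def split: if_splits)
  also have "\<dots> \<le> (\<Sum>p\<in>triangle n. g p)"
    using assms by (intro sum_mono2 finite_triangle) (auto simp: sym_index_in_triangle)
  finally show ?thesis by simp
qed

text \<open>The padded matrix is block diagonal, so its resolvent consists of the small resolvent
  and of \<open>- 1 / z\<close> on the remaining diagonal.\<close>

lemma mtrace_resolvent_padded:
  assumes b: "\<And>i j. i < n \<Longrightarrow> j < n \<Longrightarrow> b i j = b j i" and z: "0 < Im z" and nN: "n \<le> N"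
  shows "mtrace N (resolvent N (\<lambda>i j. if i < n \<and> j < n then b i j else 0) z)
    = mtrace n (resolvent n b z) - of_nat (N - n) / z"
proof -
  have z0: "z \<noteq> 0" using z by auto
  let ?a = "\<lambda>i j. if i < n \<and> j < n then b i j else 0"
  have a: "?a i j = ?a j i" for i j using b by auto
  define \<Gamma> where "\<Gamma> = (\<lambda>i j. if i < n \<and> j < n then resolvent n b z i j
     else if i = j then - 1 / z else 0)"
  have inv: "mmult N (shifted ?a z) \<Gamma> i j = (if i = j then 1 else 0)" if "i < N" "j < N" for i j
  proof (cases "i < n")
    case True
    have "mmult N (shifted ?a z) \<Gamma> i j = (\<Sum>l\<in>{..<n} \<union> {n..<N}. shifted ?a z i l * \<Gamma> l j)"
      unfolding mmult_def using nN by (intro sum.cong) auto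
    also have "\<dots> = (\<Sum>l<n. shifted ?a z i l * \<Gamma> l j) + (\<Sum>l=n..<N. shifted ?a z i l * \<Gamma> l j)"
      by (rule sum.union_disjoint) auto
    also have "(\<Sum>l=n..<N. shifted ?a z i l * \<Gamma> l j) = 0"
      using True by (intro sum.neutral) (auto simp: shifted_def)
    also have "(\<Sum>l<n. shifted ?a z i l * \<Gamma> l j) = (if j < n then mmult n (shifted b z) (resolvent n b z) i j else 0)"
      using True by (auto simp: mmult_def \<Gamma>_def shifted_def intro!: sum.cong)
    finally show ?thesis using True resolvent_inverse(1)[where a = b and n = n, OF b z True] by auto
  next
    case False
    have "mmult N (shifted ?a z) \<Gamma> i j = (\<Sum>l<N. if l = i then - z * \<Gamma> l j else 0)"
      unfolding mmult_def using False by (intro sum.cong) (auto simp: shifted_def)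
    also have "\<dots> = - z * \<Gamma> i j" using that by (simp add: sum.delta)
    finally show ?thesis using False z0 by (simp add: \<Gamma>_def)
  qed
  \<comment> \<open>The right inverse \<open>\<Gamma>\<close> agrees with the resolvent, which is a
    left inverse.\<close>
  have eq: "resolvent N ?a z i j = \<Gamma> i j" if "i < N" "j < N" for i j
  proof -
    have "resolvent N ?a z i j = (\<Sum>l<N. resolvent N ?a z i l * (if l = j then 1 else 0))"
      using that by (simp add: if_distrib sum.delta cong: if_cong)
    also have "\<dots> = mmult N (resolvent N ?a z) (mmult N (shifted ?a z) \<Gamma>) i j"
      unfolding mmult_def[of N "resolvent N ?a z"] using that by (intro sum.cong) (auto simp: inv)
    also have "\<dots> = mmult N (mmult N (resolvent N ?a z) (shifted ?a z)) \<Gamma> i j"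
      by (simp add: mmult_assoc)
    also have "\<dots> = (\<Sum>l<N. (if i = l then 1 else 0) * \<Gamma> l j)"
      unfolding mmult_def[of N "mmult N (resolvent N ?a z) (shifted ?a z)"]
      using that by (intro sum.cong refl) (simp add: resolvent_inverse(2)[where a = ?a, OF a z])
    also have "\<dots> = \<Gamma> i j" using that by (simp add: if_distrib if_distribR sum.delta cong: if_cong)
    finally show ?thesis .
  qed
  have "mtrace N (resolvent N ?a z) = (\<Sum>i\<in>{..<n} \<union> {n..<N}. \<Gamma> i i)"
    unfolding mtrace_def using nN by (intro sum.cong) (auto simp: eq)
  also have "\<dots> = (\<Sum>i<n. \<Gamma> i i) + (\<Sum>i=n..<N. \<Gamma> i i)"
    by (rule sum.union_disjoint) auto
  also have "\<dots> = mtrace n (resolvent n b z) - of_nat (N - n) / z"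
    by (simp add: \<Gamma>_def mtrace_def)
  finally show ?thesis .
qed

text \<open>The smaller matrix is padded with zeros to dimension \<open>N\<close>. Comparing the two
  resolvents of size \<open>N\<close> in Hilbert-Schmidt norm gives the square root; the change of
  normalization and the \<open>N - n\<close> added zero eigenvalues contribute
  \<open>(1 - n / N) / Im z\<close> each.\<close>

lemma array_stieltjes_dimension:
  fixes x :: "nat \<times> nat \<Rightarrow> real"
  assumes z: "0 < Im z" and n: "0 < n" and nN: "n \<le> N"
  defines "Q \<equiv> \<lambda>n. \<Sum>p\<in>triangle n. (x p)\<^sup>2"
  shows "cmod (array_stieltjes N z x - array_stieltjes n z x)
    \<le> 2 * (1 - real n / real N) / Im z
      + sqrt (2 * ((real N / real n - 1) * Q n + (Q N - Q n))) / (real N * (Im z)\<^sup>2)"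
proof -
  define y where "y = Im z"
  have y: "0 < y" using z by (simp add: y_def)
  have N: "0 < N" using n nN by simp
  let ?b = "\<lambda>i j. if i < n \<and> j < n then scaled_entry n x i j else 0"
  define GN where "GN = array_resolvent N z x"
  define GP where "GP = resolvent N ?b z"
  define Gn where "Gn = array_resolvent n z x"
  define D where "D = (\<lambda>i j. complex_of_real (?b i j - scaled_entry N x i j))"
  define S where "S = (\<Sum>i<N. \<Sum>j<N. (cmod (D i j))\<^sup>2)"
  have bsym: "?b i j = ?b j i" for i j by (simp add: scaled_entry_sym)
  have opN: "op_bounded N (1 / y) GN" unfolding GN_def y_def by (rule op_bounded_array_resolvent[OF z])
  have opP: "op_bounded N (1 / y) GP" unfolding GP_def y_def
    by (rule op_bounded_resolvent[where a = ?b, OF bsym z])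
  have opn: "op_bounded n (1 / y) Gn" unfolding Gn_def y_def by (rule op_bounded_array_resolvent[OF z])
  have tP: "mtrace N GP = mtrace n Gn - of_nat (N - n) / z"
    unfolding GP_def Gn_def array_resolvent_def
    by (rule mtrace_resolvent_padded[OF _ z nN]) (rule scaled_entry_sym)
  have "mtrace N GP = mtrace N GN - mtrace N (mmult N GN (mmult N D GP))"
    unfolding mtrace_diff[symmetric] GP_def GN_def array_resolvent_def D_def
    by (subst resolvent_identity[where a = "scaled_entry N x" and b = ?b, OF scaled_entry_sym bsym z]) (rule refl)
  moreover have "mtrace N (mmult N GN (mmult N D GP)) = mtrace N (mmult N (mmult N GP GN) D)"
    by (metis mmult_assoc mtrace_comm)
  ultimately have "cmod (mtrace N GN - mtrace N GP) \<le> 1 / y * (1 / y) * sqrt (real N) * sqrt S"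
    using norm_mtrace_hs[OF op_bounded_mmult[OF opP opN], of D] by (simp add: S_def)
  then have "cmod (mtrace N GN - mtrace N GP) / real N \<le> 1 / y * (1 / y) * sqrt (real N) * sqrt S / real N"
    by (rule divide_right_mono) simp
  also have "\<dots> = sqrt (N * S) / (real N * y\<^sup>2)"
    by (simp add: real_sqrt_mult power2_eq_square)
  also have "N * S \<le> 2 * ((real N / real n - 1) * Q n + (Q N - Q n))"
  proof -
    \<comment> \<open>\<open>g\<close> dominates the squared entries of the difference. A common
      entry is scaled by \<open>u = 1 / sqrt n\<close> in one matrix and by
      \<open>v = 1 / sqrt N\<close> in the other, and
      \<open>(u - v)\<^sup>2 \<le> u\<^sup>2 - v\<^sup>2\<close> because
      \<open>0 \<le> v \<le> u\<close>. An entry outside the smaller triangle occurs only with the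
      factor \<open>v\<close>.\<close>
    define g where "g = (\<lambda>p. (x p)\<^sup>2 * (if p \<in> triangle n then 1 / real n - 1 / real N else 1 / real N))"
    have rN: "1 / real N \<le> 1 / real n" using n nN by (simp add: field_simps)
    have g0: "0 \<le> g p" for p using rN by (auto simp: g_def)
    define u v where "u = 1 / sqrt (real n)" and "v = 1 / sqrt (real N)"
    have uv: "0 \<le> v" "v \<le> u" "u\<^sup>2 = 1 / real n" "v\<^sup>2 = 1 / real N"
      using n nN by (auto simp: u_def v_def power_divide frac_le)
    have "v * v \<le> v * u" using uv by (intro mult_left_mono) auto
    then have uv2: "(u - v)\<^sup>2 \<le> 1 / real n - 1 / real N"
      unfolding uv(3,4)[symmetric] by (simp add: power2_eq_square algebra_simps)
    have "S \<le> (\<Sum>i<N. \<Sum>j<N. g (sym_index i j))"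
      unfolding S_def
    proof (intro sum_mono)
      fix i j
      have "(cmod (D i j))\<^sup>2 = (?b i j - scaled_entry N x i j)\<^sup>2"
        unfolding D_def norm_of_real by simp
      also have "\<dots> \<le> g (sym_index i j)"
      proof (cases "i < n \<and> j < n")
        case True
        then have "?b i j - scaled_entry N x i j = x (sym_index i j) * (u - v)"
          by (simp add: scaled_entry_def u_def v_def right_diff_distrib)
        then show ?thesis using True uv2
          by (simp add: g_def power_mult_distrib sym_index_in_triangle mult_left_mono)
      next
        case False
        have "?b i j = 0" using False by (simp only: if_False)
        then have 1: "?b i j - scaled_entry N x i j = - (x (sym_index i j) * v)"
          by (simp only: scaled_entry_def v_def) simp
        have "sym_index i j \<notin> triangle n"
          using False by (simp add: sym_index_in_triangle_iff)
        then have "g (sym_index i j) = (x (sym_index i j) * v)\<^sup>2"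
          by (simp add: g_def power_mult_distrib uv(4))
        then show ?thesis unfolding 1 by simp
      qed
      finally show "(cmod (D i j))\<^sup>2 \<le> g (sym_index i j)" .
    qed
    also have "\<dots> \<le> 2 * (\<Sum>p\<in>triangle N. g p)" by (rule sum_sym_index_le[OF g0])
    finally have "N * S \<le> N * (2 * (\<Sum>p\<in>triangle N. g p))" by (rule mult_left_mono) simp
    also have "(\<Sum>p\<in>triangle N. g p) = (1 / real n - 1 / real N) * Q n + (Q N - Q n) / real N"
    proof -
      have sub: "triangle n \<subseteq> triangle N" using nN by (auto simp: triangle_def)
      have "(\<Sum>p\<in>triangle N. g p) = (\<Sum>p\<in>triangle n. g p) + (\<Sum>p\<in>triangle N - triangle n. g p)"
        by (metis sum.subset_diff[OF sub finite_triangle] add.commute)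
      also have "(\<Sum>p\<in>triangle n. g p) = (1 / real n - 1 / real N) * Q n"
        by (simp add: g_def Q_def sum_distrib_left mult.commute)
      also have "(\<Sum>p\<in>triangle N - triangle n. g p) = (\<Sum>p\<in>triangle N - triangle n. (x p)\<^sup>2) / real N"
        by (simp add: g_def sum_divide_distrib)
      also have "(\<Sum>p\<in>triangle N - triangle n. (x p)\<^sup>2) = Q N - Q n"
        unfolding Q_def by (simp add: sum_diff[OF finite_triangle sub])
      finally show ?thesis .
    qed
    also have "N * (2 * ((1 / real n - 1 / real N) * Q n + (Q N - Q n) / real N))
        = 2 * ((real N / real n - 1) * Q n + (Q N - Q n))"
      using N n by (simp add: field_simps)
    finally show ?thesis .
  qed
  finally have 1: "cmod (mtrace N GN - mtrace N GP) / real N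
      \<le> sqrt (2 * ((real N / real n - 1) * Q n + (Q N - Q n))) / (real N * y\<^sup>2)"
    using y N by (simp add: divide_right_mono)
  have "array_stieltjes N z x - array_stieltjes n z x =
      (mtrace N GN - mtrace N GP) / of_nat N
      - (of_real (1 / real n - 1 / real N) * mtrace n Gn + of_real ((real N - real n) / real N) * (1 / z))"
  proof -
    have "complex_of_real ((real N - real n) / real N) = of_nat (N - n) / of_nat N"
      using nN by (simp add: of_nat_diff)
    then show ?thesis
      unfolding array_stieltjes_eq tP GN_def[symmetric] Gn_def[symmetric]
      by (simp add: diff_divide_distrib left_diff_distrib)
  qed
  then have "cmod (array_stieltjes N z x - array_stieltjes n z x)
      \<le> cmod ((mtrace N GN - mtrace N GP) / of_nat N)
        + (cmod (of_real (1 / real n - 1 / real N) * mtrace n Gn)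
        + cmod (of_real ((real N - real n) / real N) * (1 / z)))"
    by (metis (no_types, lifting) norm_triangle_ineq4 norm_triangle_ineq add_left_mono order_trans)
  moreover have "cmod ((mtrace N GN - mtrace N GP) / of_nat N) = cmod (mtrace N GN - mtrace N GP) / real N"
    by (simp add: norm_divide)
  moreover have "cmod (of_real (1 / real n - 1 / real N) * mtrace n Gn) \<le> (1 - real n / real N) / y"
  proof -
    have "cmod (mtrace n Gn) \<le> (\<Sum>i<n. 1 / y)"
      unfolding mtrace_def by (rule sum_norm_le) (auto intro: op_bounded_entry[OF opn])
    then have "cmod (mtrace n Gn) \<le> real n / y" by simp
    moreover have "0 \<le> 1 / real n - 1 / real N" using n nN by (simp add: field_simps)
    ultimately have "cmod (of_real (1 / real n - 1 / real N) * mtrace n Gn)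
        \<le> (1 / real n - 1 / real N) * (real n / y)"
      unfolding norm_mult norm_of_real by (simp only: abs_of_nonneg mult_left_mono)
    also have "\<dots> = (1 - real n / real N) / y" using n N y by (simp add: field_simps)
    finally show ?thesis .
  qed
  moreover have "cmod (of_real ((real N - real n) / real N) * (1 / z)) \<le> (1 - real n / real N) / y"
  proof -
    have "y \<le> cmod z" using abs_Im_le_cmod[of z] z by (simp add: y_def)
    then have "1 / cmod z \<le> 1 / y" using y by (simp add: frac_le)
    then have "(1 - real n / real N) * (1 / cmod z) \<le> (1 - real n / real N) * (1 / y)"
      using N nN by (intro mult_left_mono) auto
    moreover have "(real N - real n) / real N = 1 - real n / real N" "0 \<le> 1 - real n / real N"
      using N nN by (auto simp: field_simps)
    ultimately show ?thesis unfolding norm_mult norm_of_real norm_divide by simp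
  qed
  ultimately have "cmod (array_stieltjes N z x - array_stieltjes n z x)
    \<le> ((1 - real n / real N) / y + (1 - real n / real N) / y)
      + sqrt (2 * ((real N / real n - 1) * Q n + (Q N - Q n))) / (real N * y\<^sup>2)"
    using 1 by linarith
  also have "(1 - real n / real N) / y + (1 - real n / real N) / y = 2 * (1 - real n / real N) / y"
    by simp
  finally show ?thesis unfolding y_def .
qed

section \<open>Conditional orthogonality\<close>

lemma AE_tendsto_zero_summable:
  fixes Z :: "nat \<Rightarrow> 'a \<Rightarrow> real"
  assumes meas: "\<And>j. Z j \<in> borel_measurable M"
    and bound: "\<And>j. (\<integral>\<^sup>+ \<omega>. ennreal \<bar>Z j \<omega>\<bar> \<partial>M) \<le> ennreal (\<eta> j)"
    and \<eta>: "\<And>j. 0 \<le> \<eta> j" "summable \<eta>"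
  shows "AE \<omega> in M. (\<lambda>j. Z j \<omega>) \<longlonglongrightarrow> 0"
proof -
  note meas[measurable]
  \<comment> \<open>The series of absolute values has finite expectation, hence converges almost
    surely, and so its terms vanish.\<close>
  have "(\<integral>\<^sup>+ \<omega>. (\<Sum>j. ennreal \<bar>Z j \<omega>\<bar>) \<partial>M) = (\<Sum>j. \<integral>\<^sup>+ \<omega>. ennreal \<bar>Z j \<omega>\<bar> \<partial>M)"
    by (rule nn_integral_suminf) simp
  also have "\<dots> \<le> (\<Sum>j. ennreal (\<eta> j))"
    by (rule suminf_le) (auto simp: bound)
  also have "\<dots> = ennreal (suminf \<eta>)"
    using \<eta> by (rule suminf_ennreal2)
  finally have "(\<integral>\<^sup>+ \<omega>. (\<Sum>j. ennreal \<bar>Z j \<omega>\<bar>) \<partial>M) \<noteq> \<infinity>"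
    by (auto simp: top_unique)
  then have "AE \<omega> in M. (\<Sum>j. ennreal \<bar>Z j \<omega>\<bar>) \<noteq> \<infinity>"
    by (intro nn_integral_PInf_AE) auto
  then show ?thesis
  proof eventually_elim
    case (elim \<omega>)
    then have "summable (\<lambda>j. \<bar>Z j \<omega>\<bar>)"
      by (intro summable_suminf_not_top) auto
    then show ?case
      by (intro tendsto_rabs_zero_cancel[OF summable_LIMSEQ_zero])
  qed
qed

lemma AE_tendsto_zero_square_summable:
  fixes Z :: "nat \<Rightarrow> 'a \<Rightarrow> real"
  assumes meas: "\<And>j. Z j \<in> borel_measurable M"
    and int: "\<And>j. integrable M (\<lambda>\<omega>. (Z j \<omega>)\<^sup>2)"
    and bound: "\<And>j. (\<integral>\<omega>. (Z j \<omega>)\<^sup>2 \<partial>M) \<le> \<eta> j"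
    and \<eta>: "summable \<eta>"
  shows "AE \<omega> in M. (\<lambda>j. Z j \<omega>) \<longlonglongrightarrow> 0"
proof -
  have "AE \<omega> in M. (\<lambda>j. (Z j \<omega>)\<^sup>2) \<longlonglongrightarrow> 0"
  proof (rule AE_tendsto_zero_summable[where \<eta> = \<eta>])
    show "(\<lambda>\<omega>. (Z j \<omega>)\<^sup>2) \<in> borel_measurable M" for j using meas[of j] by simp
    show "(\<integral>\<^sup>+ \<omega>. ennreal \<bar>(Z j \<omega>)\<^sup>2\<bar> \<partial>M) \<le> ennreal (\<eta> j)" for j
      using bound[of j] by (simp add: nn_integral_eq_integral[OF int] ennreal_leI)
    show "0 \<le> \<eta> j" for j
      using bound[of j] by (rule order_trans[rotated]) simp
  qed (rule \<eta>)
  then show ?thesis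
  proof eventually_elim
    case (elim \<omega>)
    then show ?case using tendsto_real_sqrt[OF elim] by (simp add: tendsto_rabs_zero_iff)
  qed
qed

lemma integrable_mult_square:
  fixes f g :: "'a \<Rightarrow> real"
  assumes [measurable]: "f \<in> borel_measurable M" "g \<in> borel_measurable M"
    and "integrable M (\<lambda>x. (f x)\<^sup>2)" "integrable M (\<lambda>x. (g x)\<^sup>2)"
  shows "integrable M (\<lambda>x. f x * g x)"
proof (rule Bochner_Integration.integrable_bound)
  show "integrable M (\<lambda>x. (f x)\<^sup>2 + (g x)\<^sup>2)" using assms by simp
  have "\<bar>f x * g x\<bar> \<le> (f x)\<^sup>2 + (g x)\<^sup>2" for x
  proof -
    have "2 * \<bar>f x\<bar> * \<bar>g x\<bar> \<le> \<bar>f x\<bar>\<^sup>2 + \<bar>g x\<bar>\<^sup>2" by (rule sum_squares_bound)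
    moreover have "0 \<le> \<bar>f x\<bar> * \<bar>g x\<bar>" by simp
    ultimately have "\<bar>f x\<bar> * \<bar>g x\<bar> \<le> \<bar>f x\<bar>\<^sup>2 + \<bar>g x\<bar>\<^sup>2" by linarith
    then show ?thesis by (simp add: abs_mult)
  qed
  then show "AE x in M. norm (f x * g x) \<le> norm ((f x)\<^sup>2 + (g x)\<^sup>2)" by (auto simp: abs_of_nonneg)
qed simp

lemma integral_mult_square_le:
  fixes f g :: "'a \<Rightarrow> real"
  assumes [measurable]: "f \<in> borel_measurable M" "g \<in> borel_measurable M"
    and int: "integrable M (\<lambda>x. (f x)\<^sup>2)" "integrable M (\<lambda>x. (g x)\<^sup>2)"
    and "(\<integral>x. (f x)\<^sup>2 \<partial>M) \<le> v" "(\<integral>x. (g x)\<^sup>2 \<partial>M) \<le> v"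
  shows "(\<integral>x. f x * g x \<partial>M) \<le> v"
proof -
  have "(\<integral>x. f x * g x \<partial>M) \<le> (\<integral>x. ((f x)\<^sup>2 + (g x)\<^sup>2) / 2 \<partial>M)"
  proof (rule integral_mono)
    show "f x * g x \<le> ((f x)\<^sup>2 + (g x)\<^sup>2) / 2" for x
      using sum_squares_bound[of "f x" "g x"] by simp
  qed (use int in \<open>auto intro: integrable_mult_square\<close>)
  also have "\<dots> = ((\<integral>x. (f x)\<^sup>2 \<partial>M) + (\<integral>x. (g x)\<^sup>2 \<partial>M)) / 2"
    using int by simp
  finally show ?thesis using assms by simp
qed

text \<open>Expand the square: pairs outside \<open>P\<close> contribute nothing and each other pair
  at most \<open>v\<close>, by the inequality of arithmetic and geometric means. For
  \<open>P\<close> the diagonal this is ordinary orthogonality; a larger \<open>P\<close> admits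
  dependence within a band of rows.\<close>

lemma integral_sum_square_le:
  fixes \<zeta> :: "'i \<Rightarrow> 'a \<Rightarrow> real"
  assumes I: "finite I" and meas: "\<And>k. k \<in> I \<Longrightarrow> \<zeta> k \<in> borel_measurable M"
    and int: "\<And>k. k \<in> I \<Longrightarrow> integrable M (\<lambda>\<omega>. (\<zeta> k \<omega>)\<^sup>2)"
    and bound: "\<And>k. k \<in> I \<Longrightarrow> (\<integral>\<omega>. (\<zeta> k \<omega>)\<^sup>2 \<partial>M) \<le> v"
    and P: "P \<subseteq> I \<times> I" and v: "0 \<le> v" and card: "real (card P) \<le> c"
    and orth: "\<And>k l. k \<in> I \<Longrightarrow> l \<in> I \<Longrightarrow> (k, l) \<notin> P \<Longrightarrow> (\<integral>\<omega>. \<zeta> k \<omega> * \<zeta> l \<omega> \<partial>M) = 0"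
  shows "integrable M (\<lambda>\<omega>. (\<Sum>k\<in>I. \<zeta> k \<omega>)\<^sup>2)" "(\<integral>\<omega>. (\<Sum>k\<in>I. \<zeta> k \<omega>)\<^sup>2 \<partial>M) \<le> c * v"
proof -
  have sq: "(\<Sum>k\<in>I. \<zeta> k \<omega>)\<^sup>2 = (\<Sum>k\<in>I. \<Sum>l\<in>I. \<zeta> k \<omega> * \<zeta> l \<omega>)" for \<omega>
    by (simp add: power2_eq_square sum_product)
  have intp: "integrable M (\<lambda>\<omega>. \<zeta> k \<omega> * \<zeta> l \<omega>)" if "k \<in> I" "l \<in> I" for k l
    using that by (intro integrable_mult_square meas int)
  show "integrable M (\<lambda>\<omega>. (\<Sum>k\<in>I. \<zeta> k \<omega>)\<^sup>2)"
    unfolding sq by (intro Bochner_Integration.integrable_sum intp)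
  have "(\<integral>\<omega>. (\<Sum>k\<in>I. \<zeta> k \<omega>)\<^sup>2 \<partial>M) = (\<Sum>k\<in>I. \<Sum>l\<in>I. \<integral>\<omega>. \<zeta> k \<omega> * \<zeta> l \<omega> \<partial>M)"
    unfolding sq by (simp add: Bochner_Integration.integral_sum intp)
  also have "\<dots> = (\<Sum>p\<in>I \<times> I. \<integral>\<omega>. \<zeta> (fst p) \<omega> * \<zeta> (snd p) \<omega> \<partial>M)"
    by (simp add: sum.cartesian_product case_prod_unfold)
  also have "\<dots> = (\<Sum>p\<in>P. \<integral>\<omega>. \<zeta> (fst p) \<omega> * \<zeta> (snd p) \<omega> \<partial>M)"
    using I P orth by (intro sum.mono_neutral_right) auto
  also have "\<dots> \<le> (\<Sum>p\<in>P. v)"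
    using P by (intro sum_mono integral_mult_square_le meas int bound) auto
  also have "\<dots> \<le> c * v" using v card by (simp add: mult_right_mono)
  finally show "(\<integral>\<omega>. (\<Sum>k\<in>I. \<zeta> k \<omega>)\<^sup>2 \<partial>M) \<le> c * v" .
qed

text \<open>Induction by adding an element of largest rank: the sets below the other elements stay
  the same, and its own term is the new increment of \<open>H\<close>.\<close>

lemma sum_telescope_rank:
  fixes r :: "'i \<Rightarrow> nat" and H :: "'i set \<Rightarrow> 'b::ab_group_add"
  assumes "finite I" "inj_on r I"
  shows "(\<Sum>k\<in>I. H {p \<in> I. r p \<le> r k} - H {p \<in> I. r p < r k}) = H I - H {}"
  using assms
proof (induction I rule: finite_ranking_induct[where f = r])
  case empty
  show ?case by simp
next
  case (insert x S)
  show ?case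
  proof (cases "x \<in> S")
    case True
    then have "insert x S = S" by (rule insert_absorb)
    with insert.IH insert.prems show ?thesis by (simp only:)
  next
    case False
    have less: "r p < r x" if p: "p \<in> S" for p
    proof -
      have "p \<noteq> x" using p False by metis
      then have "r p \<noteq> r x" using inj_onD[OF insert.prems, of p x] p by blast
      then show ?thesis using insert.hyps(2)[OF p] by simp
    qed
    let ?d = "\<lambda>T k. H {p \<in> T. r p \<le> r k} - H {p \<in> T. r p < r k}"
    have eq: "?d (insert x S) k = ?d S k" if "k \<in> S" for k
    proof -
      have "{p \<in> insert x S. r p \<le> r k} = {p \<in> S. r p \<le> r k}"
        "{p \<in> insert x S. r p < r k} = {p \<in> S. r p < r k}"
        using less[OF that] by auto
      then show ?thesis by (simp only:)
    qed
    have "{p \<in> insert x S. r p \<le> r x} = insert x S" "{p \<in> insert x S. r p < r x} = S"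
      using less less_imp_le by blast+
    then have top: "?d (insert x S) x = H (insert x S) - H S" by (simp only:)
    have "(\<Sum>k\<in>insert x S. ?d (insert x S) k) = ?d (insert x S) x + (\<Sum>k\<in>S. ?d (insert x S) k)"
      by (rule sum.insert[OF insert.hyps(1) False])
    also have "(\<Sum>k\<in>S. ?d (insert x S) k) = (\<Sum>k\<in>S. ?d S k)"
      by (rule sum.cong[OF refl eq])
    also have "\<dots> = H S - H {}"
      by (rule insert.IH) (rule inj_on_subset[OF insert.prems subset_insertI])
    finally show ?thesis unfolding top by simp
  qed
qed

section \<open>Generated and joined sigma-algebras\<close>

lemma space_generated_algebra [simp]: "space (generated_algebra M Z I) = space M"
  by (simp add: generated_algebra_def space_measure_of_conv)

lemma sets_generated_algebra:
  "sets (generated_algebra M Z I) = sigma_sets (space M) (\<Union>k\<in>I. {Z k -` A \<inter> space M | A. A \<in> sets borel})"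
  unfolding generated_algebra_def by (rule sets_measure_of) auto

lemma measurable_generated_algebra: "k \<in> I \<Longrightarrow> Z k \<in> borel_measurable (generated_algebra M Z I)"
  by (rule measurableI) (auto simp: sets_generated_algebra)

lemma subalgebra_generated_algebra:
  assumes "space F = space M" "\<And>k. k \<in> I \<Longrightarrow> Z k \<in> borel_measurable F"
  shows "subalgebra F (generated_algebra M Z I)"
  unfolding subalgebra_def
proof
  show "sets (generated_algebra M Z I) \<subseteq> sets F"
    unfolding sets_generated_algebra assms(1)[symmetric]
    by (rule sets.sigma_sets_subset) (auto dest!: assms(2) intro: measurable_sets)
qed (simp add: assms(1))

lemma subalgebra_trans: "subalgebra A B \<Longrightarrow> subalgebra B C \<Longrightarrow> subalgebra A C"
  by (auto simp: subalgebra_def)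

definition join_algebra :: "'a measure \<Rightarrow> 'a measure \<Rightarrow> 'a measure" where
  "join_algebra G H = sigma (space G) (sets G \<union> sets H)"

lemma join_algebra:
  assumes "space H = space G"
  shows "space (join_algebra G H) = space G"
    "sets (join_algebra G H) = sigma_sets (space G) (sets G \<union> sets H)"
    "subalgebra (join_algebra G H) G" "subalgebra (join_algebra G H) H"
proof -
  show *: "space (join_algebra G H) = space G" by (simp add: join_algebra_def space_measure_of_conv)
  have "sets G \<union> sets H \<subseteq> Pow (space G)"
    using sets.space_closed[of G] sets.space_closed[of H] assms by auto
  then show **: "sets (join_algebra G H) = sigma_sets (space G) (sets G \<union> sets H)"
    unfolding join_algebra_def by (rule sets_measure_of)
  show "subalgebra (join_algebra G H) G" "subalgebra (join_algebra G H) H"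
    using assms unfolding subalgebra_def * **
    by (simp_all add: subset_iff sigma_sets.Basic)
qed

lemma subalgebra_join_algebra:
  assumes "subalgebra M G" "subalgebra M H"
  shows "subalgebra M (join_algebra G H)"
proof -
  have s: "space H = space G" "space G = space M" using assms by (auto simp: subalgebra_def)
  show ?thesis
    unfolding subalgebra_def join_algebra(1,2)[OF s(1)]
  proof
    have "sets G \<union> sets H \<subseteq> sets M" using assms by (auto simp: subalgebra_def)
    then show "sigma_sets (space G) (sets G \<union> sets H) \<subseteq> sets M"
      unfolding s(2) by (rule sets.sigma_sets_subset)
  qed (rule s(2))
qed

section \<open>Conditional expectations and independence\<close>

context prob_space
begin

lemma sigma_finite_subalgebraI: "subalgebra M F \<Longrightarrow> sigma_finite_subalgebra M F"
  by (intro finite_measure_subalgebra_is_sigma_finite finite_measure_subalgebra.intro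
      finite_measure_subalgebra_axioms.intro finite_measure_axioms)

lemma integrable_indicator_event:
  assumes "A \<in> events"
  shows "integrable M (indicator A :: 'a \<Rightarrow> real)"
  using assms by (rule integrable_real_indicator) (simp add: less_top[symmetric])

lemma indep_set_integral_mult:
  fixes f g :: "'a \<Rightarrow> real"
  assumes ind: "indep_set (sets F) (sets H)" and sp: "space F = space M" "space H = space M"
    and f: "f \<in> borel_measurable F" "integrable M f" and g: "g \<in> borel_measurable H" "integrable M g"
  shows "(\<integral>\<omega>. f \<omega> * g \<omega> \<partial>M) = (\<integral>\<omega>. f \<omega> \<partial>M) * (\<integral>\<omega>. g \<omega> \<partial>M)"
proof (rule indep_var_lebesgue_integral[OF _ f(2) g(2)])
  have sub: "sigma_sets (space M) {u -` A \<inter> space M | A. A \<in> sets borel} \<subseteq> sets L"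
    if "space L = space M" "u \<in> borel_measurable L" for L and u :: "'a \<Rightarrow> real"
  proof -
    have "{u -` A \<inter> space M | A. A \<in> sets borel} \<subseteq> sets L"
      using measurable_sets[OF that(2)] that(1) by auto
    then have "sigma_sets (space L) {u -` A \<inter> space M | A. A \<in> sets borel} \<subseteq> sets L"
      by (rule sets.sigma_sets_subset)
    then show ?thesis unfolding that(1) .
  qed
  have "indep_set (sigma_sets (space M) {f -` A \<inter> space M | A. A \<in> sets borel})
      (sigma_sets (space M) {g -` A \<inter> space M | A. A \<in> sets borel})"
    unfolding indep_set_def
  proof (rule indep_sets_mono_sets[OF ind[unfolded indep_set_def]])
    fix i :: bool
    show "case_bool (sigma_sets (space M) {f -` A \<inter> space M | A. A \<in> sets borel})
      (sigma_sets (space M) {g -` A \<inter> space M | A. A \<in> sets borel}) i \<subseteq> case_bool (sets F) (sets H) i"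
      using sub[OF sp(1) f(1)] sub[OF sp(2) g(1)] by (cases i) (simp_all only: bool.case)
  qed
  then show "indep_var borel f borel g"
    unfolding indep_var_eq by (intro conjI borel_measurable_integrable f(2) g(2))
qed

text \<open>Information independent of \<open>F\<close>, which contains both \<open>G\<close> and
  \<open>Z\<close>, does not help to predict \<open>Z\<close>. Over \<open>A \<inter> B\<close> with
  \<open>A\<close> in \<open>G\<close> and \<open>B\<close> in \<open>H\<close> the integral of
  \<open>Z\<close> factors into its integral over \<open>A\<close>, which is zero, and the
  probability of \<open>B\<close>; these intersections form a generating pi-system.\<close>

lemma AE_real_cond_exp_join_algebra:
  assumes F: "subalgebra M F" and H: "subalgebra M H" and G: "subalgebra F G"
    and ind: "indep_set (sets F) (sets H)"
    and Z: "Z \<in> borel_measurable F" "integrable M Z" and ce: "AE \<omega> in M. real_cond_exp M G Z \<omega> = 0"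
  shows "AE \<omega> in M. real_cond_exp M (join_algebra G H) Z \<omega> = 0"
proof -
  have MG: "subalgebra M G" using F G by (rule subalgebra_trans)
  have sp: "space F = space M" "space H = space M" "space G = space M"
    using F H MG by (auto simp: subalgebra_def)
  have sub: "sets F \<subseteq> sets M" "sets H \<subseteq> sets M" "sets G \<subseteq> sets F"
    using F H G by (auto simp: subalgebra_def)
  let ?J = "join_algebra G H"
  have J: "subalgebra M ?J" by (rule subalgebra_join_algebra[OF MG H])
  interpret J: sigma_finite_subalgebra M ?J by (rule sigma_finite_subalgebraI[OF J])
  interpret G: sigma_finite_subalgebra M G by (rule sigma_finite_subalgebraI[OF MG])
  let ?E = "{A \<inter> B | A B. A \<in> sets G \<and> B \<in> sets H}"
  have sJ: "sets ?J = sigma_sets (space M) ?E"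
  proof -
    have "sigma_sets (space M) (sets G \<union> sets H) = sigma_sets (space M) ?E"
    proof (rule sigma_sets_eqI)
      fix A assume "A \<in> sets G \<union> sets H"
      then show "A \<in> sigma_sets (space M) ?E"
      proof
        assume A: "A \<in> sets G"
        then have "A = A \<inter> space M" using sets.sets_into_space[OF A] sp by auto
        moreover have "space M \<in> sets H" using sets.top[of H] sp by simp
        ultimately show ?thesis using A by (intro sigma_sets.Basic) auto
      next
        assume A: "A \<in> sets H"
        then have "A = space M \<inter> A" using sets.sets_into_space[OF A] sp by auto
        moreover have "space M \<in> sets G" using sets.top[of G] sp by simp
        ultimately show ?thesis using A by (intro sigma_sets.Basic) auto
      qed
    next
      fix A assume "A \<in> ?E"
      then obtain B C where A: "A = B \<inter> C" "B \<in> sets G" "C \<in> sets H" by auto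
      have "B \<inter> C \<in> sets ?J"
        using A join_algebra(3,4)[of H G] sp by (auto simp: subalgebra_def)
      then show "A \<in> sigma_sets (space M) (sets G \<union> sets H)"
        using join_algebra(2)[of H G] sp A by simp
    qed
    then show ?thesis using join_algebra(2)[of H G] sp by simp
  qed
  have stab: "Int_stable ?E"
  proof (rule Int_stableI)
    fix a b assume "a \<in> ?E" "b \<in> ?E"
    then obtain A B A' B' where "a = A \<inter> B" "A \<in> sets G" "B \<in> sets H" "b = A' \<inter> B'" "A' \<in> sets G" "B' \<in> sets H"
      by auto
    then have "a \<inter> b = (A \<inter> A') \<inter> (B \<inter> B')" "A \<inter> A' \<in> sets G" "B \<inter> B' \<in> sets H" by auto
    then show "a \<inter> b \<in> ?E" by blast
  qed
  have EP: "?E \<subseteq> Pow (space M)" using sets.sets_into_space[of _ G] sp by auto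
  have int_ind: "integrable M (\<lambda>\<omega>. indicator A \<omega> * Z \<omega>)" if "A \<in> sets M" for A
    using integrable_mult_indicator[OF that Z(2)] by simp
  have G0: "(\<integral>\<omega>. indicator A \<omega> * Z \<omega> \<partial>M) = 0" if A: "A \<in> sets G" for A
  proof -
    have "(\<integral>\<omega>. indicator A \<omega> * Z \<omega> \<partial>M) = (\<integral>\<omega>. indicator A \<omega> * real_cond_exp M G Z \<omega> \<partial>M)"
      using G.real_cond_exp_intA[OF Z(2) A] by (simp add: set_lebesgue_integral_def)
    also have "\<dots> = (\<integral>\<omega>. 0 \<partial>M)"
      using ce A sub by (intro integral_cong_AE) auto
    finally show ?thesis by simp
  qed
  \<comment> \<open>Dynkin's pi-lambda argument. Complements are covered because the whole space
    lies in \<open>G\<close>, so that \<open>Z\<close> has mean zero.\<close>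
  have zero: "(\<integral>\<omega>. indicator A \<omega> * Z \<omega> \<partial>M) = 0" if "A \<in> sigma_sets (space M) ?E" for A
    using stab EP that
  proof (induction rule: sigma_sets_induct_disjoint)
    case (basic A)
    then obtain B C where A: "A = B \<inter> C" "B \<in> sets G" "C \<in> sets H" by auto
    have B: "B \<in> sets F" "B \<in> sets M" "C \<in> sets M" using A sub by auto
    have "(\<integral>\<omega>. indicator A \<omega> * Z \<omega> \<partial>M) = (\<integral>\<omega>. (indicator B \<omega> * Z \<omega>) * indicator C \<omega> \<partial>M)"
      by (intro Bochner_Integration.integral_cong) (auto simp: A indicator_def)
    also have "\<dots> = (\<integral>\<omega>. indicator B \<omega> * Z \<omega> \<partial>M) * (\<integral>\<omega>. indicator C \<omega> \<partial>M)"
      by (rule indep_set_integral_mult[OF ind sp(1,2)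
            borel_measurable_times[OF borel_measurable_indicator[OF B(1)] Z(1)] int_ind[OF B(2)]
            borel_measurable_indicator[OF A(3)] integrable_indicator_event[OF B(3)]])
    finally show ?case using G0 A by simp
  next
    case empty
    then show ?case by simp
  next
    case (compl A)
    have A: "A \<in> sets M" using compl sJ J by (auto simp: subalgebra_def)
    have "(\<integral>\<omega>. indicator (space M - A) \<omega> * Z \<omega> \<partial>M) = (\<integral>\<omega>. indicator (space M) \<omega> * Z \<omega> - indicator A \<omega> * Z \<omega> \<partial>M)"
      using sets.sets_into_space[OF A]
      by (intro Bochner_Integration.integral_cong) (auto simp: indicator_def)
    also have "\<dots> = (\<integral>\<omega>. indicator (space M) \<omega> * Z \<omega> \<partial>M) - (\<integral>\<omega>. indicator A \<omega> * Z \<omega> \<partial>M)"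
      by (rule Bochner_Integration.integral_diff[OF int_ind[OF sets.top] int_ind[OF A]])
    also have "(\<integral>\<omega>. indicator (space M) \<omega> * Z \<omega> \<partial>M) = 0"
      using G0[OF sets.top] unfolding sp(3) .
    also have "(\<integral>\<omega>. indicator A \<omega> * Z \<omega> \<partial>M) = 0" by (rule compl(2))
    finally show ?case by simp
  next
    case (union A)
    have "sigma_sets (space M) ?E \<subseteq> sets M" using J unfolding subalgebra_def sJ by simp
    then have A: "A i \<in> sets M" for i using union(2) by blast
    have "(LINT \<omega>:(\<Union>i. A i)|M. Z \<omega>) = (\<Sum>i. LINT \<omega>:A i|M. Z \<omega>)"
    proof (rule lebesgue_integral_countable_add)
      show "set_integrable M (\<Union>i. A i) Z"
        unfolding set_integrable_def using int_ind[OF sets.countable_UN[of A UNIV M]] A by auto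
    qed (use union(1) A in \<open>auto simp: disjoint_family_on_def\<close>)
    then show ?case using union(3) by (simp add: set_lebesgue_integral_def)
  qed
  show ?thesis
  proof (rule J.real_cond_exp_charact)
    fix A assume "A \<in> sets ?J"
    then show "(LINT \<omega>:A|M. Z \<omega>) = (LINT \<omega>:A|M. 0)"
      using zero[of A] unfolding sJ by (simp add: set_lebesgue_integral_def)
  qed (simp_all add: Z(2))
qed

text \<open>Integrability is asked of the product, since the factors \<open>U\<close> to which this
  is applied are unbounded.\<close>

lemma integral_mult_eq_zero:
  assumes "subalgebra M J" and ce: "AE \<omega> in M. real_cond_exp M J Z \<omega> = 0"
    and U: "U \<in> borel_measurable J" and Z: "Z \<in> borel_measurable M" and int: "integrable M (\<lambda>\<omega>. U \<omega> * Z \<omega>)"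
  shows "(\<integral>\<omega>. U \<omega> * Z \<omega> \<partial>M) = 0"
proof -
  interpret J: sigma_finite_subalgebra M J by (rule sigma_finite_subalgebraI) fact
  have [measurable]: "U \<in> borel_measurable M" using U assms(1) by (rule measurable_from_subalg[rotated])
  have "(\<integral>\<omega>. U \<omega> * Z \<omega> \<partial>M) = (\<integral>\<omega>. U \<omega> * real_cond_exp M J Z \<omega> \<partial>M)"
    by (rule J.real_cond_exp_intg(2)[OF int U Z, symmetric])
  also have "\<dots> = (\<integral>\<omega>. 0 \<partial>M)" using ce by (intro integral_cong_AE) auto
  finally show ?thesis by simp
qed

lemma AE_real_cond_exp_indep:
  assumes F: "subalgebra M F" and G: "subalgebra M G" and ind: "indep_set (sets F) (sets G)"
    and Z: "Z \<in> borel_measurable F" "integrable M Z" and "expectation Z = 0"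
  shows "AE \<omega> in M. real_cond_exp M G Z \<omega> = 0"
proof -
  interpret G: sigma_finite_subalgebra M G by (rule sigma_finite_subalgebraI) fact
  have sp: "space F = space M" "space G = space M" using F G by (auto simp: subalgebra_def)
  show ?thesis
  proof (rule G.real_cond_exp_charact)
    fix A assume A: "A \<in> sets G"
    then have "A \<in> sets M" using G by (auto simp: subalgebra_def)
    then have "(\<integral>\<omega>. Z \<omega> * indicator A \<omega> \<partial>M) = expectation Z * (\<integral>\<omega>. indicator A \<omega> \<partial>M)"
      by (intro indep_set_integral_mult[OF ind sp Z borel_measurable_indicator[OF A]] integrable_indicator_event)
    then show "(LINT \<omega>:A|M. Z \<omega>) = (LINT \<omega>:A|M. 0)"
      using assms by (simp add: set_lebesgue_integral_def mult.commute)
  qed (use Z in auto)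
qed

text \<open>Conditional Jensen controls the square of the conditional expectation; 4 comes from
  \<open>(u - v)\<^sup>2 \<le> 2 * u\<^sup>2 + 2 * v\<^sup>2\<close>.\<close>

lemma integral_cond_exp_residual_square_le:
  assumes G: "subalgebra M G" and W: "W \<in> borel_measurable M" "integrable M (\<lambda>\<omega>. (W \<omega>)\<^sup>2)"
  shows "integrable M (\<lambda>\<omega>. (W \<omega> - real_cond_exp M G W \<omega>)\<^sup>2)"
    "(\<integral>\<omega>. (W \<omega> - real_cond_exp M G W \<omega>)\<^sup>2 \<partial>M) \<le> 4 * (\<integral>\<omega>. (W \<omega>)\<^sup>2 \<partial>M)"
proof -
  interpret G: sigma_finite_subalgebra M G by (rule sigma_finite_subalgebraI) fact
  note W(1)[measurable]
  have intW: "integrable M W" by (rule square_integrable_imp_integrable[OF W])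
  have conv: "convex_on UNIV (\<lambda>x::real. x\<^sup>2)" using convex_power_even[of 2] by simp
  have jen: "AE \<omega> in M. (real_cond_exp M G W \<omega>)\<^sup>2 \<le> real_cond_exp M G (\<lambda>\<omega>. (W \<omega>)\<^sup>2) \<omega>"
    by (rule G.real_cond_exp_jensens_inequality(2)[OF intW _ _ W(2) conv]) auto
  let ?R = "real_cond_exp M G (\<lambda>\<omega>. (W \<omega>)\<^sup>2)"
  have intR: "integrable M ?R" "(\<integral>\<omega>. ?R \<omega> \<partial>M) = (\<integral>\<omega>. (W \<omega>)\<^sup>2 \<partial>M)"
    using G.real_cond_exp_int[OF W(2)] by auto
  have bd: "AE \<omega> in M. (W \<omega> - real_cond_exp M G W \<omega>)\<^sup>2 \<le> 2 * (W \<omega>)\<^sup>2 + 2 * ?R \<omega>"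
    using jen
  proof eventually_elim
    case (elim \<omega>)
    have "(W \<omega> - real_cond_exp M G W \<omega>)\<^sup>2 \<le> 2 * (W \<omega>)\<^sup>2 + 2 * (real_cond_exp M G W \<omega>)\<^sup>2"
      using sum_squares_bound[of "W \<omega>" "- real_cond_exp M G W \<omega>"] by (simp add: power2_diff)
    with elim show ?case by linarith
  qed
  have int: "integrable M (\<lambda>\<omega>. 2 * (W \<omega>)\<^sup>2 + 2 * ?R \<omega>)" using W(2) intR(1) by simp
  show i: "integrable M (\<lambda>\<omega>. (W \<omega> - real_cond_exp M G W \<omega>)\<^sup>2)"
    by (rule Bochner_Integration.integrable_bound[OF int]) (use bd in auto)
  have "(\<integral>\<omega>. (W \<omega> - real_cond_exp M G W \<omega>)\<^sup>2 \<partial>M) \<le> (\<integral>\<omega>. 2 * (W \<omega>)\<^sup>2 + 2 * ?R \<omega> \<partial>M)"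
    by (rule integral_mono_AE[OF i int bd])
  also have "\<dots> = 4 * (\<integral>\<omega>. (W \<omega>)\<^sup>2 \<partial>M)" using W(2) intR by simp
  finally show "(\<integral>\<omega>. (W \<omega> - real_cond_exp M G W \<omega>)\<^sup>2 \<partial>M) \<le> 4 * (\<integral>\<omega>. (W \<omega>)\<^sup>2 \<partial>M)" .
qed

text \<open>The preimages under a single variable are stable under intersection, so independence
  passes to the sigma-algebras generated by disjoint groups of variables.\<close>

lemma indep_vars_generated_algebra:
  assumes ind: "indep_vars (\<lambda>_. borel) Y S" and "A \<subseteq> S" "B \<subseteq> S" "A \<inter> B = {}"
  shows "indep_set (sets (generated_algebra M Y A)) (sets (generated_algebra M Y B))"
proof -
  let ?E = "\<lambda>i. {Y i -` A \<inter> space M | A. A \<in> sets borel}"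
  let ?I = "case_bool A B"
  have "indep_sets ?E S" using ind unfolding indep_vars_def2 by auto
  then have "indep_sets ?E (\<Union>j\<in>UNIV. ?I j)"
    by (rule indep_sets_mono_index[rotated]) (use assms in \<open>auto split: bool.splits\<close>)
  moreover have "Int_stable (?E i)" for i
  proof (rule Int_stableI)
    fix a b assume "a \<in> ?E i" "b \<in> ?E i"
    then obtain u v where "a = Y i -` u \<inter> space M" "b = Y i -` v \<inter> space M" "u \<in> sets borel" "v \<in> sets borel"
      by auto
    then show "a \<inter> b \<in> ?E i" by (auto intro!: exI[of _ "u \<inter> v"])
  qed
  moreover have "disjoint_family_on ?I UNIV"
    using assms by (auto simp: disjoint_family_on_def split: bool.splits)
  ultimately have "indep_sets (\<lambda>j. sigma_sets (space M) (\<Union>i\<in>?I j. ?E i)) UNIV"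
    by (intro indep_sets_collect_sigma) auto
  then show ?thesis
    unfolding indep_set_def sets_generated_algebra
  proof (rule indep_sets_mono_sets)
    fix i :: bool
    show "case_bool (sigma_sets (space M) (\<Union>i\<in>A. ?E i)) (sigma_sets (space M) (\<Union>i\<in>B. ?E i)) i
        \<subseteq> sigma_sets (space M) (\<Union>i\<in>?I i. ?E i)"
      by (cases i) (simp_all only: bool.case order_refl)
  qed
qed

text \<open>The mean serves orthogonality, the variance is matched with that of \<open>X\<close>,
  and the fourth moment gives the variance of the square. The Dirac mass is a separate case;
  otherwise the density is written with \<open>\<bar>s\<bar>\<close>, as \<open>s\<close> may be
  negative.\<close>

lemma centered_gaussian_moments:
  fixes Y :: "'a \<Rightarrow> real"
  assumes Y[measurable]: "Y \<in> borel_measurable M" and D: "distr M borel Y = centered_gaussian (s\<^sup>2)"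
  shows "integrable M (\<lambda>\<omega>. Y \<omega> ^ k)" "expectation Y = 0" "expectation (\<lambda>\<omega>. (Y \<omega>)\<^sup>2) = s\<^sup>2"
    "expectation (\<lambda>\<omega>. (Y \<omega>) ^ 4) = 3 * s ^ 4"
proof -
  have E: "(\<integral>\<omega>. Y \<omega> ^ k \<partial>M) = (\<integral>x. x ^ k \<partial>centered_gaussian (s\<^sup>2))" for k
    unfolding D[symmetric] by (rule integral_distr[symmetric]) auto
  have I: "integrable M (\<lambda>\<omega>. Y \<omega> ^ k) \<longleftrightarrow> integrable (centered_gaussian (s\<^sup>2)) (\<lambda>x. x ^ k)" for k
    unfolding D[symmetric] by (rule integrable_distr_eq[symmetric]) auto
  have all: "integrable M (\<lambda>\<omega>. Y \<omega> ^ k) \<and> expectation (\<lambda>\<omega>. Y \<omega> ^ 1) = 0 \<and> expectation (\<lambda>\<omega>. (Y \<omega>)\<^sup>2) = s\<^sup>2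
      \<and> expectation (\<lambda>\<omega>. (Y \<omega>) ^ 4) = 3 * s ^ 4" for k
  proof (cases "s = 0")
    case True
    then have c: "centered_gaussian (s\<^sup>2) = return borel 0" by (simp add: centered_gaussian_def)
    interpret R: prob_space "return borel (0::real)" by (rule prob_space_return) simp
    have "integrable (return borel (0::real)) (\<lambda>x. x ^ k)"
      by (rule R.integrable_const_bound[where B = 1]) (auto simp: AE_return power_0_left)
    then show ?thesis unfolding I E c using True by (simp add: integral_return)
  next
    case False
    define t where "t = \<bar>s\<bar>"
    have t: "0 < t" "t\<^sup>2 = s\<^sup>2" "t ^ 4 = s ^ 4" using False by (auto simp: t_def power_even_abs)
    have c: "centered_gaussian (s\<^sup>2) = density lborel (\<lambda>x. ennreal (normal_density 0 t x))"
      using False by (simp add: centered_gaussian_def t_def)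
    have nn: "0 \<le> normal_density 0 t x" for x using t by (simp add: normal_density_nonneg)
    have i: "integrable (centered_gaussian (s\<^sup>2)) (\<lambda>x. x ^ k)"
      unfolding c using nn integrable_normal_moment[OF t(1), of 0 k]
      by (subst integrable_density) auto
    have e: "(\<integral>x. x ^ k \<partial>centered_gaussian (s\<^sup>2)) = (\<integral>x. normal_density 0 t x * x ^ k \<partial>lborel)" for k
      unfolding c using nn by (subst integral_density) auto
    have "(\<integral>x. normal_density 0 t x * x ^ 1 \<partial>lborel) = 0"
      using integral_normal_moment_odd[OF t(1), of 0 0] by simp
    moreover have "(\<integral>x. normal_density 0 t x * x\<^sup>2 \<partial>lborel) = s\<^sup>2"
      using integral_normal_moment_even[OF t(1), of 0 1] t by (simp add: fact_numeral)
    moreover have "(\<integral>x. normal_density 0 t x * x ^ 4 \<partial>lborel) = 3 * s ^ 4"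
      using integral_normal_moment_even[OF t(1), of 0 2] t
      by (simp add: fact_numeral power_divide field_simps)
    ultimately show ?thesis unfolding I E e using i by (simp only: simp_thms)
  qed
  show "integrable M (\<lambda>\<omega>. Y \<omega> ^ k)" "expectation Y = 0" "expectation (\<lambda>\<omega>. (Y \<omega>)\<^sup>2) = s\<^sup>2"
    "expectation (\<lambda>\<omega>. (Y \<omega>) ^ 4) = 3 * s ^ 4"
    using all[of k] by simp_all
qed

end

section \<open>Square sums over a triangular array\<close>

definition lex_less :: "nat \<times> nat \<Rightarrow> nat \<times> nat \<Rightarrow> bool" where
  "lex_less p q \<longleftrightarrow> fst p < fst q \<or> fst p = fst q \<and> snd p < snd q"

text \<open>On the triangle, where the second index is at most the first, this rank is compatible with the
  lexicographic order.\<close>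

definition lex_rank :: "nat \<times> nat \<Rightarrow> nat" where
  "lex_rank p = fst p * fst p + snd p"

text \<open>On the triangle \<open>j \<le> i\<close>, so
  \<open>i\<^sup>2 + j < (i + 1)\<^sup>2\<close>: passing to a later row always raises the
  rank.\<close>

lemma lex_rank_less_iff:
  assumes "p \<in> triangle n" "q \<in> triangle n"
  shows "lex_rank p < lex_rank q \<longleftrightarrow> lex_less p q"
proof -
  have key: "i * i + j < i' * i' + j'" if "i < i'" "j \<le> i" "1 \<le> j'" for i j i' j' :: nat
  proof -
    have "i * i + j \<le> i * i + i" using that by simp
    also have "\<dots> \<le> i * i + 2 * i + 1" by simp
    also have "\<dots> = Suc i * Suc i" by simp
    also have "\<dots> \<le> i' * i'" using that by (intro mult_le_mono) auto
    finally show ?thesis using that by simp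
  qed
  consider "fst p < fst q" | "fst q < fst p" | "fst p = fst q" by linarith
  then show ?thesis
  proof cases
    case 1
    then have "lex_rank p < lex_rank q"
      unfolding lex_rank_def using assms by (intro key) (auto simp: triangle_def)
    with 1 show ?thesis by (simp add: lex_less_def)
  next
    case 2
    then have "lex_rank q < lex_rank p"
      unfolding lex_rank_def using assms by (intro key) (auto simp: triangle_def)
    with 2 show ?thesis by (simp add: lex_less_def)
  next
    case 3
    then show ?thesis by (simp add: lex_rank_def lex_less_def)
  qed
qed

lemma lex_less_linear: "lex_less p q \<or> p = q \<or> lex_less q p"
  unfolding lex_less_def prod_eq_iff by linarith

lemma lex_less_irrefl: "\<not> lex_less p p"
  by (simp add: lex_less_def)

lemma inj_on_lex_rank: "inj_on lex_rank (triangle n)"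
proof (rule inj_onI)
  fix p q assume *: "p \<in> triangle n" "q \<in> triangle n" "lex_rank p = lex_rank q"
  then have "\<not> lex_less p q" "\<not> lex_less q p"
    using lex_rank_less_iff[of p n q] lex_rank_less_iff[of q n p] by auto
  then show "p = q" using lex_less_linear by blast
qed

definition lex_below :: "nat \<Rightarrow> nat \<times> nat \<Rightarrow> (nat \<times> nat) set" where
  "lex_below n k = {p \<in> triangle n. lex_less p k}"

text \<open>The Lindeberg telescope. \<open>H\<close> will be evaluated at the set of positions that
  already carry \<open>X\<close>.\<close>

lemma sum_telescope_triangle:
  fixes H :: "(nat \<times> nat) set \<Rightarrow> 'b::ab_group_add"
  shows "(\<Sum>k\<in>triangle n. H (insert k (lex_below n k)) - H (lex_below n k)) = H (triangle n) - H {}"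
proof -
  have "{p \<in> triangle n. lex_rank p < lex_rank k} = lex_below n k" if "k \<in> triangle n" for k
    using lex_rank_less_iff[OF _ that] by (auto simp: lex_below_def)
  moreover have "{p \<in> triangle n. lex_rank p \<le> lex_rank k} = insert k (lex_below n k)" if "k \<in> triangle n" for k
  proof -
    have "lex_rank p \<le> lex_rank k \<longleftrightarrow> p = k \<or> lex_less p k" if "p \<in> triangle n" for p
      using lex_rank_less_iff[OF that \<open>k \<in> triangle n\<close>] inj_onD[OF inj_on_lex_rank _ that \<open>k \<in> triangle n\<close>]
      by (metis le_less)
    then show ?thesis using that by (auto simp: lex_below_def)
  qed
  ultimately show ?thesis
    using sum_telescope_rank[OF finite_triangle inj_on_lex_rank, of H n] by (simp cong: sum.cong)
qed

lemma join_algebra_mono: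
  assumes "subalgebra A B" "space H = space A"
  shows "subalgebra (join_algebra A H) (join_algebra B H)"
proof -
  have sp: "space B = space A" "space H = space B" and sub: "sets B \<subseteq> sets A"
    using assms by (auto simp: subalgebra_def)
  have "sigma_sets (space A) (sets B \<union> sets H) \<subseteq> sigma_sets (space A) (sets A \<union> sets H)"
    by (rule sigma_sets_mono') (use sub in blast)
  then show ?thesis
    unfolding subalgebra_def join_algebra(1,2)[OF assms(2)] join_algebra(1,2)[OF sp(2)] by (simp add: sp(1))
qed

section \<open>Truncated squares\<close>

lemma trunc_square_nonneg: "0 \<le> trunc_square n t"
  by (simp add: trunc_square_def)

lemma trunc_square_le: "trunc_square n t \<le> t\<^sup>2"
  unfolding trunc_square_def by (rule mult_left_le) auto

lemma trunc_square_measurable [measurable]: "trunc_square n \<in> borel_measurable borel"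
  unfolding trunc_square_def by measurable

text \<open>Both factors increase in modulus, so the smaller of \<open>\<bar>u\<bar>\<close> and \<open>\<bar>t\<bar>\<close> may be replaced by the larger one.\<close>

lemma min_mult_square_le:
  "min 1 (\<bar>u\<bar> / sqrt (real n)) * t\<^sup>2 \<le> trunc_square n u + trunc_square n t"
proof (cases "\<bar>t\<bar> \<le> \<bar>u\<bar>")
  case True
  then have "t\<^sup>2 \<le> u\<^sup>2" by (simp add: abs_le_square_iff)
  then have "min 1 (\<bar>u\<bar> / sqrt (real n)) * t\<^sup>2 \<le> min 1 (\<bar>u\<bar> / sqrt (real n)) * u\<^sup>2"
    by (intro mult_left_mono) auto
  then show ?thesis using trunc_square_nonneg[of n t] unfolding trunc_square_def by (simp only: mult.commute)
next
  case False
  then have "\<bar>u\<bar> / sqrt (real n) \<le> \<bar>t\<bar> / sqrt (real n)" by (intro divide_right_mono) auto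
  then have "min 1 (\<bar>u\<bar> / sqrt (real n)) * t\<^sup>2 \<le> min 1 (\<bar>t\<bar> / sqrt (real n)) * t\<^sup>2"
    by (intro mult_right_mono) auto
  then show ?thesis using trunc_square_nonneg[of n u] unfolding trunc_square_def by (simp only: mult.commute)
qed

text \<open>For \<open>\<bar>t\<bar> \<le> sqrt n\<close> nothing is cut off and
  \<open>t\<^sup>4 \<le> sqrt n * \<bar>t\<bar>\<^sup>3\<close>; beyond,
  \<open>trunc_square n t\<close> is \<open>t\<^sup>2\<close>. The first bound controls the excess
  in mean, the second the truncated square in mean square.\<close>

lemma min_square_excess_le:
  assumes "0 < n"
  shows "t\<^sup>2 - min (t\<^sup>2) (real n) \<le> trunc_square n t" "(min (t\<^sup>2) (real n))\<^sup>2 \<le> real n * trunc_square n t"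
proof -
  have r: "0 < sqrt (real n)" using assms by simp
  have sq: "(sqrt (real n))\<^sup>2 = real n" by simp
  have "t\<^sup>2 - min (t\<^sup>2) (real n) \<le> trunc_square n t \<and> (min (t\<^sup>2) (real n))\<^sup>2 \<le> real n * trunc_square n t"
  proof (cases "\<bar>t\<bar> \<le> sqrt (real n)")
    case True
    then have "t\<^sup>2 \<le> real n" using sq by (metis abs_ge_zero power2_abs power_mono)
    moreover have "\<bar>t\<bar> / sqrt (real n) \<le> 1" using True r by simp
    moreover have "(t\<^sup>2)\<^sup>2 \<le> real n * (t\<^sup>2 * (\<bar>t\<bar> / sqrt (real n)))"
    proof -
      have "\<bar>t\<bar> * \<bar>t\<bar> \<le> sqrt (real n) * \<bar>t\<bar>" using True by (intro mult_right_mono) auto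
      then have "t\<^sup>2 * (\<bar>t\<bar> * \<bar>t\<bar>) \<le> t\<^sup>2 * (sqrt (real n) * \<bar>t\<bar>)" by (intro mult_left_mono) auto
      moreover have "real n * (t\<^sup>2 * (\<bar>t\<bar> / sqrt (real n))) = t\<^sup>2 * (sqrt (real n) * \<bar>t\<bar>)"
        using r by (simp add: real_div_sqrt field_simps)
      ultimately show ?thesis by (simp add: power2_eq_square)
    qed
    ultimately show ?thesis using trunc_square_nonneg[of n t] by (simp add: trunc_square_def)
  next
    case False
    then have t: "trunc_square n t = t\<^sup>2" using r by (simp add: trunc_square_def)
    have "real n \<le> t\<^sup>2" using False sq r by (metis abs_ge_zero less_eq_real_def linorder_not_le power2_abs power_mono)
    then show ?thesis unfolding t by (simp add: power2_eq_square mult_left_mono)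
  qed
  then show "t\<^sup>2 - min (t\<^sup>2) (real n) \<le> trunc_square n t" "(min (t\<^sup>2) (real n))\<^sup>2 \<le> real n * trunc_square n t"
    by auto
qed

text \<open>The moment condition is absorbed into \<open>e\<close>, a bound for the truncated second
  moments that is summable along every sequence \<open>c * 4 ^ j\<close>. The function
  \<open>h\<close> returns only when the locale is instantiated.\<close>

locale array_pair = prob_space M for M :: "'a measure" +
  fixes X :: "int \<times> int \<Rightarrow> 'a \<Rightarrow> real" and Y :: "nat \<times> nat \<Rightarrow> 'a \<Rightarrow> real"
    and \<sigma> :: "int \<times> int \<Rightarrow> real" and C :: real and e :: "nat \<Rightarrow> real"
  assumes X_measurable [measurable]: "\<And>p. X p \<in> borel_measurable M"
    and X_square_integrable: "\<And>p. integrable M (\<lambda>\<omega>. (X p \<omega>)\<^sup>2)"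
    and X_variance: "\<And>p. expectation (\<lambda>\<omega>. (X p \<omega>)\<^sup>2) = (\<sigma> p)\<^sup>2"
    and Y_measurable: "\<And>i j. 1 \<le> i \<Longrightarrow> 1 \<le> j \<Longrightarrow> Y (i, j) \<in> borel_measurable M"
    and Y_gaussian: "\<And>i j. 1 \<le> i \<Longrightarrow> 1 \<le> j \<Longrightarrow>
      distr M borel (Y (i, j)) = centered_gaussian ((\<sigma> (int i, int j))\<^sup>2)"
    and Y_indep: "indep_vars (\<lambda>_. borel) Y ({1..} \<times> {1..})"
    and XY_indep: "indep_set
      (sets (generated_algebra M X UNIV)) (sets (generated_algebra M Y ({1..} \<times> {1..})))"
    and martingale: "\<And>i j :: nat. 1 \<le> j \<Longrightarrow> j \<le> i \<Longrightarrow>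
      AE \<omega> in M. real_cond_exp M (past_algebra M X 1 (int i, int j)) (X (int i, int j)) \<omega> = 0"
    and variance_le: "\<And>p. (\<sigma> p)\<^sup>2 \<le> C"
    and trunc_le: "\<And>n p. 0 < n \<Longrightarrow> expectation (\<lambda>\<omega>. trunc_square n (X p \<omega>)) \<le> e n"
    and e_summable: "\<And>c. 0 < c \<Longrightarrow> summable (\<lambda>j. e (c * 4 ^ j))"
begin

section \<open>Entries, pasts and sigma-algebras of the model\<close>

definition x :: "nat \<times> nat \<Rightarrow> 'a \<Rightarrow> real" where
  "x p = X (int (fst p), int (snd p))"

definition s :: "nat \<times> nat \<Rightarrow> real" where
  "s p = \<sigma> (int (fst p), int (snd p))"

definition past :: "nat \<Rightarrow> nat \<times> nat \<Rightarrow> 'a measure" where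
  "past a p = past_algebra M X a (int (fst p), int (snd p))"

definition X_alg :: "'a measure" where "X_alg = generated_algebra M X UNIV"

definition Y_alg :: "'a measure" where "Y_alg = generated_algebra M Y ({1..} \<times> {1..})"

definition Y_rest :: "nat \<times> nat \<Rightarrow> 'a measure" where
  "Y_rest l = generated_algebra M Y ({1..} \<times> {1..} - {l})"

definition cond_var :: "nat \<Rightarrow> nat \<times> nat \<Rightarrow> 'a \<Rightarrow> real" where
  "cond_var a p = real_cond_exp M (past a p) (\<lambda>\<omega>. (x p \<omega>)\<^sup>2 - (s p)\<^sup>2)"

lemma C_nonneg: "0 \<le> C"
  using variance_le[of "(0, 0)"] zero_le_power2[of "\<sigma> (0, 0)"] by linarith

lemma e_nonneg: "0 < n \<Longrightarrow> 0 \<le> e n"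
proof -
  assume "0 < n"
  have "0 \<le> expectation (\<lambda>\<omega>. trunc_square n (X (0, 0) \<omega>))"
    by (rule integral_nonneg_AE) (simp add: trunc_square_nonneg)
  also have "\<dots> \<le> e n" by (rule trunc_le) fact
  finally show ?thesis .
qed

lemma x_measurable [measurable]: "x p \<in> borel_measurable M"
  unfolding x_def by measurable

lemma x_square_integrable: "integrable M (\<lambda>\<omega>. (x p \<omega>)\<^sup>2)"
  unfolding x_def by (rule X_square_integrable)

lemma x_integrable: "integrable M (x p)"
  by (rule square_integrable_imp_integrable[OF x_measurable x_square_integrable])

lemma x_variance: "expectation (\<lambda>\<omega>. (x p \<omega>)\<^sup>2) = (s p)\<^sup>2"
  unfolding x_def s_def by (rule X_variance)

lemma s_le: "(s p)\<^sup>2 \<le> C"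
  unfolding s_def by (rule variance_le)

lemma x_trunc_integrable: "integrable M (\<lambda>\<omega>. trunc_square n (x p \<omega>))"
  by (rule Bochner_Integration.integrable_bound[OF x_square_integrable[of p]])
     (auto simp: trunc_square_nonneg trunc_square_le)

lemma x_trunc_le: "0 < n \<Longrightarrow> expectation (\<lambda>\<omega>. trunc_square n (x p \<omega>)) \<le> e n"
  unfolding x_def by (rule trunc_le)

lemma triangle_positive: "p \<in> triangle n \<Longrightarrow> p \<in> {1..} \<times> {1..}"
  by (auto simp: triangle_def)

lemma Y_measurable': "p \<in> triangle n \<Longrightarrow> Y p \<in> borel_measurable M"
  using Y_measurable[of "fst p" "snd p"] by (auto simp: triangle_def)

lemma Y_moments:
  assumes "p \<in> triangle n"
  shows "integrable M (\<lambda>\<omega>. Y p \<omega> ^ k)" "expectation (Y p) = 0" "expectation (\<lambda>\<omega>. (Y p \<omega>)\<^sup>2) = (s p)\<^sup>2"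
    "expectation (\<lambda>\<omega>. (Y p \<omega>) ^ 4) = 3 * (s p) ^ 4"
proof -
  have "distr M borel (Y p) = centered_gaussian ((s p)\<^sup>2)"
    using Y_gaussian[of "fst p" "snd p"] assms by (auto simp: triangle_def s_def)
  note centered_gaussian_moments[OF Y_measurable'[OF assms] this]
  then show "integrable M (\<lambda>\<omega>. Y p \<omega> ^ k)" "expectation (Y p) = 0" "expectation (\<lambda>\<omega>. (Y p \<omega>)\<^sup>2) = (s p)\<^sup>2"
    "expectation (\<lambda>\<omega>. (Y p \<omega>) ^ 4) = 3 * (s p) ^ 4" by blast+
qed

lemma subalgebra_X_alg: "subalgebra M X_alg"
  unfolding X_alg_def by (rule subalgebra_generated_algebra) auto

lemma subalgebra_Y_alg: "subalgebra M Y_alg"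
  unfolding Y_alg_def by (rule subalgebra_generated_algebra) (auto intro: Y_measurable)

lemma subalgebra_Y_rest: "subalgebra Y_alg (Y_rest l)"
  unfolding Y_alg_def Y_rest_def
  by (rule subalgebra_generated_algebra[OF space_generated_algebra]) (auto intro: measurable_generated_algebra)

lemma space_algs [simp]: "space X_alg = space M" "space Y_alg = space M" "space (Y_rest l) = space M"
  "space (past a p) = space M"
  by (simp_all add: X_alg_def Y_alg_def Y_rest_def past_def past_algebra_def)

lemma subalgebra_past: "subalgebra X_alg (past a p)"
  unfolding X_alg_def past_def past_algebra_def
  by (rule subalgebra_generated_algebra[OF space_generated_algebra]) (rule measurable_generated_algebra, simp)

lemma past_subalgebra: "subalgebra M (past a p)"
  by (rule subalgebra_trans[OF subalgebra_X_alg subalgebra_past])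

lemma x_X_alg: "x p \<in> borel_measurable X_alg"
  unfolding x_def X_alg_def by (rule measurable_generated_algebra) simp

definition far :: "nat \<Rightarrow> nat \<times> nat \<Rightarrow> nat \<times> nat \<Rightarrow> bool" where
  "far a k p \<longleftrightarrow> int a \<le> max \<bar>int (fst p) - int (fst k)\<bar> \<bar>int (snd p) - int (snd k)\<bar>"

lemma x_past:
  assumes "lex_less p k" "far a k p" "p \<in> triangle n"
  shows "x p \<in> borel_measurable (past a k)"
  unfolding x_def past_def past_algebra_def using assms
  by (intro measurable_generated_algebra)
     (auto simp: lex_less_def far_def triangle_def past_region_def lex_le_def)

lemma far_one: "lex_less p k \<Longrightarrow> far 1 k p"
  by (auto simp: lex_less_def far_def)

lemma far_rows: "fst p + a \<le> fst k \<Longrightarrow> far a k p"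
  by (auto simp: far_def)

text \<open>The past of \<open>l\<close> lies in rows up to that of \<open>l\<close>, hence at least
  \<open>a\<close> rows before \<open>k\<close>. For \<open>a \<ge> 2\<close> and closer rows the
  inclusion may fail, because entries near \<open>k\<close> that are far from \<open>l\<close> are
  missing from the past of \<open>k\<close>.\<close>

lemma past_mono:
  assumes "fst l + a \<le> fst k" "1 \<le> a"
  shows "subalgebra (past a k) (past a l)"
  unfolding past_def past_algebra_def
proof (rule subalgebra_generated_algebra[OF space_generated_algebra])
  fix q assume q: "q \<in> {(u, v). (u, v) \<in> past_region a (int (fst l), int (snd l)) \<and> v \<le> u}"
  obtain u v where uv: "q = (u, v)" by (cases q)
  have 1: "v \<le> u" "u \<le> int (fst l)" using q uv by (auto simp: past_region_def lex_le_def)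
  then have "int a \<le> \<bar>u - int (fst k)\<bar>" "u < int (fst k)" using assms by auto
  then have "q \<in> {(u, v). (u, v) \<in> past_region a (int (fst k), int (snd k)) \<and> v \<le> u}"
    using uv 1 by (simp add: past_region_def lex_le_def)
  then show "X q \<in> borel_measurable (generated_algebra M X
      {(u, v). (u, v) \<in> past_region a (int (fst k), int (snd k)) \<and> v \<le> u})"
    by (rule measurable_generated_algebra)
qed

text \<open>At distance 1 the past consists of all strictly earlier entries, so it grows along the
  whole lexicographic order.\<close>

lemma past_one_mono:
  assumes "lex_less l k"
  shows "subalgebra (past 1 k) (past 1 l)"
  unfolding past_def past_algebra_def
proof (rule subalgebra_generated_algebra[OF space_generated_algebra])
  fix q assume q: "q \<in> {(u, v). (u, v) \<in> past_region 1 (int (fst l), int (snd l)) \<and> v \<le> u}"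
  obtain u v where uv: "q = (u, v)" by (cases q)
  have "v \<le> u" "u < int (fst l) \<or> u = int (fst l) \<and> v \<le> int (snd l)"
    using q uv by (auto simp: past_region_def lex_le_def)
  then have "v \<le> u" "u < int (fst k) \<or> u = int (fst k) \<and> v < int (snd k)"
    using assms unfolding lex_less_def by linarith+
  then have "q \<in> {(u, v). (u, v) \<in> past_region 1 (int (fst k), int (snd k)) \<and> v \<le> u}"
    using uv by (auto simp: past_region_def lex_le_def)
  then show "X q \<in> borel_measurable (generated_algebra M X
      {(u, v). (u, v) \<in> past_region 1 (int (fst k), int (snd k)) \<and> v \<le> u})"
    by (rule measurable_generated_algebra)
qed

text \<open>All of \<open>Y\<close> is added because the coefficients of the expansion at
  \<open>k\<close> involve the entries of \<open>Y\<close> after \<open>k\<close>.\<close>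

definition past_Y :: "nat \<Rightarrow> nat \<times> nat \<Rightarrow> 'a measure" where
  "past_Y a k = join_algebra (past a k) Y_alg"

text \<open>Everything except \<open>Y l\<close>, for the terms in which \<open>Y l\<close> is the
  centered factor.\<close>

definition X_rest :: "nat \<times> nat \<Rightarrow> 'a measure" where
  "X_rest l = join_algebra (Y_rest l) X_alg"

lemma past_Y:
  "subalgebra M (past_Y a k)" "subalgebra (past_Y a k) (past a k)" "subalgebra (past_Y a k) Y_alg"
  unfolding past_Y_def
  using subalgebra_join_algebra[OF past_subalgebra subalgebra_Y_alg]
    join_algebra(3,4)[of Y_alg "past a k"] by auto

lemma X_rest:
  "subalgebra M (X_rest l)" "subalgebra (X_rest l) (Y_rest l)" "subalgebra (X_rest l) X_alg"
  unfolding X_rest_def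
  using subalgebra_join_algebra[OF subalgebra_trans[OF subalgebra_Y_alg subalgebra_Y_rest] subalgebra_X_alg]
    join_algebra(3,4)[of X_alg "Y_rest l"] by auto

lemma past_Y_mono: "fst l + a \<le> fst k \<Longrightarrow> 1 \<le> a \<Longrightarrow> subalgebra (past_Y a k) (past_Y a l)"
  unfolding past_Y_def by (rule join_algebra_mono[OF past_mono]) auto

lemma past_Y_one_mono: "lex_less l k \<Longrightarrow> subalgebra (past_Y 1 k) (past_Y 1 l)"
  unfolding past_Y_def by (rule join_algebra_mono[OF past_one_mono]) auto

lemma Y_past_Y: "p \<in> triangle n \<Longrightarrow> Y p \<in> borel_measurable (past_Y a k)"
  by (rule measurable_from_subalg[OF past_Y(3)], unfold Y_alg_def, rule measurable_generated_algebra[OF triangle_positive])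

lemma x_past_Y: "lex_less p k \<Longrightarrow> far a k p \<Longrightarrow> p \<in> triangle n \<Longrightarrow> x p \<in> borel_measurable (past_Y a k)"
  by (rule measurable_from_subalg[OF past_Y(2) x_past])

lemma x_X_rest: "x p \<in> borel_measurable (X_rest l)"
  by (rule measurable_from_subalg[OF X_rest(3) x_X_alg])

lemma Y_X_rest: "p \<in> triangle n \<Longrightarrow> p \<noteq> l \<Longrightarrow> Y p \<in> borel_measurable (X_rest l)"
  by (rule measurable_from_subalg[OF X_rest(2)], unfold Y_rest_def, rule measurable_generated_algebra)
     (simp add: triangle_positive[simplified])

lemma XY_indep': "indep_set (sets X_alg) (sets Y_alg)"
  using XY_indep by (simp add: X_alg_def Y_alg_def)

lemma YX_indep: "indep_set (sets Y_alg) (sets X_alg)"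
  using XY_indep' unfolding indep_sets2_eq by (metis Int_commute mult.commute)

lemma cond_exp_past_Y:
  assumes "Z \<in> borel_measurable X_alg" "integrable M Z" "AE \<omega> in M. real_cond_exp M (past a k) Z \<omega> = 0"
  shows "AE \<omega> in M. real_cond_exp M (past_Y a k) Z \<omega> = 0"
  unfolding past_Y_def
  by (rule AE_real_cond_exp_join_algebra[OF subalgebra_X_alg subalgebra_Y_alg subalgebra_past XY_indep' assms])

text \<open>Independence within \<open>Y\<close> centers \<open>g (Y l)\<close> given the other
  entries of \<open>Y\<close>; the independent algebra \<open>X_alg\<close> is then joined. The
  function \<open>g\<close> will be the identity or a centered square.\<close>

lemma cond_exp_X_rest:
  assumes "l \<in> triangle n" and g[measurable]: "g \<in> borel_measurable borel"
    and int: "integrable M (\<lambda>\<omega>. g (Y l \<omega>))" and zero: "expectation (\<lambda>\<omega>. g (Y l \<omega>)) = 0"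
  shows "AE \<omega> in M. real_cond_exp M (X_rest l) (\<lambda>\<omega>. g (Y l \<omega>)) \<omega> = 0"
proof -
  let ?L = "generated_algebra M Y {l}"
  have l: "l \<in> {1..} \<times> {1..}" using assms(1) by (rule triangle_positive)
  have Yl: "Y l \<in> borel_measurable ?L" by (rule measurable_generated_algebra) simp
  have YL: "Y l \<in> borel_measurable Y_alg" unfolding Y_alg_def by (rule measurable_generated_algebra[OF l])
  have L: "subalgebra M ?L"
    using Y_measurable'[OF assms(1)] by (intro subalgebra_generated_algebra) auto
  have "indep_set (sets ?L) (sets (Y_rest l))"
    unfolding Y_rest_def by (rule indep_vars_generated_algebra[OF Y_indep]) (use l in auto)
  then have "AE \<omega> in M. real_cond_exp M (Y_rest l) (\<lambda>\<omega>. g (Y l \<omega>)) \<omega> = 0"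
    by (rule AE_real_cond_exp_indep[OF L subalgebra_trans[OF subalgebra_Y_alg subalgebra_Y_rest] _
          measurable_compose[OF Yl g] int zero])
  then show ?thesis
    unfolding X_rest_def
    by (rule AE_real_cond_exp_join_algebra[OF subalgebra_Y_alg subalgebra_X_alg subalgebra_Y_rest YX_indep
          measurable_compose[OF YL g] int])
qed

section \<open>Second moments of orthogonal sums\<close>

lemma bounded_mult_square:
  fixes c V :: "'a \<Rightarrow> real"
  assumes c[measurable]: "c \<in> borel_measurable M" and bd: "\<And>\<omega>. \<bar>c \<omega>\<bar> \<le> \<kappa>"
    and V[measurable]: "V \<in> borel_measurable M" and int: "integrable M (\<lambda>\<omega>. (V \<omega>)\<^sup>2)"
    and w: "expectation (\<lambda>\<omega>. (V \<omega>)\<^sup>2) \<le> w"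
  shows "integrable M (\<lambda>\<omega>. (c \<omega> * V \<omega>)\<^sup>2)" "expectation (\<lambda>\<omega>. (c \<omega> * V \<omega>)\<^sup>2) \<le> \<kappa>\<^sup>2 * w"
proof -
  have le: "(c \<omega> * V \<omega>)\<^sup>2 \<le> \<kappa>\<^sup>2 * (V \<omega>)\<^sup>2" for \<omega>
  proof -
    have "(c \<omega>)\<^sup>2 \<le> \<kappa>\<^sup>2" using power_mono[OF bd[of \<omega>], of 2] by simp
    then show ?thesis unfolding power_mult_distrib by (rule mult_right_mono) simp
  qed
  have i2: "integrable M (\<lambda>\<omega>. \<kappa>\<^sup>2 * (V \<omega>)\<^sup>2)" using int by simp
  show i1: "integrable M (\<lambda>\<omega>. (c \<omega> * V \<omega>)\<^sup>2)"
    by (rule Bochner_Integration.integrable_bound[OF i2]) (use le in \<open>auto simp del: power_mult_distrib\<close>)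
  have "expectation (\<lambda>\<omega>. (c \<omega> * V \<omega>)\<^sup>2) \<le> expectation (\<lambda>\<omega>. \<kappa>\<^sup>2 * (V \<omega>)\<^sup>2)"
    by (rule integral_mono[OF i1 i2 le])
  also have "\<dots> \<le> \<kappa>\<^sup>2 * w" using mult_left_mono[OF w, of "\<kappa>\<^sup>2"] by simp
  finally show "expectation (\<lambda>\<omega>. (c \<omega> * V \<omega>)\<^sup>2) \<le> \<kappa>\<^sup>2 * w" .
qed

text \<open>A sum of products is orthogonal as soon as, in each product of two distinct terms, one of the
  two factors \<open>V\<close> is conditionally centered given everything else.\<close>

lemma orthogonal_sum_square_le:
  fixes c V :: "nat \<times> nat \<Rightarrow> 'a \<Rightarrow> real"
  assumes J: "\<And>k. k \<in> triangle n \<Longrightarrow> subalgebra M (J k)"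
    and c: "\<And>k. k \<in> triangle n \<Longrightarrow> c k \<in> borel_measurable (J k)" and bd: "\<And>k \<omega>. \<bar>c k \<omega>\<bar> \<le> \<kappa>"
    and V: "\<And>k. k \<in> triangle n \<Longrightarrow> V k \<in> borel_measurable M"
    and int: "\<And>k. k \<in> triangle n \<Longrightarrow> integrable M (\<lambda>\<omega>. (V k \<omega>)\<^sup>2)"
    and w: "\<And>k. k \<in> triangle n \<Longrightarrow> expectation (\<lambda>\<omega>. (V k \<omega>)\<^sup>2) \<le> w" and w0: "0 \<le> w"
    and ce: "\<And>k. k \<in> triangle n \<Longrightarrow> AE \<omega> in M. real_cond_exp M (J k) (V k) \<omega> = 0"
    and P: "P \<subseteq> triangle n \<times> triangle n" "real (card P) \<le> N"
    and order: "\<And>k l. k \<in> triangle n \<Longrightarrow> l \<in> triangle n \<Longrightarrow> (k, l) \<notin> P \<Longrightarrow>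
      c l \<in> borel_measurable (J k) \<and> V l \<in> borel_measurable (J k) \<or>
      c k \<in> borel_measurable (J l) \<and> V k \<in> borel_measurable (J l)"
  shows "integrable M (\<lambda>\<omega>. (\<Sum>k\<in>triangle n. c k \<omega> * V k \<omega>)\<^sup>2)"
    "expectation (\<lambda>\<omega>. (\<Sum>k\<in>triangle n. c k \<omega> * V k \<omega>)\<^sup>2) \<le> N * (\<kappa>\<^sup>2 * w)"
proof -
  have cM: "c k \<in> borel_measurable M" if "k \<in> triangle n" for k
    by (rule measurable_from_subalg[OF J c]) (use that in auto)
  have m: "(\<lambda>\<omega>. c k \<omega> * V k \<omega>) \<in> borel_measurable M" if "k \<in> triangle n" for k
    using cM[OF that] V[OF that] by simp
  have zero: "expectation (\<lambda>\<omega>. (c k \<omega> * V k \<omega>) * (c l \<omega> * V l \<omega>)) = 0"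
    if k: "k \<in> triangle n" and l: "l \<in> triangle n"
      and ml: "c l \<in> borel_measurable (J k)" "V l \<in> borel_measurable (J k)" for k l
  proof -
    \<comment> \<open>The centered factor \<open>V k\<close> is singled out; everything else in the
      product is measurable with respect to \<open>J k\<close>.\<close>
    let ?U = "\<lambda>\<omega>. c k \<omega> * (c l \<omega> * V l \<omega>)"
    have e: "(\<lambda>\<omega>. (c k \<omega> * V k \<omega>) * (c l \<omega> * V l \<omega>)) = (\<lambda>\<omega>. ?U \<omega> * V k \<omega>)"
      by (simp add: mult_ac)
    have "integrable M (\<lambda>\<omega>. (c k \<omega> * V k \<omega>) * (c l \<omega> * V l \<omega>))"
      by (rule integrable_mult_square[OF m[OF k] m[OF l] bounded_mult_square(1)[OF cM[OF k] bd V[OF k] int[OF k] w[OF k]]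
          bounded_mult_square(1)[OF cM[OF l] bd V[OF l] int[OF l] w[OF l]]])
    then have "integrable M (\<lambda>\<omega>. ?U \<omega> * V k \<omega>)" unfolding e .
    moreover have "?U \<in> borel_measurable (J k)" using c[OF k] ml by simp
    ultimately show ?thesis
      unfolding e by (intro integral_mult_eq_zero[OF J[OF k] ce[OF k]] V[OF k])
  qed
  have orth: "expectation (\<lambda>\<omega>. (c k \<omega> * V k \<omega>) * (c l \<omega> * V l \<omega>)) = 0"
    if "k \<in> triangle n" "l \<in> triangle n" "(k, l) \<notin> P" for k l
    using order[OF that] zero[of k l] zero[of l k] that by (auto simp: mult.commute)
  have "0 \<le> \<kappa>\<^sup>2 * w" using w0 by simp
  note R = integral_sum_square_le[OF finite_triangle m
      bounded_mult_square(1)[OF cM bd V int w] bounded_mult_square(2)[OF cM bd V int w] P(1) this P(2) orth]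
  show "integrable M (\<lambda>\<omega>. (\<Sum>k\<in>triangle n. c k \<omega> * V k \<omega>)\<^sup>2)" by (rule R(1))
  show "expectation (\<lambda>\<omega>. (\<Sum>k\<in>triangle n. c k \<omega> * V k \<omega>)\<^sup>2) \<le> N * (\<kappa>\<^sup>2 * w)" by (rule R(2))
qed

lemma diagonal: "(\<lambda>k. (k, k)) ` triangle n \<subseteq> triangle n \<times> triangle n"
    "real (card ((\<lambda>k. (k, k)) ` triangle n)) \<le> (real n)\<^sup>2"
proof -
  have "card ((\<lambda>k. (k, k)) ` triangle n) \<le> n\<^sup>2"
    using card_image_le[OF finite_triangle] card_triangle_le by (rule order_trans)
  then show "real (card ((\<lambda>k. (k, k)) ` triangle n)) \<le> (real n)\<^sup>2"
    unfolding of_nat_power[symmetric] by (rule of_nat_mono)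
qed auto

text \<open>For \<open>l\<close> before \<open>k\<close> the term of \<open>l\<close> and the
  coefficient at \<open>k\<close> are known given \<open>past_Y 1 k\<close>, while
  \<open>x k\<close> is centered. Only the diagonal of the double sum survives.\<close>

lemma martingale_sum_square_le:
  fixes c :: "nat \<times> nat \<Rightarrow> 'a \<Rightarrow> real"
  assumes c: "\<And>k. k \<in> triangle n \<Longrightarrow> c k \<in> borel_measurable (past_Y 1 k)" and bd: "\<And>k \<omega>. \<bar>c k \<omega>\<bar> \<le> \<kappa>"
  shows "integrable M (\<lambda>\<omega>. (\<Sum>k\<in>triangle n. c k \<omega> * x k \<omega>)\<^sup>2)"
    "expectation (\<lambda>\<omega>. (\<Sum>k\<in>triangle n. c k \<omega> * x k \<omega>)\<^sup>2) \<le> (real n)\<^sup>2 * (\<kappa>\<^sup>2 * C)"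
proof -
  have ce: "AE \<omega> in M. real_cond_exp M (past_Y 1 k) (x k) \<omega> = 0" if "k \<in> triangle n" for k
  proof (rule cond_exp_past_Y[OF x_X_alg x_integrable])
    show "AE \<omega> in M. real_cond_exp M (past 1 k) (x k) \<omega> = 0"
      unfolding x_def past_def by (rule martingale) (use that in \<open>auto simp: triangle_def\<close>)
  qed
  have v: "expectation (\<lambda>\<omega>. (x k \<omega>)\<^sup>2) \<le> C" for k unfolding x_variance by (rule s_le)
  have mono: "c l \<in> borel_measurable (past_Y 1 k) \<and> x l \<in> borel_measurable (past_Y 1 k)"
    if "k \<in> triangle n" "l \<in> triangle n" "lex_less l k" for k l
    using measurable_from_subalg[OF past_Y_one_mono[OF that(3)] c[OF that(2)]]
      x_past_Y[OF that(3) far_one[OF that(3)] that(2)] by simp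
  have order: "c l \<in> borel_measurable (past_Y 1 k) \<and> x l \<in> borel_measurable (past_Y 1 k) \<or>
      c k \<in> borel_measurable (past_Y 1 l) \<and> x k \<in> borel_measurable (past_Y 1 l)"
    if kl: "k \<in> triangle n" "l \<in> triangle n" "(k, l) \<notin> (\<lambda>k. (k, k)) ` triangle n" for k l
  proof -
    have "k \<noteq> l" using kl by auto
    then consider "lex_less l k" | "lex_less k l" using lex_less_linear by blast
    then show ?thesis using mono[OF kl(1,2)] mono[OF kl(2,1)] by cases blast+
  qed
  note R = orthogonal_sum_square_le[where J = "past_Y 1" and V = x, OF past_Y(1) c bd x_measurable
      x_square_integrable v C_nonneg ce diagonal order]
  show "integrable M (\<lambda>\<omega>. (\<Sum>k\<in>triangle n. c k \<omega> * x k \<omega>)\<^sup>2)" by (rule R(1))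
  show "expectation (\<lambda>\<omega>. (\<Sum>k\<in>triangle n. c k \<omega> * x k \<omega>)\<^sup>2) \<le> (real n)\<^sup>2 * (\<kappa>\<^sup>2 * C)" by (rule R(2))
qed

text \<open>Conditioning runs backwards here. The coefficient at \<open>k\<close> is known given
  \<open>X_rest l\<close> for every \<open>l\<close> up to \<open>k\<close>; hence in the product of
  the terms of \<open>k\<close> and of an earlier \<open>l\<close>, everything but
  \<open>Y l\<close> is known given \<open>X_rest l\<close>.\<close>

lemma independent_sum_square_le:
  fixes c :: "nat \<times> nat \<Rightarrow> 'a \<Rightarrow> real" and g :: "nat \<times> nat \<Rightarrow> real \<Rightarrow> real"
  assumes c: "\<And>k l. k \<in> triangle n \<Longrightarrow> l = k \<or> lex_less l k \<Longrightarrow> c k \<in> borel_measurable (X_rest l)"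
    and bd: "\<And>k \<omega>. \<bar>c k \<omega>\<bar> \<le> \<kappa>"
    and g: "\<And>k. g k \<in> borel_measurable borel"
    and int: "\<And>k. k \<in> triangle n \<Longrightarrow> integrable M (\<lambda>\<omega>. (g k (Y k \<omega>))\<^sup>2)"
    and zero: "\<And>k. k \<in> triangle n \<Longrightarrow> expectation (\<lambda>\<omega>. g k (Y k \<omega>)) = 0"
    and w: "\<And>k. k \<in> triangle n \<Longrightarrow> expectation (\<lambda>\<omega>. (g k (Y k \<omega>))\<^sup>2) \<le> w" and w0: "0 \<le> w"
  shows "integrable M (\<lambda>\<omega>. (\<Sum>k\<in>triangle n. c k \<omega> * g k (Y k \<omega>))\<^sup>2)"
    "expectation (\<lambda>\<omega>. (\<Sum>k\<in>triangle n. c k \<omega> * g k (Y k \<omega>))\<^sup>2) \<le> (real n)\<^sup>2 * (\<kappa>\<^sup>2 * w)"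
proof -
  have V: "(\<lambda>\<omega>. g k (Y k \<omega>)) \<in> borel_measurable M" if "k \<in> triangle n" for k
    by (rule measurable_compose[OF Y_measurable'[OF that] g])
  have ce: "AE \<omega> in M. real_cond_exp M (X_rest k) (\<lambda>\<omega>. g k (Y k \<omega>)) \<omega> = 0" if "k \<in> triangle n" for k
    by (rule cond_exp_X_rest[OF that g square_integrable_imp_integrable[OF V[OF that] int[OF that]] zero[OF that]])
  have mono: "c k \<in> borel_measurable (X_rest l) \<and> (\<lambda>\<omega>. g k (Y k \<omega>)) \<in> borel_measurable (X_rest l)"
    if "k \<in> triangle n" "lex_less l k" for k l
  proof -
    have "k \<noteq> l" using that(2) lex_less_irrefl by blast
    then show ?thesis
      using c[OF that(1)] that(2) measurable_compose[OF Y_X_rest[OF that(1)] g] by simp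
  qed
  have order: "c l \<in> borel_measurable (X_rest k) \<and> (\<lambda>\<omega>. g l (Y l \<omega>)) \<in> borel_measurable (X_rest k) \<or>
      c k \<in> borel_measurable (X_rest l) \<and> (\<lambda>\<omega>. g k (Y k \<omega>)) \<in> borel_measurable (X_rest l)"
    if kl: "k \<in> triangle n" "l \<in> triangle n" "(k, l) \<notin> (\<lambda>k. (k, k)) ` triangle n" for k l
  proof -
    have "k \<noteq> l" using kl by auto
    then consider "lex_less l k" | "lex_less k l" using lex_less_linear by blast
    then show ?thesis using mono[OF kl(1), of l] mono[OF kl(2), of k] by cases blast+
  qed
  note R = orthogonal_sum_square_le[where J = X_rest and V = "\<lambda>k \<omega>. g k (Y k \<omega>)", OF X_rest(1) c[OF _ disjI1[OF refl]] bd V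
      int w w0 ce diagonal order]
  show "integrable M (\<lambda>\<omega>. (\<Sum>k\<in>triangle n. c k \<omega> * g k (Y k \<omega>))\<^sup>2)" by (rule R(1))
  show "expectation (\<lambda>\<omega>. (\<Sum>k\<in>triangle n. c k \<omega> * g k (Y k \<omega>))\<^sup>2) \<le> (real n)\<^sup>2 * (\<kappa>\<^sup>2 * w)" by (rule R(2))
qed

section \<open>Conditionally centered squares and their truncation\<close>

definition cut :: "nat \<Rightarrow> nat \<times> nat \<Rightarrow> 'a \<Rightarrow> real" where
  "cut n k \<omega> = min ((x k \<omega>)\<^sup>2) (real n)"

definition cut_residual :: "nat \<Rightarrow> nat \<Rightarrow> nat \<times> nat \<Rightarrow> 'a \<Rightarrow> real" where
  "cut_residual a n k \<omega> = cut n k \<omega> - real_cond_exp M (past a k) (cut n k) \<omega>"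

text \<open>Defined by subtraction, so that the two residuals add up exactly; almost surely it is
  the excess of the square over the level \<open>n\<close>, conditionally centered.\<close>

definition tail_residual :: "nat \<Rightarrow> nat \<Rightarrow> nat \<times> nat \<Rightarrow> 'a \<Rightarrow> real" where
  "tail_residual a n k \<omega> = (x k \<omega>)\<^sup>2 - (s k)\<^sup>2 - cond_var a k \<omega> - cut_residual a n k \<omega>"

lemma cut_X_alg: "cut n k \<in> borel_measurable X_alg"
  using x_X_alg[of k] unfolding cut_def by measurable

lemma cut_measurable [measurable]: "cut n k \<in> borel_measurable M"
  by (rule measurable_from_subalg[OF subalgebra_X_alg cut_X_alg])

lemma cut_square:
  assumes n: "0 < n"
  shows "integrable M (\<lambda>\<omega>. (cut n k \<omega>)\<^sup>2)" "expectation (\<lambda>\<omega>. (cut n k \<omega>)\<^sup>2) \<le> real n * e n"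
proof -
  have i: "integrable M (\<lambda>\<omega>. real n * trunc_square n (x k \<omega>))" using x_trunc_integrable by simp
  have le: "(cut n k \<omega>)\<^sup>2 \<le> real n * trunc_square n (x k \<omega>)" for \<omega>
    unfolding cut_def by (rule min_square_excess_le(2)[OF n])
  show j: "integrable M (\<lambda>\<omega>. (cut n k \<omega>)\<^sup>2)"
    by (rule Bochner_Integration.integrable_bound[OF i]) (use le trunc_square_nonneg in auto)
  have "expectation (\<lambda>\<omega>. (cut n k \<omega>)\<^sup>2) \<le> expectation (\<lambda>\<omega>. real n * trunc_square n (x k \<omega>))"
    by (rule integral_mono[OF j i le])
  also have "\<dots> \<le> real n * e n" using mult_left_mono[OF x_trunc_le[OF n], of "real n" k] by simp
  finally show "expectation (\<lambda>\<omega>. (cut n k \<omega>)\<^sup>2) \<le> real n * e n" .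
qed

lemma cut_integrable: "0 < n \<Longrightarrow> integrable M (cut n k)"
  by (rule square_integrable_imp_integrable[OF cut_measurable cut_square(1)])

lemma cut_residual_X_alg: "cut_residual a n k \<in> borel_measurable X_alg"
proof -
  have "real_cond_exp M (past a k) (cut n k) \<in> borel_measurable X_alg"
    by (rule measurable_from_subalg[OF subalgebra_past borel_measurable_cond_exp])
  then show ?thesis using cut_X_alg[of n k] unfolding cut_residual_def by measurable
qed

lemma cut_residual_past:
  assumes "fst l + a \<le> fst k" "1 \<le> a" "l \<in> triangle n"
  shows "cut_residual a m l \<in> borel_measurable (past a k)"
proof -
  have "real_cond_exp M (past a l) (cut m l) \<in> borel_measurable (past a k)"
    by (rule measurable_from_subalg[OF past_mono[OF assms(1,2)] borel_measurable_cond_exp])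
  moreover have "lex_less l k" using assms(1,2) by (simp add: lex_less_def)
  then have "x l \<in> borel_measurable (past a k)"
    by (rule x_past[OF _ far_rows[OF assms(1)] assms(3)])
  ultimately show ?thesis unfolding cut_residual_def cut_def by measurable
qed

lemma cut_residual_cond_exp:
  assumes n: "0 < n"
  shows "AE \<omega> in M. real_cond_exp M (past a k) (cut_residual a n k) \<omega> = 0"
proof -
  interpret G: sigma_finite_subalgebra M "past a k" by (rule sigma_finite_subalgebraI[OF past_subalgebra])
  let ?E = "real_cond_exp M (past a k)"
  have i: "integrable M (?E (cut n k))" by (rule G.real_cond_exp_int(1)[OF cut_integrable[OF n]])
  have "AE \<omega> in M. ?E (\<lambda>\<omega>. cut n k \<omega> - ?E (cut n k) \<omega>) \<omega> = ?E (cut n k) \<omega> - ?E (?E (cut n k)) \<omega>"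
    by (rule G.real_cond_exp_diff[OF cut_integrable[OF n] i])
  moreover have "AE \<omega> in M. ?E (?E (cut n k)) \<omega> = ?E (cut n k) \<omega>"
    by (rule G.real_cond_exp_F_meas[OF i borel_measurable_cond_exp])
  ultimately show ?thesis
    unfolding cut_residual_def[abs_def] by eventually_elim simp
qed

text \<open>Two terms may be correlated only if their rows are closer than \<open>a\<close>, which
  leaves at most \<open>2 * a * n\<close> partners for each of at most \<open>n\<^sup>2\<close>
  entries. Truncation bounds the second moment of a square by \<open>n * e n\<close>, and 4 is the
  price of centering.\<close>

lemma cut_residual_sum_square_le:
  fixes c :: "nat \<times> nat \<Rightarrow> 'a \<Rightarrow> real"
  assumes n: "0 < n" and a: "1 \<le> a"
    and c: "\<And>k. k \<in> triangle n \<Longrightarrow> c k \<in> borel_measurable (past_Y a k)" and bd: "\<And>k \<omega>. \<bar>c k \<omega>\<bar> \<le> \<kappa>"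
  shows "integrable M (\<lambda>\<omega>. (\<Sum>k\<in>triangle n. c k \<omega> * cut_residual a n k \<omega>)\<^sup>2)"
    "expectation (\<lambda>\<omega>. (\<Sum>k\<in>triangle n. c k \<omega> * cut_residual a n k \<omega>)\<^sup>2)
      \<le> (2 * real a * real n ^ 3) * (\<kappa>\<^sup>2 * (4 * (real n * e n)))"
proof -
  let ?P = "{(k, l). k \<in> triangle n \<and> l \<in> triangle n \<and> fst k < fst l + a \<and> fst l < fst k + a}"
  have res: "integrable M (\<lambda>\<omega>. (cut_residual a n k \<omega>)\<^sup>2)"
    "expectation (\<lambda>\<omega>. (cut_residual a n k \<omega>)\<^sup>2) \<le> 4 * (real n * e n)" for k
  proof -
    note R = integral_cond_exp_residual_square_le[OF past_subalgebra[of a k] cut_measurable[of n k] cut_square(1)[OF n, of k]]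
    show "integrable M (\<lambda>\<omega>. (cut_residual a n k \<omega>)\<^sup>2)" unfolding cut_residual_def by (rule R(1))
    show "expectation (\<lambda>\<omega>. (cut_residual a n k \<omega>)\<^sup>2) \<le> 4 * (real n * e n)"
      unfolding cut_residual_def using R(2) cut_square(2)[OF n, of k] by linarith
  qed
  have meas: "cut_residual a n k \<in> borel_measurable M" for k
    by (rule measurable_from_subalg[OF subalgebra_X_alg cut_residual_X_alg])
  have int: "integrable M (cut_residual a n k)" for k
    by (rule square_integrable_imp_integrable[OF meas res(1)])
  have ce: "AE \<omega> in M. real_cond_exp M (past_Y a k) (cut_residual a n k) \<omega> = 0" for k
    by (rule cond_exp_past_Y[OF cut_residual_X_alg int cut_residual_cond_exp[OF n]])
  have P1: "?P \<subseteq> triangle n \<times> triangle n" by auto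
  have P2: "real (card ?P) \<le> 2 * real a * real n ^ 3"
  proof -
    let ?S = "Sigma (triangle n) (\<lambda>k. {fst k + 1 - a..<fst k + a} \<times> {1..n})"
    have "card ?P \<le> card ?S"
    proof (rule card_mono)
      show "finite ?S" by (intro finite_SigmaI finite_triangle finite_cartesian_product) auto
      show "?P \<subseteq> ?S" by (auto simp: triangle_def)
    qed
    also have "\<dots> = (\<Sum>k\<in>triangle n. card ({fst k + 1 - a..<fst k + a} \<times> {1..n}))"
      by (rule card_SigmaI) (auto simp: finite_triangle)
    also have "\<dots> \<le> (\<Sum>k\<in>triangle n. (2 * a) * n)"
      by (rule sum_mono) (auto simp: card_cartesian_product)
    also have "\<dots> = card (triangle n) * (2 * a * n)" by simp
    also have "\<dots> \<le> n\<^sup>2 * (2 * a * n)" by (intro mult_right_mono card_triangle_le) simp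
    finally have "real (card ?P) \<le> real (n\<^sup>2 * (2 * a * n))" by (rule of_nat_mono)
    then show ?thesis by (simp add: power2_eq_square power3_eq_cube mult_ac)
  qed
  have w0: "0 \<le> 4 * (real n * e n)" using e_nonneg[OF n] by simp
  have mono: "c l \<in> borel_measurable (past_Y a k) \<and> cut_residual a n l \<in> borel_measurable (past_Y a k)"
    if "l \<in> triangle n" "fst l + a \<le> fst k" for k l
    using measurable_from_subalg[OF past_Y_mono[OF that(2) a] c[OF that(1)]]
      measurable_from_subalg[OF past_Y(2) cut_residual_past[OF that(2) a that(1)]] by simp
  have order: "c l \<in> borel_measurable (past_Y a k) \<and> cut_residual a n l \<in> borel_measurable (past_Y a k) \<or>
      c k \<in> borel_measurable (past_Y a l) \<and> cut_residual a n k \<in> borel_measurable (past_Y a l)"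
    if kl: "k \<in> triangle n" "l \<in> triangle n" "(k, l) \<notin> ?P" for k l
  proof -
    consider "fst l + a \<le> fst k" | "fst k + a \<le> fst l" using kl by fastforce
    then show ?thesis using mono[OF kl(2), of k] mono[OF kl(1), of l] by cases blast+
  qed
  note R = orthogonal_sum_square_le[where J = "past_Y a" and V = "cut_residual a n" and P = ?P,
      OF past_Y(1) c bd meas res(1) res(2) w0 ce P1 P2 order]
  show "integrable M (\<lambda>\<omega>. (\<Sum>k\<in>triangle n. c k \<omega> * cut_residual a n k \<omega>)\<^sup>2)" by (rule R(1))
  show "expectation (\<lambda>\<omega>. (\<Sum>k\<in>triangle n. c k \<omega> * cut_residual a n k \<omega>)\<^sup>2)
      \<le> (2 * real a * real n ^ 3) * (\<kappa>\<^sup>2 * (4 * (real n * e n)))" by (rule R(2))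
qed

lemma tail_residual_le:
  assumes n: "0 < n"
  shows "integrable M (tail_residual a n k)" "expectation (\<lambda>\<omega>. \<bar>tail_residual a n k \<omega>\<bar>) \<le> 2 * e n"
proof -
  interpret G: sigma_finite_subalgebra M "past a k" by (rule sigma_finite_subalgebraI[OF past_subalgebra])
  let ?E = "real_cond_exp M (past a k)"
  define V where "V \<omega> = (x k \<omega>)\<^sup>2 - cut n k \<omega>" for \<omega>
  have Vm[measurable]: "V \<in> borel_measurable M" unfolding V_def by measurable
  have Vi: "integrable M V" unfolding V_def
    using x_square_integrable cut_integrable[OF n] by (rule Bochner_Integration.integrable_diff)
  have V0: "0 \<le> V \<omega>" for \<omega> by (simp add: V_def cut_def)
  have Vle: "expectation V \<le> e n"
  proof -
    have "expectation V \<le> expectation (\<lambda>\<omega>. trunc_square n (x k \<omega>))"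
      using min_square_excess_le(1)[OF n]
      by (intro integral_mono Vi x_trunc_integrable) (simp add: V_def cut_def)
    also have "\<dots> \<le> e n" by (rule x_trunc_le[OF n])
    finally show ?thesis .
  qed
  have EV: "integrable M (?E V)" "expectation (?E V) = expectation V" "AE \<omega> in M. 0 \<le> ?E V \<omega>"
    using G.real_cond_exp_int[OF Vi] G.real_cond_exp_pos[OF _ Vm] V0 by auto
  have eq: "AE \<omega> in M. tail_residual a n k \<omega> = V \<omega> - ?E V \<omega>"
  proof -
    have i1: "integrable M (\<lambda>\<omega>. V \<omega> - (s k)\<^sup>2)" using Vi by simp
    have d: "(\<lambda>\<omega>. (x k \<omega>)\<^sup>2 - (s k)\<^sup>2) = (\<lambda>\<omega>. cut n k \<omega> + (V \<omega> - (s k)\<^sup>2))" by (simp add: V_def)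
    have "AE \<omega> in M. cond_var a k \<omega> = ?E (cut n k) \<omega> + ?E (\<lambda>\<omega>. V \<omega> - (s k)\<^sup>2) \<omega>"
      unfolding cond_var_def d by (rule G.real_cond_exp_add[OF cut_integrable[OF n] i1])
    moreover have "AE \<omega> in M. ?E (\<lambda>\<omega>. V \<omega> - (s k)\<^sup>2) \<omega> = ?E V \<omega> - ?E (\<lambda>\<omega>. (s k)\<^sup>2) \<omega>"
      by (rule G.real_cond_exp_diff[OF Vi]) simp
    moreover have "AE \<omega> in M. ?E (\<lambda>\<omega>. (s k)\<^sup>2) \<omega> = (s k)\<^sup>2"
      by (rule G.real_cond_exp_F_meas) auto
    ultimately show ?thesis
      by eventually_elim (simp add: tail_residual_def cut_residual_def V_def)
  qed
  have m: "tail_residual a n k \<in> borel_measurable M"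
    unfolding tail_residual_def cut_residual_def cond_var_def by measurable
  have i2: "integrable M (\<lambda>\<omega>. V \<omega> + ?E V \<omega>)" using Vi EV(1) by simp
  have le: "AE \<omega> in M. \<bar>tail_residual a n k \<omega>\<bar> \<le> V \<omega> + ?E V \<omega>"
    using eq EV(3)
  proof eventually_elim
    case (elim \<omega>)
    then show ?case unfolding elim(1) abs_le_iff using V0[of \<omega>] by linarith
  qed
  show i: "integrable M (tail_residual a n k)"
  proof (rule Bochner_Integration.integrable_bound[OF i2 m])
    show "AE \<omega> in M. norm (tail_residual a n k \<omega>) \<le> norm (V \<omega> + ?E V \<omega>)"
      using le
    proof eventually_elim
      case (elim \<omega>)
      then show ?case unfolding real_norm_def by (rule order_trans) (rule abs_ge_self)
    qed
  qed
  have "expectation (\<lambda>\<omega>. \<bar>tail_residual a n k \<omega>\<bar>) \<le> expectation (\<lambda>\<omega>. V \<omega> + ?E V \<omega>)"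
    by (rule integral_mono_AE[OF integrable_abs[OF i] i2 le])
  also have "\<dots> \<le> 2 * e n" using Vi EV Vle by simp
  finally show "expectation (\<lambda>\<omega>. \<bar>tail_residual a n k \<omega>\<bar>) \<le> 2 * e n" .
qed

section \<open>Almost sure limits along geometric sequences\<close>

definition rate :: "nat \<Rightarrow> real" where
  "rate n = e n + 1 / sqrt (real n)"

lemma rate_nonneg: "0 < n \<Longrightarrow> 0 \<le> rate n"
  unfolding rate_def using e_nonneg by simp

lemma e_le_rate: "e n \<le> rate n"
  unfolding rate_def by simp

lemma inverse_le_rate:
  assumes "0 < n"
  shows "1 / real n \<le> rate n" "1 / sqrt (real n) \<le> rate n"
proof -
  show 1: "1 / sqrt (real n) \<le> rate n" unfolding rate_def using e_nonneg[OF assms] by simp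
  have "sqrt (real n) \<le> real n" using assms by (intro real_le_lsqrt) (auto simp: power2_eq_square)
  then have "1 / real n \<le> 1 / sqrt (real n)" using assms by (simp add: frac_le)
  with 1 show "1 / real n \<le> rate n" by simp
qed

text \<open>The part \<open>e\<close> is summable by assumption. The other part, which absorbs the
  errors \<open>1 / n\<close> of orthogonal sums and \<open>1 / sqrt n\<close> of uniformly bounded
  moments, is geometric with ratio 1/2.\<close>

lemma rate_summable:
  assumes "0 < c"
  shows "summable (\<lambda>j. \<kappa> * rate (c * 4 ^ j))"
proof -
  have "sqrt (4 ^ j) = 2 ^ j" for j :: nat
    using real_sqrt_power[of 4 j] by simp
  then have "1 / sqrt (real (c * 4 ^ j)) = 1 / sqrt (real c) * (1 / 2) ^ j" for j
    by (simp add: real_sqrt_mult power_divide)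
  then have "summable (\<lambda>j. 1 / sqrt (real (c * 4 ^ j)))"
    by (simp add: summable_geometric summable_mult)
  then show ?thesis
    unfolding rate_def by (intro summable_mult summable_add e_summable[OF assms])
qed

lemma AE_tendsto_along_L1:
  assumes int: "\<And>n. 0 < n \<Longrightarrow> integrable M (Z n)"
    and le: "\<And>n. 0 < n \<Longrightarrow> expectation (\<lambda>\<omega>. \<bar>Z n \<omega>\<bar>) \<le> \<kappa> * rate n" and c: "0 < c"
  shows "AE \<omega> in M. (\<lambda>j. Z (c * 4 ^ j) \<omega>) \<longlonglongrightarrow> 0"
proof (rule AE_tendsto_zero_summable[where \<eta> = "\<lambda>j. \<kappa> * rate (c * 4 ^ j)"])
  fix j
  have n: "0 < c * 4 ^ j" using c by simp
  show "Z (c * 4 ^ j) \<in> borel_measurable M" using int[OF n] by (rule borel_measurable_integrable)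
  have "(\<integral>\<^sup>+ \<omega>. ennreal \<bar>Z (c * 4 ^ j) \<omega>\<bar> \<partial>M) = ennreal (expectation (\<lambda>\<omega>. \<bar>Z (c * 4 ^ j) \<omega>\<bar>))"
    by (rule nn_integral_eq_integral[OF integrable_abs[OF int[OF n]]]) simp
  also have "\<dots> \<le> ennreal (\<kappa> * rate (c * 4 ^ j))" by (rule ennreal_leI[OF le[OF n]])
  finally show "(\<integral>\<^sup>+ \<omega>. ennreal \<bar>Z (c * 4 ^ j) \<omega>\<bar> \<partial>M) \<le> ennreal (\<kappa> * rate (c * 4 ^ j))" .
  have "0 \<le> expectation (\<lambda>\<omega>. \<bar>Z (c * 4 ^ j) \<omega>\<bar>)" by simp
  then show "0 \<le> \<kappa> * rate (c * 4 ^ j)" using le[OF n] by linarith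
qed (rule rate_summable[OF c])

lemma AE_tendsto_along_L2:
  assumes meas: "\<And>n. 0 < n \<Longrightarrow> Z n \<in> borel_measurable M"
    and int: "\<And>n. 0 < n \<Longrightarrow> integrable M (\<lambda>\<omega>. (Z n \<omega>)\<^sup>2)"
    and le: "\<And>n. 0 < n \<Longrightarrow> expectation (\<lambda>\<omega>. (Z n \<omega>)\<^sup>2) \<le> \<kappa> * rate n" and c: "0 < c"
  shows "AE \<omega> in M. (\<lambda>j. Z (c * 4 ^ j) \<omega>) \<longlonglongrightarrow> 0"
proof (rule AE_tendsto_zero_square_summable[where \<eta> = "\<lambda>j. \<kappa> * rate (c * 4 ^ j)"])
  fix j
  have n: "0 < c * 4 ^ j" using c by simp
  show "Z (c * 4 ^ j) \<in> borel_measurable M" by (rule meas[OF n])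
  show "integrable M (\<lambda>\<omega>. (Z (c * 4 ^ j) \<omega>)\<^sup>2)" by (rule int[OF n])
  show "expectation (\<lambda>\<omega>. (Z (c * 4 ^ j) \<omega>)\<^sup>2) \<le> \<kappa> * rate (c * 4 ^ j)" by (rule le[OF n])
qed (rule rate_summable[OF c])

lemma card_triangle_le_real: "real (card (triangle n)) \<le> (real n)\<^sup>2"
  unfolding of_nat_power[symmetric] by (rule of_nat_mono[OF card_triangle_le])

lemma sum_triangle_le:
  assumes "\<And>k. k \<in> triangle n \<Longrightarrow> f k \<le> w" "0 \<le> w"
  shows "(\<Sum>k\<in>triangle n. f k) \<le> (real n)\<^sup>2 * w"
proof -
  have "(\<Sum>k\<in>triangle n. f k) \<le> real (card (triangle n)) * w" by (rule sum_bounded_above[OF assms(1)])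
  also have "\<dots> \<le> (real n)\<^sup>2 * w" by (rule mult_right_mono[OF card_triangle_le_real assms(2)])
  finally show ?thesis .
qed

text \<open>For error sums with a pointwise majorant \<open>G\<close>, on which integrability and
  the rate are checked.\<close>

lemma AE_tendsto_along_dominated:
  assumes meas: "\<And>n. 0 < n \<Longrightarrow> Z n \<in> borel_measurable M"
    and dom: "\<And>n \<omega>. 0 < n \<Longrightarrow> \<bar>Z n \<omega>\<bar> \<le> G n \<omega>" and int: "\<And>n. 0 < n \<Longrightarrow> integrable M (G n)"
    and le: "\<And>n. 0 < n \<Longrightarrow> expectation (G n) \<le> \<kappa> * rate n" and c: "0 < c"
  shows "AE \<omega> in M. (\<lambda>j. Z (c * 4 ^ j) \<omega>) \<longlonglongrightarrow> 0"
proof (rule AE_tendsto_along_L1[OF _ _ c])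
  fix n :: nat assume n: "0 < n"
  show i: "integrable M (Z n)"
  proof (rule Bochner_Integration.integrable_bound[OF int[OF n] meas[OF n]], rule AE_I2)
    show "norm (Z n \<omega>) \<le> norm (G n \<omega>)" for \<omega>
      using dom[OF n, of \<omega>] unfolding real_norm_def by (rule order_trans) (rule abs_ge_self)
  qed
  have "expectation (\<lambda>\<omega>. \<bar>Z n \<omega>\<bar>) \<le> expectation (G n)"
    by (rule integral_mono[OF integrable_abs[OF i] int[OF n] dom[OF n]])
  then show "expectation (\<lambda>\<omega>. \<bar>Z n \<omega>\<bar>) \<le> \<kappa> * rate n" using le[OF n] by linarith
qed

text \<open>The truncated residuals vanish in mean square, with \<open>O(n\<^sup>3)\<close> pairs of
  size \<open>n * e n\<close> and weights \<open>n\<^sup>-\<^sup>4\<close>; the tails vanish in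
  mean. The random coefficients are those of the second order terms, constant ones give the law of
  large numbers for squares.\<close>

lemma AE_centered_square_sum:
  fixes b :: "nat \<Rightarrow> nat \<times> nat \<Rightarrow> 'a \<Rightarrow> real"
  assumes a: "1 \<le> a" and c: "0 < c" and K: "0 \<le> K"
    and b: "\<And>n k. 0 < n \<Longrightarrow> k \<in> triangle n \<Longrightarrow> b n k \<in> borel_measurable (past_Y a k)"
    and bd: "\<And>n k \<omega>. 0 < n \<Longrightarrow> \<bar>b n k \<omega>\<bar> \<le> K / (real n)\<^sup>2"
  shows "AE \<omega> in M. (\<lambda>j. \<Sum>k\<in>triangle (c * 4 ^ j).
    b (c * 4 ^ j) k \<omega> * ((x k \<omega>)\<^sup>2 - (s k)\<^sup>2 - cond_var a k \<omega>)) \<longlonglongrightarrow> 0"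
proof -
  define S where "S n \<omega> = (\<Sum>k\<in>triangle n. b n k \<omega> * cut_residual a n k \<omega>)" for n \<omega>
  define R where "R n \<omega> = (\<Sum>k\<in>triangle n. b n k \<omega> * tail_residual a n k \<omega>)" for n \<omega>
  have bM: "b n k \<in> borel_measurable M" if "0 < n" "k \<in> triangle n" for n k
    by (rule measurable_from_subalg[OF past_Y(1) b[OF that]])
  have S: "AE \<omega> in M. (\<lambda>j. S (c * 4 ^ j) \<omega>) \<longlonglongrightarrow> 0"
  proof (rule AE_tendsto_along_L2[where \<kappa> = "8 * real a * K\<^sup>2", OF _ _ _ c])
    fix n :: nat assume n: "0 < n"
    have "cut_residual a n k \<in> borel_measurable M" for k
      by (rule measurable_from_subalg[OF subalgebra_X_alg cut_residual_X_alg])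
    then show "S n \<in> borel_measurable M"
      unfolding S_def by (intro borel_measurable_sum borel_measurable_times bM[OF n])
    note R = cut_residual_sum_square_le[OF n a b[OF n] bd[OF n]]
    show "integrable M (\<lambda>\<omega>. (S n \<omega>)\<^sup>2)" unfolding S_def by (rule R(1))
    have "expectation (\<lambda>\<omega>. (S n \<omega>)\<^sup>2) \<le> 2 * real a * real n ^ 3 * ((K / (real n)\<^sup>2)\<^sup>2 * (4 * (real n * e n)))"
      unfolding S_def by (rule R(2))
    also have "\<dots> = 8 * real a * K\<^sup>2 * e n"
      using n by (simp add: field_simps power2_eq_square power3_eq_cube)
    also have "\<dots> \<le> 8 * real a * K\<^sup>2 * rate n" by (intro mult_left_mono e_le_rate) simp
    finally show "expectation (\<lambda>\<omega>. (S n \<omega>)\<^sup>2) \<le> 8 * real a * K\<^sup>2 * rate n" .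
  qed
  have R: "AE \<omega> in M. (\<lambda>j. R (c * 4 ^ j) \<omega>) \<longlonglongrightarrow> 0"
  proof (rule AE_tendsto_along_dominated[where \<kappa> = "2 * K"
        and G = "\<lambda>n \<omega>. K / (real n)\<^sup>2 * (\<Sum>k\<in>triangle n. \<bar>tail_residual a n k \<omega>\<bar>)", OF _ _ _ _ c])
    fix n :: nat assume n: "0 < n"
    have ta: "integrable M (\<lambda>\<omega>. \<bar>tail_residual a n k \<omega>\<bar>)" for k
      by (rule integrable_abs[OF tail_residual_le(1)[OF n]])
    let ?B = "\<lambda>\<omega>. K / (real n)\<^sup>2 * (\<Sum>k\<in>triangle n. \<bar>tail_residual a n k \<omega>\<bar>)"
    show "integrable M ?B" by (intro integrable_mult_right Bochner_Integration.integrable_sum ta)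
    show "R n \<in> borel_measurable M"
      unfolding R_def by (intro borel_measurable_sum borel_measurable_times bM[OF n]
          borel_measurable_integrable tail_residual_le(1)[OF n])
    show "\<bar>R n \<omega>\<bar> \<le> ?B \<omega>" for \<omega>
      unfolding R_def sum_distrib_left
    proof (rule order_trans[OF sum_abs sum_mono])
      fix k
      show "\<bar>b n k \<omega> * tail_residual a n k \<omega>\<bar> \<le> K / (real n)\<^sup>2 * \<bar>tail_residual a n k \<omega>\<bar>"
        unfolding abs_mult by (rule mult_right_mono[OF bd[OF n]]) simp
    qed
    have "expectation ?B = K / (real n)\<^sup>2 * (\<Sum>k\<in>triangle n. expectation (\<lambda>\<omega>. \<bar>tail_residual a n k \<omega>\<bar>))"
      by (simp add: Bochner_Integration.integral_sum ta)
    also have "\<dots> \<le> K / (real n)\<^sup>2 * ((real n)\<^sup>2 * (2 * rate n))"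
      using K rate_nonneg[OF n] order_trans[OF tail_residual_le(2)[OF n] mult_left_mono[OF e_le_rate]]
      by (intro mult_left_mono sum_triangle_le) simp_all
    also have "\<dots> = 2 * K * rate n" using n by simp
    finally show "expectation ?B \<le> 2 * K * rate n" .
  qed
  from S R show ?thesis
  proof eventually_elim
    case (elim \<omega>)
    have "(\<Sum>k\<in>triangle n. b n k \<omega> * ((x k \<omega>)\<^sup>2 - (s k)\<^sup>2 - cond_var a k \<omega>)) = S n \<omega> + R n \<omega>" for n
      unfolding S_def R_def sum.distrib[symmetric]
      by (rule sum.cong) (auto simp: tail_residual_def algebra_simps)
    then show ?case using tendsto_add[OF elim] by simp
  qed
qed

end

section \<open>Lindeberg replacement\<close>

lemma norm_quad_coeff_zero_set:
  fixes x :: "nat \<times> nat \<Rightarrow> real"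
  assumes z: "0 < Im z" and n: "0 < n" and "finite N"
  shows "cmod (quad_coeff n z k x - quad_coeff n z k (\<lambda>p. if p \<in> N then 0 else x p))
    \<le> (\<Sum>m\<in>N. coeff_bound z / (real n)\<^sup>2 * min 1 (\<bar>x m\<bar> / sqrt (real n)))"
  using assms(3)
proof (induction N rule: finite_induct)
  case empty
  then show ?case by simp
next
  case (insert m N)
  let ?y = "\<lambda>p. if p \<in> N then 0 else x p"
  have "(\<lambda>p. if p \<in> insert m N then 0 else x p) = ?y(m := 0)" by auto
  then have "quad_coeff n z k x - quad_coeff n z k (\<lambda>p. if p \<in> insert m N then 0 else x p)
      = (quad_coeff n z k x - quad_coeff n z k ?y) + (quad_coeff n z k ?y - quad_coeff n z k (?y(m := 0)))"
    by simp
  also have "cmod \<dots> \<le> (\<Sum>m\<in>N. coeff_bound z / (real n)\<^sup>2 * min 1 (\<bar>x m\<bar> / sqrt (real n)))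
      + coeff_bound z / (real n)\<^sup>2 * min 1 (\<bar>?y m\<bar> / sqrt (real n))"
    by (rule order_trans[OF norm_triangle_ineq add_mono[OF insert.IH norm_quad_coeff_diff[OF z n]]])
  finally show ?case using insert.hyps by (simp add: add.commute)
qed

text \<open>The cubic branch together with \<open>\<bar>t\<bar> \<le> 1 + t\<^sup>2\<close>; it
  reduces the Gaussian remainders to moments of order two and four.\<close>

lemma trunc_square_le_moments: "trunc_square n t \<le> (t\<^sup>2 + t ^ 4) / sqrt (real n)"
proof -
  have "\<bar>t\<bar> \<le> 1 + t\<^sup>2"
  proof -
    have "2 * \<bar>t\<bar> \<le> \<bar>t\<bar>\<^sup>2 + 1" using sum_squares_bound[of "\<bar>t\<bar>" 1] by simp
    then show ?thesis using zero_le_power2[of t] by (simp del: zero_le_power2)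
  qed
  then have "t\<^sup>2 * \<bar>t\<bar> \<le> t\<^sup>2 * (1 + t\<^sup>2)" by (rule mult_left_mono) simp
  also have "\<dots> = t\<^sup>2 + t ^ 4" by (simp add: algebra_simps power2_eq_square power4_eq_xxxx)
  finally have "t\<^sup>2 * \<bar>t\<bar> / sqrt (real n) \<le> (t\<^sup>2 + t ^ 4) / sqrt (real n)" by (rule divide_right_mono) simp
  moreover have "trunc_square n t \<le> t\<^sup>2 * (\<bar>t\<bar> / sqrt (real n))"
    unfolding trunc_square_def by (intro mult_left_mono) auto
  ultimately show ?thesis by simp
qed

lemma lin_coeff_update: "lin_coeff n z k (x(k := t)) = lin_coeff n z k x"
  by (simp add: lin_coeff_def)

lemma quad_coeff_update: "quad_coeff n z k (x(k := t)) = quad_coeff n z k x"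
  by (simp add: quad_coeff_def)

context array_pair
begin

section \<open>Hybrid arrays\<close>

definition mix :: "(nat \<times> nat) set \<Rightarrow> 'a \<Rightarrow> nat \<times> nat \<Rightarrow> real" where
  "mix A \<omega> p = (if p \<in> A then x p \<omega> else Y p \<omega>)"

text \<open>Of the entries of \<open>X\<close> only those at distance at least \<open>a\<close>
  before \<open>k\<close> remain, as \<open>past_Y a k\<close> requires. The value at
  \<open>k\<close> itself is irrelevant, since the coefficients reset it to 0.\<close>

definition trimmed :: "nat \<Rightarrow> nat \<Rightarrow> nat \<times> nat \<Rightarrow> 'a \<Rightarrow> nat \<times> nat \<Rightarrow> real" where
  "trimmed a n k \<omega> p = (if p \<in> lex_below n k \<and> \<not> far a k p then 0 else mix (lex_below n k) \<omega> p)"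

lemma mix_past_Y: "p \<in> triangle n \<Longrightarrow> (\<lambda>\<omega>. mix (lex_below n k) \<omega> p) \<in> borel_measurable (past_Y 1 k)"
  using x_past_Y[OF _ far_one, of p k n] Y_past_Y[of p n 1 k]
  by (cases "p \<in> lex_below n k") (simp_all add: mix_def lex_below_def)

lemma trimmed_past_Y: "p \<in> triangle n \<Longrightarrow> (\<lambda>\<omega>. trimmed a n k \<omega> p) \<in> borel_measurable (past_Y a k)"
  using x_past_Y[of p k a n] Y_past_Y[of p n a k]
  by (cases "p \<in> lex_below n k"; cases "far a k p") (simp_all add: mix_def trimmed_def lex_below_def)

text \<open>Entry \<open>k\<close> is reset to 0 since for \<open>l = k\<close> the hybrid array
  would otherwise carry \<open>Y k\<close>, which is missing from \<open>X_rest k\<close>. All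
  positions before \<open>k\<close> already carry \<open>X\<close>, so an earlier \<open>Y l\<close>
  does not occur either.\<close>

lemma mix_X_rest:
  assumes "l = k \<or> lex_less l k" "p \<in> triangle n"
  shows "(\<lambda>\<omega>. ((mix (lex_below n k) \<omega>)(k := 0)) p) \<in> borel_measurable (X_rest l)"
proof (cases "p \<in> lex_below n k \<or> p = k")
  case True
  then show ?thesis using x_X_rest[of p l] by (cases "p = k") (simp_all add: mix_def)
next
  case False
  then have "p \<noteq> l" using assms by (auto simp: lex_below_def)
  then show ?thesis using False Y_X_rest[OF assms(2)] by (simp add: mix_def)
qed

lemma mix_measurable: "p \<in> triangle n \<Longrightarrow> (\<lambda>\<omega>. mix A \<omega> p) \<in> borel_measurable M"
  using x_measurable[of p] Y_measurable'[of p n] by (cases "p \<in> A") (simp_all add: mix_def)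

text \<open>The centered square of \<open>Y k\<close> has variance \<open>2 * (s k) ^ 4\<close>, at
  most \<open>2 * C\<^sup>2\<close>. With weights of order \<open>n\<^sup>-\<^sup>2\<close> the sum
  of at most \<open>n\<^sup>2\<close> orthogonal terms has second moment
  \<open>O(n\<^sup>-\<^sup>2)\<close>.\<close>

lemma AE_square_Y:
  fixes b :: "nat \<Rightarrow> nat \<times> nat \<Rightarrow> 'a \<Rightarrow> real"
  assumes c: "0 < c"
    and b: "\<And>n k l. 0 < n \<Longrightarrow> k \<in> triangle n \<Longrightarrow> l = k \<or> lex_less l k \<Longrightarrow> b n k \<in> borel_measurable (X_rest l)"
    and bd: "\<And>n k \<omega>. 0 < n \<Longrightarrow> \<bar>b n k \<omega>\<bar> \<le> K / (real n)\<^sup>2"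
  shows "AE \<omega> in M. (\<lambda>j. \<Sum>k\<in>triangle (c * 4 ^ j). b (c * 4 ^ j) k \<omega> * ((Y k \<omega>)\<^sup>2 - (s k)\<^sup>2)) \<longlonglongrightarrow> 0"
proof (rule AE_tendsto_along_L2[where Z = "\<lambda>n \<omega>. \<Sum>k\<in>triangle n. b n k \<omega> * ((Y k \<omega>)\<^sup>2 - (s k)\<^sup>2)"
      and \<kappa> = "K\<^sup>2 * (2 * C\<^sup>2)", OF _ _ _ c])
  fix n :: nat assume n: "0 < n"
  have bM: "b n k \<in> borel_measurable M" if "k \<in> triangle n" for k
    by (rule measurable_from_subalg[OF X_rest(1) b[OF n that disjI1[OF refl]]])
  show "(\<lambda>\<omega>. \<Sum>k\<in>triangle n. b n k \<omega> * ((Y k \<omega>)\<^sup>2 - (s k)\<^sup>2)) \<in> borel_measurable M"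
    by (intro borel_measurable_sum borel_measurable_times borel_measurable_diff borel_measurable_power
        borel_measurable_const bM Y_measurable')
  have e: "(\<lambda>\<omega>. ((Y k \<omega>)\<^sup>2 - (s k)\<^sup>2)\<^sup>2) = (\<lambda>\<omega>. (Y k \<omega>) ^ 4 - 2 * (s k)\<^sup>2 * (Y k \<omega>)\<^sup>2 + (s k) ^ 4)" for k
    by (simp add: fun_eq_iff power2_diff algebra_simps flip: power_mult)
  have m: "integrable M (\<lambda>\<omega>. ((Y k \<omega>)\<^sup>2 - (s k)\<^sup>2)\<^sup>2)" "expectation (\<lambda>\<omega>. (Y k \<omega>)\<^sup>2 - (s k)\<^sup>2) = 0"
    "expectation (\<lambda>\<omega>. ((Y k \<omega>)\<^sup>2 - (s k)\<^sup>2)\<^sup>2) \<le> 2 * C\<^sup>2" if "k \<in> triangle n" for k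
  proof -
    note Y = Y_moments[OF that]
    have i: "integrable M (\<lambda>\<omega>. (Y k \<omega>) ^ 4)" "integrable M (\<lambda>\<omega>. 2 * (s k)\<^sup>2 * (Y k \<omega>)\<^sup>2)"
      using Y(1) by simp_all
    show "integrable M (\<lambda>\<omega>. ((Y k \<omega>)\<^sup>2 - (s k)\<^sup>2)\<^sup>2)" unfolding e using i by simp
    show "expectation (\<lambda>\<omega>. (Y k \<omega>)\<^sup>2 - (s k)\<^sup>2) = 0"
      using Y(1)[of 2] Y(3) by (simp add: prob_space)
    have "expectation (\<lambda>\<omega>. ((Y k \<omega>)\<^sup>2 - (s k)\<^sup>2)\<^sup>2) = 3 * s k ^ 4 - 2 * (s k)\<^sup>2 * (s k)\<^sup>2 + s k ^ 4"
      unfolding e using i Y(1)[of 2] Y(3,4) by (simp add: prob_space)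
    also have "\<dots> = 2 * ((s k)\<^sup>2)\<^sup>2" by (simp add: power2_eq_square power4_eq_xxxx)
    also have "\<dots> \<le> 2 * C\<^sup>2" using power_mono[OF s_le[of k], of 2] by simp
    finally show "expectation (\<lambda>\<omega>. ((Y k \<omega>)\<^sup>2 - (s k)\<^sup>2)\<^sup>2) \<le> 2 * C\<^sup>2" .
  qed
  have g: "(\<lambda>t. t\<^sup>2 - (s k)\<^sup>2) \<in> borel_measurable borel" for k by measurable
  have w0: "0 \<le> 2 * C\<^sup>2" by (intro mult_nonneg_nonneg zero_le_power2) simp
  note R = independent_sum_square_le[of n "b n" _ "\<lambda>k t. t\<^sup>2 - (s k)\<^sup>2", OF b[OF n] bd[OF n] g m w0]
  show "integrable M (\<lambda>\<omega>. (\<Sum>k\<in>triangle n. b n k \<omega> * ((Y k \<omega>)\<^sup>2 - (s k)\<^sup>2))\<^sup>2)" by (rule R(1))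
  have "expectation (\<lambda>\<omega>. (\<Sum>k\<in>triangle n. b n k \<omega> * ((Y k \<omega>)\<^sup>2 - (s k)\<^sup>2))\<^sup>2)
      \<le> (real n)\<^sup>2 * ((K / (real n)\<^sup>2)\<^sup>2 * (2 * C\<^sup>2))" by (rule R(2))
  also have "\<dots> = K\<^sup>2 * (2 * C\<^sup>2) * (1 / (real n)\<^sup>2)"
    using n by (simp add: power_divide power2_eq_square power4_eq_xxxx)
  also have "\<dots> \<le> K\<^sup>2 * (2 * C\<^sup>2) * rate n"
  proof (rule mult_left_mono)
    have "real n \<le> (real n)\<^sup>2" using n by (simp add: power2_eq_square)
    then have "1 / (real n)\<^sup>2 \<le> 1 / real n" using n by (intro divide_left_mono) auto
    then show "1 / (real n)\<^sup>2 \<le> rate n" using inverse_le_rate(1)[OF n] by linarith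
  qed simp
  finally show "expectation (\<lambda>\<omega>. (\<Sum>k\<in>triangle n. b n k \<omega> * ((Y k \<omega>)\<^sup>2 - (s k)\<^sup>2))\<^sup>2) \<le> K\<^sup>2 * (2 * C\<^sup>2) * rate n" .
qed

context
  fixes z :: complex and re :: "complex \<Rightarrow> real"
  assumes z: "0 < Im z" and re: "bounded_linear re" and re_le: "\<And>w. \<bar>re w\<bar> \<le> cmod w"
begin

interpretation re: bounded_linear re by (rule re)

lemma re_measurable: "f \<in> borel_measurable J \<Longrightarrow> (\<lambda>\<omega>. re (f \<omega>)) \<in> borel_measurable J"
  by (rule measurable_compose[OF _ borel_measurable_continuous_onI[OF linear_continuous_on[OF re]]])

text \<open>The map \<open>re\<close> stands for the real or the imaginary part, because conditional
  expectations and orthogonality are set up for real variables. Linearity and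
  \<open>\<bar>re w\<bar> \<le> cmod w\<close> are all that enters.\<close>

definition lin :: "nat \<Rightarrow> nat \<times> nat \<Rightarrow> 'a \<Rightarrow> real" where
  "lin n k \<omega> = re (lin_coeff n z k (mix (lex_below n k) \<omega>))"

definition quad :: "nat \<Rightarrow> nat \<times> nat \<Rightarrow> 'a \<Rightarrow> real" where
  "quad n k \<omega> = re (quad_coeff n z k (mix (lex_below n k) \<omega>))"

definition quad_trim :: "nat \<Rightarrow> nat \<Rightarrow> nat \<times> nat \<Rightarrow> 'a \<Rightarrow> real" where
  "quad_trim a n k \<omega> = re (quad_coeff n z k (trimmed a n k \<omega>))"

text \<open>The difference of two Taylor remainders around the same array, with entry
  \<open>k\<close> set to 0, so that the constant terms cancel.\<close>

definition taylor_rem :: "nat \<Rightarrow> nat \<times> nat \<Rightarrow> 'a \<Rightarrow> real" where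
  "taylor_rem n k \<omega> = re (array_stieltjes n z (mix (insert k (lex_below n k)) \<omega>))
     - re (array_stieltjes n z (mix (lex_below n k) \<omega>))
     - lin n k \<omega> * (x k \<omega> - Y k \<omega>) - quad n k \<omega> * ((x k \<omega>)\<^sup>2 - (Y k \<omega>)\<^sup>2)"

lemma lin_le: "0 < n \<Longrightarrow> \<bar>lin n k \<omega>\<bar> \<le> coeff_bound z / (real n * sqrt (real n))"
  unfolding lin_def by (rule order_trans[OF re_le norm_lin_coeff[OF z]])

lemma quad_le: "0 < n \<Longrightarrow> \<bar>quad n k \<omega>\<bar> \<le> coeff_bound z / (real n)\<^sup>2"
  unfolding quad_def by (rule order_trans[OF re_le norm_quad_coeff[OF z]])

lemma quad_trim_le: "0 < n \<Longrightarrow> \<bar>quad_trim a n k \<omega>\<bar> \<le> coeff_bound z / (real n)\<^sup>2"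
  unfolding quad_trim_def by (rule order_trans[OF re_le norm_quad_coeff[OF z]])

lemma lin_past_Y: "lin n k \<in> borel_measurable (past_Y 1 k)"
  unfolding lin_def by (intro re_measurable lin_coeff_measurable[OF z] mix_past_Y)

lemma lin_X_rest: "l = k \<or> lex_less l k \<Longrightarrow> lin n k \<in> borel_measurable (X_rest l)"
  unfolding lin_def
  by (subst lin_coeff_update[of n z k _ 0, symmetric])
     (intro re_measurable lin_coeff_measurable[OF z] mix_X_rest)

lemma quad_X_rest: "l = k \<or> lex_less l k \<Longrightarrow> quad n k \<in> borel_measurable (X_rest l)"
  unfolding quad_def
  by (subst quad_coeff_update[of n z k _ 0, symmetric])
     (intro re_measurable quad_coeff_measurable[OF z] mix_X_rest)

lemma quad_trim_past_Y: "quad_trim a n k \<in> borel_measurable (past_Y a k)"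
  unfolding quad_trim_def by (intro re_measurable quad_coeff_measurable[OF z] trimmed_past_Y)

lemma coeff_measurable [measurable]:
  "lin n k \<in> borel_measurable M" "quad n k \<in> borel_measurable M" "quad_trim a n k \<in> borel_measurable M"
  using measurable_from_subalg[OF past_Y(1) lin_past_Y] measurable_from_subalg[OF past_Y(1) quad_trim_past_Y]
    measurable_from_subalg[OF X_rest(1) quad_X_rest[OF disjI1[OF refl]]] by blast+

lemma taylor_rem_measurable: "k \<in> triangle n \<Longrightarrow> taylor_rem n k \<in> borel_measurable M"
  unfolding taylor_rem_def
  by (intro borel_measurable_diff borel_measurable_times borel_measurable_power re_measurable
      array_stieltjes_measurable[OF z] mix_measurable coeff_measurable x_measurable Y_measurable')

lemma taylor_rem_le:
  assumes n: "0 < n"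
  shows "\<bar>taylor_rem n k \<omega>\<bar>
    \<le> coeff_bound z / (real n)\<^sup>2 * (trunc_square n (x k \<omega>) + trunc_square n (Y k \<omega>))"
proof -
  let ?u = "mix (lex_below n k) \<omega>"
  have k: "k \<notin> lex_below n k" by (simp add: lex_below_def lex_less_irrefl)
  have u1: "mix (insert k (lex_below n k)) \<omega> = ?u(k := x k \<omega>)"
    by (rule ext) (simp add: mix_def)
  have u2: "?u(k := Y k \<omega>) = ?u"
    by (rule ext) (simp add: mix_def k)
  define F where "F t = array_stieltjes n z (?u(k := t))" for t
  let ?T = "\<lambda>t. F t - F 0 - lin_coeff n z k ?u * of_real t - quad_coeff n z k ?u * of_real (t\<^sup>2)"
  have mult: "re (w * of_real t) = re w * t" for w t
    using re.scaleR[of t w] by (simp add: scaleR_conv_of_real mult.commute)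
  have T: "re (?T t) = re (F t) - re (F 0) - lin n k \<omega> * t - quad n k \<omega> * t\<^sup>2" for t
    unfolding lin_def quad_def re.diff mult ..
  have "taylor_rem n k \<omega> = re (F (x k \<omega>)) - re (F (Y k \<omega>))
      - lin n k \<omega> * (x k \<omega> - Y k \<omega>) - quad n k \<omega> * ((x k \<omega>)\<^sup>2 - (Y k \<omega>)\<^sup>2)"
    unfolding taylor_rem_def F_def u1 u2 ..
  then have "taylor_rem n k \<omega> = re (?T (x k \<omega>)) - re (?T (Y k \<omega>))"
    unfolding T right_diff_distrib by linarith
  moreover have bound: "\<bar>re (?T t)\<bar> \<le> coeff_bound z / (real n)\<^sup>2 * trunc_square n t" for t
    unfolding F_def by (rule order_trans[OF re_le array_stieltjes_taylor[OF z n, of ?u k t]])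
  ultimately have "\<bar>taylor_rem n k \<omega>\<bar> = \<bar>re (?T (x k \<omega>)) - re (?T (Y k \<omega>))\<bar>" by (simp only:)
  also have "\<dots> \<le> \<bar>re (?T (x k \<omega>))\<bar> + \<bar>re (?T (Y k \<omega>))\<bar>" by (rule abs_triangle_ineq4)
  also have "\<dots> \<le> coeff_bound z / (real n)\<^sup>2 * trunc_square n (x k \<omega>)
      + coeff_bound z / (real n)\<^sup>2 * trunc_square n (Y k \<omega>)"
    by (rule add_mono[OF bound bound])
  finally show ?thesis by (simp only: distrib_left)
qed

lemma quad_trim_diff_le:
  assumes n: "0 < n"
  shows "\<bar>quad n k \<omega> - quad_trim a n k \<omega>\<bar>
    \<le> (\<Sum>m\<in>{p \<in> lex_below n k. \<not> far a k p}. coeff_bound z / (real n)\<^sup>2 * min 1 (\<bar>x m \<omega>\<bar> / sqrt (real n)))"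
proof -
  let ?N = "{p \<in> lex_below n k. \<not> far a k p}"
  have N: "finite ?N" by (rule finite_subset[OF _ finite_triangle[of n]]) (auto simp: lex_below_def)
  have t: "trimmed a n k \<omega> = (\<lambda>p. if p \<in> ?N then 0 else mix (lex_below n k) \<omega> p)"
    by (simp add: trimmed_def fun_eq_iff)
  have "\<bar>quad n k \<omega> - quad_trim a n k \<omega>\<bar> \<le> cmod (quad_coeff n z k (mix (lex_below n k) \<omega>)
      - quad_coeff n z k (\<lambda>p. if p \<in> ?N then 0 else mix (lex_below n k) \<omega> p))"
    unfolding quad_def quad_trim_def t re.diff[symmetric] by (rule re_le)
  also have "\<dots> \<le> (\<Sum>m\<in>?N. coeff_bound z / (real n)\<^sup>2 * min 1 (\<bar>mix (lex_below n k) \<omega> m\<bar> / sqrt (real n)))"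
    by (rule norm_quad_coeff_zero_set[OF z n N])
  also have "\<dots> = (\<Sum>m\<in>?N. coeff_bound z / (real n)\<^sup>2 * min 1 (\<bar>x m \<omega>\<bar> / sqrt (real n)))"
    by (rule sum.cong) (auto simp: mix_def)
  finally show ?thesis .
qed

lemma card_near_le: "card {p \<in> lex_below n k. \<not> far a k p} \<le> (2 * a)\<^sup>2"
proof -
  let ?B = "{fst k + 1 - a..<fst k + a} \<times> {snd k + 1 - a..<snd k + a}"
  have "card {p \<in> lex_below n k. \<not> far a k p} \<le> card ?B"
    by (rule card_mono) (auto simp: far_def)
  also have "\<dots> \<le> (2 * a) * (2 * a)"
    unfolding card_cartesian_product by (rule mult_le_mono) auto
  finally show ?thesis by (simp add: power2_eq_square)
qed

lemma card_near_le_real: "real (card {p \<in> lex_below n k. \<not> far a k p}) \<le> (real (2 * a))\<^sup>2"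
  unfolding of_nat_power[symmetric] by (rule of_nat_mono[OF card_near_le])

section \<open>Negligibility of the error terms\<close>

lemma AE_lin_x: "0 < c \<Longrightarrow> AE \<omega> in M. (\<lambda>j. \<Sum>k\<in>triangle (c * 4 ^ j). lin (c * 4 ^ j) k \<omega> * x k \<omega>) \<longlonglongrightarrow> 0"
proof (rule AE_tendsto_along_L2[where Z = "\<lambda>n \<omega>. \<Sum>k\<in>triangle n. lin n k \<omega> * x k \<omega>" and \<kappa> = "(coeff_bound z)\<^sup>2 * C"])
  fix n :: nat assume n: "0 < n"
  show "(\<lambda>\<omega>. \<Sum>k\<in>triangle n. lin n k \<omega> * x k \<omega>) \<in> borel_measurable M" by measurable
  note R = martingale_sum_square_le[of n "lin n", OF lin_past_Y lin_le[OF n]]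
  show "integrable M (\<lambda>\<omega>. (\<Sum>k\<in>triangle n. lin n k \<omega> * x k \<omega>)\<^sup>2)" by (rule R(1))
  have "expectation (\<lambda>\<omega>. (\<Sum>k\<in>triangle n. lin n k \<omega> * x k \<omega>)\<^sup>2)
      \<le> (real n)\<^sup>2 * ((coeff_bound z / (real n * sqrt (real n)))\<^sup>2 * C)" by (rule R(2))
  \<comment> \<open>At most \<open>n\<^sup>2\<close> orthogonal terms with squared weights of order
    \<open>n\<^sup>-\<^sup>3\<close>.\<close>
  also have "\<dots> = (coeff_bound z)\<^sup>2 * C * (1 / real n)"
    using n by (simp add: power_divide power_mult_distrib)
  also have "\<dots> \<le> (coeff_bound z)\<^sup>2 * C * rate n"
    using C_nonneg by (intro mult_left_mono inverse_le_rate(1)[OF n]) simp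
  finally show "expectation (\<lambda>\<omega>. (\<Sum>k\<in>triangle n. lin n k \<omega> * x k \<omega>)\<^sup>2) \<le> (coeff_bound z)\<^sup>2 * C * rate n" .
qed

lemma AE_lin_Y: "0 < c \<Longrightarrow> AE \<omega> in M. (\<lambda>j. \<Sum>k\<in>triangle (c * 4 ^ j). lin (c * 4 ^ j) k \<omega> * Y k \<omega>) \<longlonglongrightarrow> 0"
proof (rule AE_tendsto_along_L2[where Z = "\<lambda>n \<omega>. \<Sum>k\<in>triangle n. lin n k \<omega> * Y k \<omega>" and \<kappa> = "(coeff_bound z)\<^sup>2 * C"])
  fix n :: nat assume n: "0 < n"
  show "(\<lambda>\<omega>. \<Sum>k\<in>triangle n. lin n k \<omega> * Y k \<omega>) \<in> borel_measurable M"
    by (intro borel_measurable_sum borel_measurable_times coeff_measurable Y_measurable')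
  have m: "integrable M (\<lambda>\<omega>. (Y k \<omega>)\<^sup>2)" "expectation (\<lambda>\<omega>. Y k \<omega>) = 0" "expectation (\<lambda>\<omega>. (Y k \<omega>)\<^sup>2) \<le> C"
    if "k \<in> triangle n" for k
    using Y_moments[OF that] s_le[of k] by simp_all
  note R = independent_sum_square_le[of n "lin n" _ "\<lambda>_ t. t", OF lin_X_rest lin_le[OF n] measurable_ident_sets[OF refl] m C_nonneg]
  show "integrable M (\<lambda>\<omega>. (\<Sum>k\<in>triangle n. lin n k \<omega> * Y k \<omega>)\<^sup>2)" by (rule R(1))
  have "expectation (\<lambda>\<omega>. (\<Sum>k\<in>triangle n. lin n k \<omega> * Y k \<omega>)\<^sup>2)
      \<le> (real n)\<^sup>2 * ((coeff_bound z / (real n * sqrt (real n)))\<^sup>2 * C)" by (rule R(2))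
  also have "\<dots> = (coeff_bound z)\<^sup>2 * C * (1 / real n)"
    using n by (simp add: power_divide power_mult_distrib)
  also have "\<dots> \<le> (coeff_bound z)\<^sup>2 * C * rate n"
    using C_nonneg by (intro mult_left_mono inverse_le_rate(1)[OF n]) simp
  finally show "expectation (\<lambda>\<omega>. (\<Sum>k\<in>triangle n. lin n k \<omega> * Y k \<omega>)\<^sup>2) \<le> (coeff_bound z)\<^sup>2 * C * rate n" .
qed

lemma AE_taylor_rem: 
  assumes c: "0 < c"
  shows "AE \<omega> in M. (\<lambda>j. \<Sum>k\<in>triangle (c * 4 ^ j). taylor_rem (c * 4 ^ j) k \<omega>) \<longlonglongrightarrow> 0"
proof (rule AE_tendsto_along_dominated[where Z = "\<lambda>n \<omega>. \<Sum>k\<in>triangle n. taylor_rem n k \<omega>"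
      and G = "\<lambda>n \<omega>. \<Sum>k\<in>triangle n. coeff_bound z / (real n)\<^sup>2 * (trunc_square n (x k \<omega>) + trunc_square n (Y k \<omega>))"
      and \<kappa> = "coeff_bound z * (1 + C + 3 * C\<^sup>2)", OF _ _ _ _ c])
  fix n :: nat assume n: "0 < n"
  have K: "0 \<le> coeff_bound z" using coeff_bound_ge(4)[OF z] by simp
  show "(\<lambda>\<omega>. \<Sum>k\<in>triangle n. taylor_rem n k \<omega>) \<in> borel_measurable M"
    by (intro borel_measurable_sum taylor_rem_measurable)
  show "\<bar>\<Sum>k\<in>triangle n. taylor_rem n k \<omega>\<bar>
      \<le> (\<Sum>k\<in>triangle n. coeff_bound z / (real n)\<^sup>2 * (trunc_square n (x k \<omega>) + trunc_square n (Y k \<omega>)))" for \<omega>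
    by (rule order_trans[OF sum_abs sum_mono[OF taylor_rem_le[OF n]]])
  \<comment> \<open>The bound \<open>e n\<close> is assumed for \<open>X\<close>; for the Gaussian
    entries moments of order two and four take its place.\<close>
  have Yi: "integrable M (\<lambda>\<omega>. trunc_square n (Y k \<omega>))" "expectation (\<lambda>\<omega>. trunc_square n (Y k \<omega>)) \<le> (C + 3 * C\<^sup>2) / sqrt (real n)"
    if k: "k \<in> triangle n" for k
  proof -
    note Y = Y_moments[OF k]
    have i2: "integrable M (\<lambda>\<omega>. (Y k \<omega>)\<^sup>2)" by (rule Y(1))
    have Ym: "(\<lambda>\<omega>. trunc_square n (Y k \<omega>)) \<in> borel_measurable M"
      by (rule measurable_compose[OF Y_measurable'[OF k] trunc_square_measurable])
    show i: "integrable M (\<lambda>\<omega>. trunc_square n (Y k \<omega>))"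
      by (rule Bochner_Integration.integrable_bound[OF i2 Ym]) (simp add: trunc_square_nonneg trunc_square_le)
    have "expectation (\<lambda>\<omega>. trunc_square n (Y k \<omega>)) \<le> expectation (\<lambda>\<omega>. ((Y k \<omega>)\<^sup>2 + (Y k \<omega>) ^ 4) / sqrt (real n))"
      using Y(1) by (intro integral_mono i trunc_square_le_moments) simp
    also have "\<dots> = ((s k)\<^sup>2 + 3 * ((s k)\<^sup>2)\<^sup>2) / sqrt (real n)"
    proof -
      have "expectation (\<lambda>\<omega>. ((Y k \<omega>)\<^sup>2 + (Y k \<omega>) ^ 4) / sqrt (real n))
          = (expectation (\<lambda>\<omega>. (Y k \<omega>)\<^sup>2) + expectation (\<lambda>\<omega>. (Y k \<omega>) ^ 4)) / sqrt (real n)"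
        using Y(1) by simp
      then show ?thesis unfolding Y(3,4) by (simp only: power_mult[symmetric]) simp
    qed
    also have "\<dots> \<le> (C + 3 * C\<^sup>2) / sqrt (real n)"
      using s_le[of k] power_mono[OF s_le[of k], of 2] by (intro divide_right_mono) simp_all
    finally show "expectation (\<lambda>\<omega>. trunc_square n (Y k \<omega>)) \<le> (C + 3 * C\<^sup>2) / sqrt (real n)" .
  qed
  have i: "integrable M (\<lambda>\<omega>. coeff_bound z / (real n)\<^sup>2 * (trunc_square n (x k \<omega>) + trunc_square n (Y k \<omega>)))"
    if "k \<in> triangle n" for k
    using x_trunc_integrable[of n k] Yi(1)[OF that] by simp
  then show "integrable M (\<lambda>\<omega>. \<Sum>k\<in>triangle n. coeff_bound z / (real n)\<^sup>2 * (trunc_square n (x k \<omega>) + trunc_square n (Y k \<omega>)))"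
    by (rule Bochner_Integration.integrable_sum)
  have term_le: "expectation (\<lambda>\<omega>. coeff_bound z / (real n)\<^sup>2 * (trunc_square n (x k \<omega>) + trunc_square n (Y k \<omega>)))
      \<le> coeff_bound z / (real n)\<^sup>2 * ((1 + C + 3 * C\<^sup>2) * rate n)" if k: "k \<in> triangle n" for k
  proof -
    have "(C + 3 * C\<^sup>2) * (1 / sqrt (real n)) \<le> (C + 3 * C\<^sup>2) * rate n"
      using C_nonneg by (intro mult_left_mono inverse_le_rate(2)[OF n]) simp
    then have "expectation (\<lambda>\<omega>. trunc_square n (x k \<omega>)) + expectation (\<lambda>\<omega>. trunc_square n (Y k \<omega>))
        \<le> rate n + (C + 3 * C\<^sup>2) * rate n"
      using x_trunc_le[OF n, of k] e_le_rate[of n] Yi(2)[OF k] by (simp only: times_divide_eq_right mult_1_right)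
    also have "\<dots> = (1 + C + 3 * C\<^sup>2) * rate n" by (simp add: algebra_simps)
    finally show ?thesis
      using x_trunc_integrable[of n k] Yi(1)[OF k] K by (simp add: mult_left_mono divide_right_mono)
  qed
  have "expectation (\<lambda>\<omega>. \<Sum>k\<in>triangle n. coeff_bound z / (real n)\<^sup>2 * (trunc_square n (x k \<omega>) + trunc_square n (Y k \<omega>)))
      = (\<Sum>k\<in>triangle n. expectation (\<lambda>\<omega>. coeff_bound z / (real n)\<^sup>2 * (trunc_square n (x k \<omega>) + trunc_square n (Y k \<omega>))))"
    by (rule Bochner_Integration.integral_sum[OF i])
  also have "\<dots> \<le> (real n)\<^sup>2 * (coeff_bound z / (real n)\<^sup>2 * ((1 + C + 3 * C\<^sup>2) * rate n))"
    using K C_nonneg rate_nonneg[OF n] by (intro sum_triangle_le term_le) simp_all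
  also have "\<dots> = coeff_bound z * (1 + C + 3 * C\<^sup>2) * rate n" using n by simp
  finally show "expectation (\<lambda>\<omega>. \<Sum>k\<in>triangle n. coeff_bound z / (real n)\<^sup>2 * (trunc_square n (x k \<omega>) + trunc_square n (Y k \<omega>)))
      \<le> coeff_bound z * (1 + C + 3 * C\<^sup>2) * rate n" .
qed

text \<open>Each of the at most \<open>(2 * a)\<^sup>2\<close> near entries \<open>m\<close> changes
  the coefficient by the order \<open>n\<^sup>-\<^sup>2 * min 1 (\<bar>x m\<bar> / sqrt n)\<close>.
  The product of this minimum with the square of \<open>x k\<close> is dominated by a sum of
  functions of \<open>x m\<close> and of \<open>x k\<close> separately, so that marginal moments
  suffice.\<close>

lemma AE_quad_trim_diff:
  assumes c: "0 < c"
  shows "AE \<omega> in M. (\<lambda>j. \<Sum>k\<in>triangle (c * 4 ^ j).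
    (quad (c * 4 ^ j) k \<omega> - quad_trim a (c * 4 ^ j) k \<omega>) * ((x k \<omega>)\<^sup>2 - (s k)\<^sup>2)) \<longlonglongrightarrow> 0"
proof -
  let ?N = "\<lambda>n k. {p \<in> lex_below n k. \<not> far a k p}"
  let ?K = "coeff_bound z"
  let ?g = "\<lambda>n k m \<omega>. ?K / (real n)\<^sup>2 * (trunc_square n (x m \<omega>) + trunc_square n (x k \<omega>)
      + C * (1 + (x m \<omega>)\<^sup>2) * (1 / sqrt (real n)))"
  let ?w = "(2 + C * (1 + C))"
  have K: "0 \<le> ?K" using coeff_bound_ge(4)[OF z] by simp
  have cancel: "v * (A * (B / v * w)) = B * A * w" if "v \<noteq> 0" for v A B w :: real
    using that by simp
  show ?thesis
  proof (rule AE_tendsto_along_dominated[where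
        Z = "\<lambda>n \<omega>. \<Sum>k\<in>triangle n. (quad n k \<omega> - quad_trim a n k \<omega>) * ((x k \<omega>)\<^sup>2 - (s k)\<^sup>2)"
        and G = "\<lambda>n \<omega>. \<Sum>k\<in>triangle n. \<Sum>m\<in>?N n k. ?g n k m \<omega>"
        and \<kappa> = "?K * (real (2 * a))\<^sup>2 * ?w", OF _ _ _ _ c])
    fix n :: nat assume n: "0 < n"
    have cm: "quad n k \<in> borel_measurable M" "quad_trim a n k \<in> borel_measurable M" for k
      using coeff_measurable(2,3) by blast+
    show "(\<lambda>\<omega>. \<Sum>k\<in>triangle n. (quad n k \<omega> - quad_trim a n k \<omega>) * ((x k \<omega>)\<^sup>2 - (s k)\<^sup>2)) \<in> borel_measurable M"
      by (intro borel_measurable_sum borel_measurable_times borel_measurable_diff cm borel_measurable_power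
          x_measurable borel_measurable_const)
    \<comment> \<open>The square \<open>t\<^sup>2\<close> is handled by
      \<open>min_mult_square_le\<close>, the variance by its bound \<open>C\<close> and by
      \<open>\<bar>u\<bar> \<le> 1 + u\<^sup>2\<close>, which costs only a second moment of
      \<open>u\<close>.\<close>
    have pt: "?K / (real n)\<^sup>2 * min 1 (\<bar>u\<bar> / sqrt (real n)) * \<bar>t\<^sup>2 - (s k)\<^sup>2\<bar>
        \<le> ?K / (real n)\<^sup>2 * (trunc_square n u + trunc_square n t + C * (1 + u\<^sup>2) * (1 / sqrt (real n)))" for u t k
    proof -
      let ?m = "min 1 (\<bar>u\<bar> / sqrt (real n))"
      have m0: "0 \<le> ?m" by simp
      have "\<bar>u\<bar> \<le> 1 + u\<^sup>2"
      proof -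
        have "2 * \<bar>u\<bar> \<le> \<bar>u\<bar>\<^sup>2 + 1" using sum_squares_bound[of "\<bar>u\<bar>" 1] by simp
        then show ?thesis using zero_le_power2[of u] by (simp del: zero_le_power2)
      qed
      then have "\<bar>u\<bar> / sqrt (real n) \<le> (1 + u\<^sup>2) / sqrt (real n)" by (rule divide_right_mono) simp
      then have "?m \<le> (1 + u\<^sup>2) * (1 / sqrt (real n))" by simp
      then have "C * ?m \<le> C * ((1 + u\<^sup>2) * (1 / sqrt (real n)))" using C_nonneg by (rule mult_left_mono)
      moreover have "?m * \<bar>t\<^sup>2 - (s k)\<^sup>2\<bar> \<le> ?m * (t\<^sup>2 + C)"
      proof (rule mult_left_mono[OF _ m0])
        show "\<bar>t\<^sup>2 - (s k)\<^sup>2\<bar> \<le> t\<^sup>2 + C"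
          using s_le[of k] zero_le_power2[of t] zero_le_power2[of "s k"] unfolding abs_le_iff by linarith
      qed
      moreover have "?m * t\<^sup>2 \<le> trunc_square n u + trunc_square n t" by (rule min_mult_square_le)
      moreover have "?m * (t\<^sup>2 + C) = ?m * t\<^sup>2 + C * ?m"
        by (simp only: distrib_left mult.commute[of _ C])
      moreover have "C * ((1 + u\<^sup>2) * (1 / sqrt (real n))) = C * (1 + u\<^sup>2) * (1 / sqrt (real n))"
        by (simp only: mult.assoc)
      ultimately have "?m * \<bar>t\<^sup>2 - (s k)\<^sup>2\<bar> \<le> trunc_square n u + trunc_square n t + C * (1 + u\<^sup>2) * (1 / sqrt (real n))"
        by linarith
      then have "?K / (real n)\<^sup>2 * (?m * \<bar>t\<^sup>2 - (s k)\<^sup>2\<bar>)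
          \<le> ?K / (real n)\<^sup>2 * (trunc_square n u + trunc_square n t + C * (1 + u\<^sup>2) * (1 / sqrt (real n)))"
        using K by (intro mult_left_mono) simp_all
      then show ?thesis by (simp only: mult.assoc)
    qed
    show "\<bar>\<Sum>k\<in>triangle n. (quad n k \<omega> - quad_trim a n k \<omega>) * ((x k \<omega>)\<^sup>2 - (s k)\<^sup>2)\<bar>
        \<le> (\<Sum>k\<in>triangle n. \<Sum>m\<in>?N n k. ?g n k m \<omega>)" for \<omega>
    proof (rule order_trans[OF sum_abs sum_mono])
      fix k
      have "\<bar>(quad n k \<omega> - quad_trim a n k \<omega>) * ((x k \<omega>)\<^sup>2 - (s k)\<^sup>2)\<bar>
          \<le> (\<Sum>m\<in>?N n k. ?K / (real n)\<^sup>2 * min 1 (\<bar>x m \<omega>\<bar> / sqrt (real n))) * \<bar>(x k \<omega>)\<^sup>2 - (s k)\<^sup>2\<bar>"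
        unfolding abs_mult by (rule mult_right_mono[OF quad_trim_diff_le[OF n]]) simp
      also have "\<dots> \<le> (\<Sum>m\<in>?N n k. ?g n k m \<omega>)"
        unfolding sum_distrib_right by (rule sum_mono) (rule pt)
      finally show "\<bar>(quad n k \<omega> - quad_trim a n k \<omega>) * ((x k \<omega>)\<^sup>2 - (s k)\<^sup>2)\<bar> \<le> (\<Sum>m\<in>?N n k. ?g n k m \<omega>)" .
    qed
    have gi: "integrable M (?g n k m)" for k m
      using x_trunc_integrable[of n k] x_trunc_integrable[of n m] x_square_integrable[of m]
      by (intro integrable_mult_right Bochner_Integration.integrable_add integrable_mult_left) simp_all
    then show "integrable M (\<lambda>\<omega>. \<Sum>k\<in>triangle n. \<Sum>m\<in>?N n k. ?g n k m \<omega>)"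
      by (intro Bochner_Integration.integrable_sum)
    have gle: "expectation (?g n k m) \<le> ?K / (real n)\<^sup>2 * (?w * rate n)" for k m
    proof -
      have ex: "expectation (?g n k m) = ?K / (real n)\<^sup>2 * (expectation (\<lambda>\<omega>. trunc_square n (x m \<omega>))
          + expectation (\<lambda>\<omega>. trunc_square n (x k \<omega>)) + C * (1 + (s m)\<^sup>2) * (1 / sqrt (real n)))"
        using x_trunc_integrable[of n k] x_trunc_integrable[of n m] x_square_integrable[of m]
        by (simp add: x_variance prob_space)
      have "C * (1 + (s m)\<^sup>2) * (1 / sqrt (real n)) \<le> C * (1 + C) * rate n"
        using C_nonneg s_le[of m] inverse_le_rate(2)[OF n] by (intro mult_mono mult_left_mono) simp_all
      then have "expectation (\<lambda>\<omega>. trunc_square n (x m \<omega>)) + expectation (\<lambda>\<omega>. trunc_square n (x k \<omega>))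
          + C * (1 + (s m)\<^sup>2) * (1 / sqrt (real n)) \<le> rate n + rate n + C * (1 + C) * rate n"
        using x_trunc_le[OF n, of k] x_trunc_le[OF n, of m] e_le_rate[of n] by linarith
      also have "\<dots> = ?w * rate n" by (simp add: algebra_simps)
      finally show ?thesis unfolding ex using K by (intro mult_left_mono) simp_all
    qed
    have w0: "0 \<le> ?K / (real n)\<^sup>2 * (?w * rate n)"
      using K C_nonneg rate_nonneg[OF n] by simp
    have "expectation (\<lambda>\<omega>. \<Sum>k\<in>triangle n. \<Sum>m\<in>?N n k. ?g n k m \<omega>)
        = (\<Sum>k\<in>triangle n. expectation (\<lambda>\<omega>. \<Sum>m\<in>?N n k. ?g n k m \<omega>))"
      by (rule Bochner_Integration.integral_sum) (intro Bochner_Integration.integrable_sum gi)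
    also have "\<dots> = (\<Sum>k\<in>triangle n. \<Sum>m\<in>?N n k. expectation (?g n k m))"
      by (intro sum.cong refl Bochner_Integration.integral_sum gi)
    also have "\<dots> \<le> (real n)\<^sup>2 * ((real (2 * a))\<^sup>2 * (?K / (real n)\<^sup>2 * (?w * rate n)))"
    proof (rule sum_triangle_le)
      fix k
      have "(\<Sum>m\<in>?N n k. expectation (?g n k m)) \<le> real (card (?N n k)) * (?K / (real n)\<^sup>2 * (?w * rate n))"
        by (rule sum_bounded_above[OF gle])
      also have "\<dots> \<le> (real (2 * a))\<^sup>2 * (?K / (real n)\<^sup>2 * (?w * rate n))"
        by (rule mult_right_mono[OF card_near_le_real w0])
      finally show "(\<Sum>m\<in>?N n k. expectation (?g n k m)) \<le> (real (2 * a))\<^sup>2 * (?K / (real n)\<^sup>2 * (?w * rate n))" .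
    qed (rule mult_nonneg_nonneg[OF zero_le_power2 w0])
    also have "\<dots> = ?K * (real (2 * a))\<^sup>2 * (?w * rate n)" using n by (intro cancel) simp
    also have "\<dots> = ?K * (real (2 * a))\<^sup>2 * ?w * rate n" by (simp only: mult.assoc)
    finally show "expectation (\<lambda>\<omega>. \<Sum>k\<in>triangle n. \<Sum>m\<in>?N n k. ?g n k m \<omega>) \<le> ?K * (real (2 * a))\<^sup>2 * ?w * rate n" .
  qed
qed

text \<open>What survives the replacement is the weighted sum of conditional variances, for which no
  rate is known; the six other sums of the expansion vanish along the sequence.\<close>

lemma AE_stieltjes_comparison:
  assumes c: "0 < c" and a: "1 \<le> a"
  shows "AE \<omega> in M. (\<lambda>j. re (array_stieltjes (c * 4 ^ j) z (\<lambda>p. x p \<omega>)) - re (array_stieltjes (c * 4 ^ j) z (\<lambda>p. Y p \<omega>))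
    - (\<Sum>k\<in>triangle (c * 4 ^ j). quad_trim a (c * 4 ^ j) k \<omega> * cond_var a k \<omega>)) \<longlonglongrightarrow> 0"
proof -
  let ?A = "lin" and ?B = "quad" and ?b = "quad_trim a"
  have K: "0 \<le> coeff_bound z" using coeff_bound_ge(4)[OF z] by simp
  have 3: "AE \<omega> in M. (\<lambda>j. \<Sum>k\<in>triangle (c * 4 ^ j). ?B (c * 4 ^ j) k \<omega> * ((Y k \<omega>)\<^sup>2 - (s k)\<^sup>2)) \<longlonglongrightarrow> 0"
    by (rule AE_square_Y[OF c quad_X_rest quad_le[OF]])
  have 5: "AE \<omega> in M. (\<lambda>j. \<Sum>k\<in>triangle (c * 4 ^ j). ?b (c * 4 ^ j) k \<omega> * ((x k \<omega>)\<^sup>2 - (s k)\<^sup>2 - cond_var a k \<omega>)) \<longlonglongrightarrow> 0"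
    by (rule AE_centered_square_sum[OF a c K quad_trim_past_Y quad_trim_le[OF]])
  have "re (array_stieltjes n z (\<lambda>p. x p \<omega>)) - re (array_stieltjes n z (\<lambda>p. Y p \<omega>))
      - (\<Sum>k\<in>triangle n. ?b n k \<omega> * cond_var a k \<omega>)
    = (\<Sum>k\<in>triangle n. ?A n k \<omega> * x k \<omega>) - (\<Sum>k\<in>triangle n. ?A n k \<omega> * Y k \<omega>)
      - (\<Sum>k\<in>triangle n. ?B n k \<omega> * ((Y k \<omega>)\<^sup>2 - (s k)\<^sup>2)) + (\<Sum>k\<in>triangle n. taylor_rem n k \<omega>)
      + (\<Sum>k\<in>triangle n. (?B n k \<omega> - ?b n k \<omega>) * ((x k \<omega>)\<^sup>2 - (s k)\<^sup>2))
      + (\<Sum>k\<in>triangle n. ?b n k \<omega> * ((x k \<omega>)\<^sup>2 - (s k)\<^sup>2 - cond_var a k \<omega>))" for n \<omega>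
  proof -
    let ?H = "\<lambda>A. re (array_stieltjes n z (mix A \<omega>))"
    have "?H (triangle n) - ?H {} = (\<Sum>k\<in>triangle n. ?H (insert k (lex_below n k)) - ?H (lex_below n k))"
      by (rule sum_telescope_triangle[symmetric])
    moreover have "?H (triangle n) = re (array_stieltjes n z (\<lambda>p. x p \<omega>))"
      by (rule arg_cong[OF array_stieltjes_cong]) (simp add: mix_def)
    moreover have "?H {} = re (array_stieltjes n z (\<lambda>p. Y p \<omega>))"
      by (rule arg_cong[OF array_stieltjes_cong]) (simp add: mix_def)
    ultimately have "re (array_stieltjes n z (\<lambda>p. x p \<omega>)) - re (array_stieltjes n z (\<lambda>p. Y p \<omega>))
        = (\<Sum>k\<in>triangle n. ?H (insert k (lex_below n k)) - ?H (lex_below n k))" by simp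
    then have "re (array_stieltjes n z (\<lambda>p. x p \<omega>)) - re (array_stieltjes n z (\<lambda>p. Y p \<omega>))
          - (\<Sum>k\<in>triangle n. ?b n k \<omega> * cond_var a k \<omega>)
        = (\<Sum>k\<in>triangle n. (?H (insert k (lex_below n k)) - ?H (lex_below n k)) - ?b n k \<omega> * cond_var a k \<omega>)"
      by (simp only: sum_subtractf[of _ "\<lambda>k. ?b n k \<omega> * cond_var a k \<omega>"])
    \<comment> \<open>The variances of \<open>x k\<close> and \<open>Y k\<close> agree, so
      \<open>(s k)\<^sup>2\<close> is subtracted from both squares for free. In the part of
      \<open>X\<close> the coefficient \<open>quad\<close> is then exchanged for
      \<open>quad_trim\<close>, and the conditional variance is split off.\<close>
    also have "\<dots> = (\<Sum>k\<in>triangle n. ?A n k \<omega> * x k \<omega> - ?A n k \<omega> * Y k \<omega>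
      - ?B n k \<omega> * ((Y k \<omega>)\<^sup>2 - (s k)\<^sup>2) + taylor_rem n k \<omega>
      + (?B n k \<omega> - ?b n k \<omega>) * ((x k \<omega>)\<^sup>2 - (s k)\<^sup>2)
      + ?b n k \<omega> * ((x k \<omega>)\<^sup>2 - (s k)\<^sup>2 - cond_var a k \<omega>))"
      by (intro sum.cong refl) (simp add: taylor_rem_def algebra_simps)
    finally show ?thesis by (simp only: sum.distrib sum_subtractf)
  qed
  note eq = this
  show ?thesis
    unfolding eq
    using AE_lin_x[OF c] AE_lin_Y[OF c] 3 AE_taylor_rem[OF c] AE_quad_trim_diff[OF c, of a] 5
  proof eventually_elim
    case (elim \<omega>)
    show ?case
      using tendsto_add[OF tendsto_add[OF tendsto_add[OF tendsto_diff[OF tendsto_diff[OF elim(1,2)] elim(3)] elim(4)] elim(5)] elim(6)]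
      by simp
  qed
qed

end

end

section \<open>Interpolation between geometric subsequences\<close>

text \<open>The error of the approximation \<open>v a\<close> vanishes for each fixed
  \<open>a\<close>, whereas its size is small only for suitable \<open>a\<close>. Hence
  \<open>a\<close> is chosen first, then \<open>j\<close>.\<close>

lemma tendsto_zero_of_approximations:
  fixes u :: "nat \<Rightarrow> real" and v w :: "nat \<Rightarrow> nat \<Rightarrow> real"
  assumes approx: "\<And>a. 1 \<le> a \<Longrightarrow> (\<lambda>j. u j - v a j) \<longlonglongrightarrow> 0"
    and v: "\<And>a j. \<bar>v a j\<bar> \<le> K * w a (m j)" and K: "0 < K"
    and m: "filterlim m at_top sequentially"
    and w: "\<And>\<epsilon>. 0 < \<epsilon> \<Longrightarrow> \<exists>a\<ge>1. \<forall>\<^sub>F n in sequentially. w a n \<le> \<epsilon>"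
  shows "u \<longlonglongrightarrow> 0"
proof (rule tendstoI)
  fix \<epsilon> :: real assume \<epsilon>: "0 < \<epsilon>"
  then have "0 < \<epsilon> / (2 * K)" using K by simp
  from w[OF this] obtain a where a: "1 \<le> a" "\<forall>\<^sub>F n in sequentially. w a n \<le> \<epsilon> / (2 * K)" by blast
  have "\<forall>\<^sub>F j in sequentially. w a (m j) \<le> \<epsilon> / (2 * K)"
    by (rule eventually_compose_filterlim[OF a(2) m])
  moreover have "\<forall>\<^sub>F j in sequentially. dist (u j - v a j) 0 < \<epsilon> / 2"
    by (rule tendstoD[OF approx[OF a(1)]]) (use \<epsilon> in simp)
  ultimately show "\<forall>\<^sub>F j in sequentially. dist (u j) 0 < \<epsilon>"
  proof eventually_elim
    case (elim j)
    have "\<bar>v a j\<bar> \<le> K * (\<epsilon> / (2 * K))"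
      using v[of a j] mult_left_mono[OF elim(1), of K] K by linarith
    also have "\<dots> = \<epsilon> / 2" using K by simp
    finally have "\<bar>v a j\<bar> \<le> \<epsilon> / 2" .
    moreover have "\<bar>u j - v a j\<bar> < \<epsilon> / 2" using elim(2) by (simp add: dist_real_def)
    ultimately have "\<bar>u j\<bar> < \<epsilon>" using abs_triangle_ineq[of "u j - v a j" "v a j"] by simp
    then show ?case by (simp add: dist_real_def)
  qed
qed

lemma card_triangle_diff_le: "n \<le> m \<Longrightarrow> card (triangle m - triangle n) \<le> (m - n) * m"
proof -
  assume "n \<le> m"
  have "card (triangle m - triangle n) \<le> card ({n + 1..m} \<times> {1..m})"
    by (rule card_mono) (auto simp: triangle_def)
  then show ?thesis by simp
qed

lemma sum_triangle_diff_le: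
  fixes f :: "nat \<times> nat \<Rightarrow> real"
  assumes "\<And>p. f p \<le> C" "0 \<le> C" "n \<le> m"
  shows "sum f (triangle m) - sum f (triangle n) \<le> C * (real (m - n) * real m)"
proof -
  have sub: "triangle n \<subseteq> triangle m" using assms(3) by (auto simp: triangle_def)
  have "sum f (triangle m) - sum f (triangle n) = sum f (triangle m - triangle n)"
    by (rule sum_diff[OF finite_triangle sub, symmetric])
  also have "\<dots> \<le> real (card (triangle m - triangle n)) * C"
    by (rule sum_bounded_above) (rule assms(1))
  also have "\<dots> \<le> real ((m - n) * m) * C"
    by (rule mult_right_mono[OF of_nat_mono[OF card_triangle_diff_le[OF assms(3)]] assms(2)])
  finally show ?thesis by (simp add: mult_ac)
qed

text \<open>The largest change over a gap of relative size \<open>1 / L\<close>. The constant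
  \<open>12 + 6 * C\<close> is \<open>2 * ((1 + C) + 5 + 2 * C)\<close>, collected from the
  estimates for sums of squares.\<close>

definition oscillation :: "complex \<Rightarrow> real \<Rightarrow> nat \<Rightarrow> real" where
  "oscillation z C L = 2 / real L / Im z + sqrt ((12 + 6 * C) / real L) / (Im z)\<^sup>2"

lemma oscillation_tendsto: "(\<lambda>L. oscillation z C L) \<longlonglongrightarrow> 0"
proof -
  have 1: "(\<lambda>L. k / real L) \<longlonglongrightarrow> 0" for k by (rule lim_const_over_n)
  have 2: "(\<lambda>L. sqrt ((12 + 6 * C) / real L)) \<longlonglongrightarrow> 0"
    using tendsto_real_sqrt[OF 1[of "12 + 6 * C"]] by simp
  show ?thesis
    unfolding oscillation_def
    using tendsto_add[OF tendsto_divide[OF 1[of 2] tendsto_const[of "Im z"]] tendsto_divide[OF 2 tendsto_const[of "(Im z)\<^sup>2"]]]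
    by (cases "Im z = 0") simp_all
qed

text \<open>Sums of squares increase with the dimension, so the one at \<open>N\<close> lies between
  those at the neighbouring points \<open>c * 4 ^ j\<close> and \<open>(c + 1) * 4 ^ j\<close>.
  There they are close to the sums of \<open>v\<close>, whose growth over the gap is at most of
  relative order \<open>1 / L\<close>.\<close>

lemma array_stieltjes_oscillation:
  fixes x v :: "nat \<times> nat \<Rightarrow> real"
  assumes z: "0 < Im z" and v: "\<And>p. v p \<le> C" and C: "0 \<le> C"
    and L: "0 < L" "L \<le> c" and N: "4 ^ j * c \<le> N" "N < 4 ^ j * (c + 1)"
    and q: "\<bar>(\<Sum>p\<in>triangle (c * 4 ^ j). (x p)\<^sup>2 - v p) / (real (c * 4 ^ j))\<^sup>2\<bar> \<le> 1 / real L"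
    and q': "\<bar>(\<Sum>p\<in>triangle ((c + 1) * 4 ^ j). (x p)\<^sup>2 - v p) / (real ((c + 1) * 4 ^ j))\<^sup>2\<bar> \<le> 1 / real L"
  shows "cmod (array_stieltjes N z x - array_stieltjes (c * 4 ^ j) z x) \<le> oscillation z C L"
proof -
  define n n' where "n = c * 4 ^ j" and "n' = (c + 1) * 4 ^ j"
  define Q where "Q m = (\<Sum>p\<in>triangle m. (x p)\<^sup>2)" for m
  define V where "V m = (\<Sum>p\<in>triangle m. v p)" for m
  have c: "0 < c" using L by simp
  have n: "0 < n" using c by (simp add: n_def)
  have nN: "n \<le> N" "N \<le> n'" using N by (auto simp: n_def n'_def mult.commute)
  have N0: "0 < N" using n nN by simp
  have d: "n' - n = 4 ^ j" by (simp add: n_def n'_def algebra_simps)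
  have n'2: "n' \<le> 2 * n" using c by (simp add: n_def n'_def)
  have jn: "real (4 ^ j) = real n / real c" using c by (simp add: n_def)
  have cL: "1 / real c \<le> 1 / real L" using L by (simp add: frac_le)
  have Nn: "real N / real n - 1 \<le> 1 / real L"
  proof -
    have "N \<le> n + 4 ^ j" using nN d by simp
    then have "real N \<le> real n + real n / real c" unfolding jn[symmetric] of_nat_add[symmetric] by (rule of_nat_mono)
    then have "real N / real n \<le> (real n + real n / real c) / real n" by (rule divide_right_mono) simp
    also have "\<dots> = 1 + 1 / real c" using n by (simp add: add_divide_distrib)
    finally show ?thesis using cL by linarith
  qed
  have QV: "(\<Sum>p\<in>triangle m. (x p)\<^sup>2 - v p) = Q m - V m" for m
    by (simp add: Q_def V_def sum_subtractf)
  have bnd: "\<bar>Q m - V m\<bar> \<le> (real m)\<^sup>2 / real L"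
    if "\<bar>(Q m - V m) / (real m)\<^sup>2\<bar> \<le> 1 / real L" "0 < m" for m
  proof -
    have "\<bar>Q m - V m\<bar> / (real m)\<^sup>2 \<le> 1 / real L" using that by simp
    then have "\<bar>Q m - V m\<bar> / (real m)\<^sup>2 * (real m)\<^sup>2 \<le> 1 / real L * (real m)\<^sup>2" by (rule mult_right_mono) simp
    then show ?thesis using that(2) by simp
  qed
  have qn: "\<bar>Q n - V n\<bar> \<le> (real n)\<^sup>2 / real L" using q n unfolding QV n_def[symmetric] by (intro bnd)
  have n'0: "0 < n'" using n nN by simp
  have "\<bar>Q n' - V n'\<bar> \<le> (real n')\<^sup>2 / real L" using q' n'0 unfolding QV n'_def[symmetric] by (intro bnd)
  also have "\<dots> \<le> (2 * real n)\<^sup>2 / real L"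
    using of_nat_mono[OF n'2, where ?'a = real] by (intro divide_right_mono power_mono) auto
  finally have qn': "\<bar>Q n' - V n'\<bar> \<le> 4 * ((real n)\<^sup>2 / real L)" by (simp add: power_mult_distrib)
  have Vn: "V n \<le> C * (real n)\<^sup>2"
  proof -
    have "V n \<le> real (card (triangle n)) * C" unfolding V_def by (rule sum_bounded_above) (rule v)
    also have "\<dots> \<le> real (n\<^sup>2) * C" by (rule mult_right_mono[OF of_nat_mono[OF card_triangle_le] C])
    finally show ?thesis by (simp add: mult.commute)
  qed
  have Vd: "V n' - V n \<le> 2 * C * ((real n)\<^sup>2 / real L)"
  proof -
    have "V n' - V n \<le> C * (real (n' - n) * real n')"
      unfolding V_def using nN by (intro sum_triangle_diff_le v C) simp
    also have "\<dots> \<le> C * (real n / real L * (2 * real n))"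
    proof (intro mult_left_mono mult_mono)
      show "real (n' - n) \<le> real n / real L" unfolding d jn using L by (intro divide_left_mono) auto
      show "real n' \<le> 2 * real n" using of_nat_mono[OF n'2, where ?'a = real] by simp
    qed (use C in auto)
    finally show ?thesis by (simp add: power2_eq_square mult_ac)
  qed
  have QN: "Q N \<le> Q n'"
    unfolding Q_def using nN by (intro sum_mono2 finite_triangle) (auto simp: triangle_def)
  have Lr: "1 / real L \<le> 1" using L by simp
  have nL: "(real n)\<^sup>2 / real L \<le> (real n)\<^sup>2" using Lr mult_left_mono[OF Lr, of "(real n)\<^sup>2"] by simp
  have Qn: "0 \<le> Q n" "Q n \<le> (1 + C) * (real n)\<^sup>2"
    using qn Vn nL unfolding abs_le_iff by (auto simp: Q_def sum_nonneg distrib_right)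
  have "(real N / real n - 1) * Q n \<le> 1 / real L * ((1 + C) * (real n)\<^sup>2)"
    using Nn Qn L by (intro mult_mono) auto
  also have "1 / real L * ((1 + C) * (real n)\<^sup>2) = (1 + C) * ((real n)\<^sup>2 / real L)" by simp
  finally have "(real N / real n - 1) * Q n \<le> (1 + C) * ((real n)\<^sup>2 / real L)" .
  \<comment> \<open>The 5 is \<open>1 + 4\<close>: the deviation at \<open>n\<close> and the one at
    \<open>n'\<close>, where \<open>n' \<le> 2 * n\<close>. The rest is the growth of
    \<open>V\<close>.\<close>
  moreover have "Q N - Q n \<le> 5 * ((real n)\<^sup>2 / real L) + 2 * C * ((real n)\<^sup>2 / real L)"
    using qn qn' Vd QN unfolding abs_le_iff by linarith
  ultimately have "2 * ((real N / real n - 1) * Q n + (Q N - Q n))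
      \<le> 2 * ((1 + C) * ((real n)\<^sup>2 / real L) + (5 * ((real n)\<^sup>2 / real L) + 2 * C * ((real n)\<^sup>2 / real L)))"
    by (intro mult_left_mono add_mono) simp_all
  also have "\<dots> = (12 + 6 * C) / real L * (real n)\<^sup>2" using L by (simp add: field_simps)
  also have "\<dots> \<le> (12 + 6 * C) / real L * (real N)\<^sup>2"
    using C nN by (intro mult_left_mono power_mono) auto
  finally have "sqrt (2 * ((real N / real n - 1) * Q n + (Q N - Q n)))
      \<le> sqrt ((12 + 6 * C) / real L * (real N)\<^sup>2)" by (rule real_sqrt_le_mono)
  also have "\<dots> = real N * sqrt ((12 + 6 * C) / real L)"
    by (simp only: real_sqrt_mult real_sqrt_abs abs_of_nat) (rule mult.commute)
  finally have "sqrt (2 * ((real N / real n - 1) * Q n + (Q N - Q n))) / (real N * (Im z)\<^sup>2)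
      \<le> real N * sqrt ((12 + 6 * C) / real L) / (real N * (Im z)\<^sup>2)" by (rule divide_right_mono) simp
  then have 2: "sqrt (2 * ((real N / real n - 1) * Q n + (Q N - Q n))) / (real N * (Im z)\<^sup>2)
      \<le> sqrt ((12 + 6 * C) / real L) / (Im z)\<^sup>2" using N0 by simp
  \<comment> \<open>Arithmetic and geometric means: \<open>n / N + N / n \<ge> 2\<close>.\<close>
  have "1 - real n / real N \<le> real N / real n - 1"
  proof -
    have "2 * (real n * real N) \<le> (real n)\<^sup>2 + (real N)\<^sup>2" using sum_squares_bound[of "real n" "real N"] by (simp add: mult.assoc)
    then show ?thesis using n N0 by (simp add: field_simps power2_eq_square)
  qed
  then have "2 * (1 - real n / real N) / Im z \<le> 2 / real L / Im z"
    using z Nn by (intro divide_right_mono) auto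
  then show ?thesis
    using array_stieltjes_dimension[OF z n nN(1), of x, folded Q_def] 2
    unfolding oscillation_def n_def[symmetric] by linarith
qed

text \<open>Take the largest \<open>j\<close> with \<open>4 ^ j * L \<le> N\<close> and let
  \<open>c\<close> be the quotient of \<open>N\<close> by \<open>4 ^ j\<close>. The multiplier then
  stays in a range independent of \<open>N\<close>.\<close>

lemma geometric_bracket:
  fixes L N J :: nat
  assumes L: "0 < L" and N: "4 ^ J * L \<le> N"
  obtains j c where "J \<le> j" "L \<le> c" "c < 4 * L" "4 ^ j * c \<le> N" "N < 4 ^ j * (c + 1)"
proof -
  let ?S = "{j. 4 ^ j * L \<le> N}"
  have fin: "finite ?S"
  proof (rule finite_subset)
    show "?S \<subseteq> {..N}"
    proof
      fix j assume "j \<in> ?S"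
      then have SN: "4 ^ j * L \<le> N" by simp
      have "4 ^ j * 1 \<le> 4 ^ j * L" using L by (intro mult_le_mono2) simp
      from order_trans[OF this SN] have "4 ^ j \<le> N" by simp
      moreover have "j < 4 ^ j"
      proof -
        have "j < 2 ^ j" by (rule less_exp)
        also have "(2::nat) ^ j \<le> 4 ^ j" by (rule power_mono) auto
        finally show ?thesis .
      qed
      ultimately show "j \<in> {..N}" by simp
    qed
  qed simp
  define j where "j = Max ?S"
  have "J \<in> ?S" using N by simp
  then have j: "j \<in> ?S" "J \<le> j" unfolding j_def using fin Max_in[OF fin] Max_ge[OF fin] by auto
  have up: "N < 4 ^ Suc j * L"
  proof (rule ccontr)
    assume "\<not> N < 4 ^ Suc j * L"
    then have "Suc j \<in> ?S" by simp
    then have "Suc j \<le> j" unfolding j_def by (rule Max_ge[OF fin])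
    then show False by simp
  qed
  define c where "c = N div 4 ^ j"
  have p: "(0::nat) < 4 ^ j" by simp
  show ?thesis
  proof (rule that)
    show "J \<le> j" by (rule j(2))
    show "L \<le> c" unfolding c_def using j(1) p by (simp add: less_eq_div_iff_mult_less_eq mult.commute)
    show "c < 4 * L" unfolding c_def using up p by (simp add: less_mult_imp_div_less mult_ac)
    show "4 ^ j * c \<le> N" unfolding c_def by simp
    show "N < 4 ^ j * (c + 1)" unfolding c_def using p by (simp add: dividend_less_times_div)
  qed
qed

text \<open>For fixed \<open>L\<close> only finitely many multipliers occur, so the limits along
  their sequences hold from a common \<open>j\<close> on. The gaps are bridged by
  \<open>oscillation\<close>, once for \<open>x\<close> and once for \<open>y\<close>.\<close>

lemma tendsto_from_geometric_subsequences:
  fixes x y v :: "nat \<times> nat \<Rightarrow> real"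
  assumes z: "0 < Im z" and v: "\<And>p. v p \<le> C" and C: "0 \<le> C"
    and x: "\<And>c. 0 < c \<Longrightarrow> (\<lambda>j. (\<Sum>p\<in>triangle (c * 4 ^ j). (x p)\<^sup>2 - v p) / (real (c * 4 ^ j))\<^sup>2) \<longlonglongrightarrow> 0"
    and y: "\<And>c. 0 < c \<Longrightarrow> (\<lambda>j. (\<Sum>p\<in>triangle (c * 4 ^ j). (y p)\<^sup>2 - v p) / (real (c * 4 ^ j))\<^sup>2) \<longlonglongrightarrow> 0"
    and D: "\<And>c. 0 < c \<Longrightarrow> (\<lambda>j. array_stieltjes (c * 4 ^ j) z x - array_stieltjes (c * 4 ^ j) z y) \<longlonglongrightarrow> 0"
  shows "(\<lambda>N. array_stieltjes N z x - array_stieltjes N z y) \<longlonglongrightarrow> 0"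
proof (rule LIMSEQ_I)
  fix \<epsilon> :: real assume \<epsilon>: "0 < \<epsilon>"
  have "\<forall>\<^sub>F L in sequentially. oscillation z C L < \<epsilon> / 4"
    using order_tendstoD(2)[OF oscillation_tendsto, of "\<epsilon> / 4" z C] \<epsilon> by simp
  then have "\<forall>\<^sub>F L in sequentially. oscillation z C L < \<epsilon> / 4 \<and> 0 < L"
    using eventually_gt_at_top[of "0::nat"] by eventually_elim simp
  from eventually_happens'[OF sequentially_bot this]
  obtain L where L: "oscillation z C L < \<epsilon> / 4" "0 < L" by blast
  define good where "good c j \<longleftrightarrow>
     \<bar>(\<Sum>p\<in>triangle (c * 4 ^ j). (x p)\<^sup>2 - v p) / (real (c * 4 ^ j))\<^sup>2\<bar> \<le> 1 / real L \<and>
     \<bar>(\<Sum>p\<in>triangle (c * 4 ^ j). (y p)\<^sup>2 - v p) / (real (c * 4 ^ j))\<^sup>2\<bar> \<le> 1 / real L \<and>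
     cmod (array_stieltjes (c * 4 ^ j) z x - array_stieltjes (c * 4 ^ j) z y) < \<epsilon> / 4" for c j
  have small: "\<forall>\<^sub>F j in sequentially. \<bar>u j\<bar> \<le> 1 / real L" if "u \<longlonglongrightarrow> 0" for u :: "nat \<Rightarrow> real"
    using tendstoD[OF that, of "1 / real L"] L(2) by (auto elim!: eventually_mono simp: dist_real_def)
  have "\<forall>\<^sub>F j in sequentially. good c j" if "0 < c" for c
  proof -
    have "\<forall>\<^sub>F j in sequentially. cmod (array_stieltjes (c * 4 ^ j) z x - array_stieltjes (c * 4 ^ j) z y) < \<epsilon> / 4"
      using tendstoD[OF D[OF that], of "\<epsilon> / 4"] \<epsilon> by simp
    with small[OF x[OF that]] small[OF y[OF that]] show ?thesis
      by eventually_elim (unfold good_def, blast)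
  qed
  \<comment> \<open>The value \<open>4 * L\<close> is included because the upper neighbour
    \<open>c + 1\<close> of \<open>c < 4 * L\<close> is used as well.\<close>
  then have "\<forall>\<^sub>F j in sequentially. \<forall>c\<in>{L..4 * L}. good c j"
    using L(2) by (intro eventually_ball_finite) auto
  then obtain J where "\<forall>j\<ge>J. \<forall>c\<in>{L..4 * L}. good c j"
    unfolding eventually_sequentially by (rule exE)
  then have J: "good c j" if "J \<le> j" "L \<le> c" "c \<le> 4 * L" for j c
    using that unfolding Ball_def atLeastAtMost_iff by blast
  show "\<exists>no. \<forall>n\<ge>no. norm (array_stieltjes n z x - array_stieltjes n z y - 0) < \<epsilon>"
  proof (intro exI allI impI)
    fix N assume "4 ^ J * L \<le> N"
    then obtain j c where jc: "J \<le> j" "L \<le> c" "c < 4 * L" "4 ^ j * c \<le> N" "N < 4 ^ j * (c + 1)"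
      by (rule geometric_bracket[OF L(2)])
    have g: "good c j" "good (c + 1) j" using J[of j c] J[of j "c + 1"] jc by auto
    have "cmod (array_stieltjes N z x - array_stieltjes (c * 4 ^ j) z x) \<le> oscillation z C L"
      using g unfolding good_def by (intro array_stieltjes_oscillation[where v = v and C = C, OF z v C L(2) jc(2,4,5)]) blast+
    moreover have "cmod (array_stieltjes N z y - array_stieltjes (c * 4 ^ j) z y) \<le> oscillation z C L"
      using g unfolding good_def by (intro array_stieltjes_oscillation[where v = v and C = C, OF z v C L(2) jc(2,4,5)]) blast+
    moreover have "cmod (array_stieltjes (c * 4 ^ j) z x - array_stieltjes (c * 4 ^ j) z y) < \<epsilon> / 4"
      using g unfolding good_def by blast
    moreover have eq: "array_stieltjes N z x - array_stieltjes N z y - 0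
        = ((array_stieltjes N z x - array_stieltjes (c * 4 ^ j) z x)
            - (array_stieltjes N z y - array_stieltjes (c * 4 ^ j) z y))
          + (array_stieltjes (c * 4 ^ j) z x - array_stieltjes (c * 4 ^ j) z y)" by simp
    ultimately show "norm (array_stieltjes N z x - array_stieltjes N z y - 0) < \<epsilon>"
      unfolding eq using L(1) norm_triangle_ineq[of "(array_stieltjes N z x - array_stieltjes (c * 4 ^ j) z x)
            - (array_stieltjes N z y - array_stieltjes (c * 4 ^ j) z y)"
          "array_stieltjes (c * 4 ^ j) z x - array_stieltjes (c * 4 ^ j) z y"]
        norm_triangle_ineq4[of "array_stieltjes N z x - array_stieltjes (c * 4 ^ j) z x"
          "array_stieltjes N z y - array_stieltjes (c * 4 ^ j) z y"] \<epsilon> by linarith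
  qed
qed

lemma filterlim_geometric: "0 < c \<Longrightarrow> filterlim (\<lambda>j. c * 4 ^ j :: nat) at_top sequentially"
proof (rule filterlim_subseq)
  assume "0 < c"
  show "strict_mono (\<lambda>j. c * 4 ^ j :: nat)"
    by (rule strict_monoI_Suc) (use \<open>0 < c\<close> in simp)
qed

context array_pair
begin

text \<open>Real and imaginary parts, the distances \<open>a\<close> and the multipliers
  \<open>c\<close> make up countably many statements, so a single null set serves them all and the
  interpolation is pathwise.\<close>

lemma AE_stieltjes_tendsto:
  assumes z: "0 < Im z"
    and cv: "AE \<omega> in M. \<forall>\<epsilon>>0. \<exists>a\<ge>1. \<forall>\<^sub>F n in sequentially. (\<Sum>k\<in>triangle n. \<bar>cond_var a k \<omega>\<bar>) / (real n)\<^sup>2 \<le> \<epsilon>"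
  shows "AE \<omega> in M. (\<lambda>n. array_stieltjes n z (\<lambda>p. x p \<omega>) - array_stieltjes n z (\<lambda>p. Y p \<omega>)) \<longlonglongrightarrow> 0"
proof -
  have K: "0 < coeff_bound z" by (rule coeff_bound_ge(4)[OF z])
  let ?w = "\<lambda>\<omega> a n. (\<Sum>k\<in>triangle n. \<bar>cond_var a k \<omega>\<bar>) / (real n)\<^sup>2"
  \<comment> \<open>Coefficients of order \<open>n\<^sup>-\<^sup>2\<close> turn any weighted sum of
    conditional variances into a multiple of the average that is assumed to be small.\<close>
  have weighted: "\<bar>\<Sum>k\<in>triangle n. b k * cond_var a k \<omega>\<bar> \<le> B * ?w \<omega> a n"
    if "\<And>k. \<bar>b k\<bar> \<le> B / (real n)\<^sup>2" for b B n a \<omega>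
  proof -
    have "\<bar>\<Sum>k\<in>triangle n. b k * cond_var a k \<omega>\<bar> \<le> (\<Sum>k\<in>triangle n. B / (real n)\<^sup>2 * \<bar>cond_var a k \<omega>\<bar>)"
    proof (rule order_trans[OF sum_abs sum_mono])
      show "\<bar>b k * cond_var a k \<omega>\<bar> \<le> B / (real n)\<^sup>2 * \<bar>cond_var a k \<omega>\<bar>" for k
        unfolding abs_mult by (rule mult_right_mono[OF that abs_ge_zero])
    qed
    then show ?thesis by (simp add: sum_distrib_left sum_divide_distrib)
  qed
  have comp: "AE \<omega> in M. (\<lambda>j. re (array_stieltjes (c * 4 ^ j) z (\<lambda>p. x p \<omega>)) - re (array_stieltjes (c * 4 ^ j) z (\<lambda>p. Y p \<omega>))) \<longlonglongrightarrow> 0"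
    if re: "bounded_linear re" "\<And>w. \<bar>re w\<bar> \<le> cmod w" and c: "0 < c" for re c
  proof -
    have "AE \<omega> in M. \<forall>a. 1 \<le> a \<longrightarrow> (\<lambda>j. re (array_stieltjes (c * 4 ^ j) z (\<lambda>p. x p \<omega>)) - re (array_stieltjes (c * 4 ^ j) z (\<lambda>p. Y p \<omega>))
      - (\<Sum>k\<in>triangle (c * 4 ^ j). quad_trim z re a (c * 4 ^ j) k \<omega> * cond_var a k \<omega>)) \<longlonglongrightarrow> 0"
      unfolding AE_all_countable
    proof
      fix a
      show "AE \<omega> in M. 1 \<le> a \<longrightarrow> (\<lambda>j. re (array_stieltjes (c * 4 ^ j) z (\<lambda>p. x p \<omega>)) - re (array_stieltjes (c * 4 ^ j) z (\<lambda>p. Y p \<omega>))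
        - (\<Sum>k\<in>triangle (c * 4 ^ j). quad_trim z re a (c * 4 ^ j) k \<omega> * cond_var a k \<omega>)) \<longlonglongrightarrow> 0"
      proof (cases "1 \<le> a")
        case True
        from AE_stieltjes_comparison[OF z re c True] show ?thesis by eventually_elim blast
      qed simp
    qed
    with cv show ?thesis
    proof eventually_elim
      case (elim \<omega>)
      show ?case
      proof (rule tendsto_zero_of_approximations[where w = "?w \<omega>" and K = "coeff_bound z" and m = "\<lambda>j. c * 4 ^ j"
            and v = "\<lambda>a j. \<Sum>k\<in>triangle (c * 4 ^ j). quad_trim z re a (c * 4 ^ j) k \<omega> * cond_var a k \<omega>"])
        show "\<bar>\<Sum>k\<in>triangle (c * 4 ^ j). quad_trim z re a (c * 4 ^ j) k \<omega> * cond_var a k \<omega>\<bar>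
            \<le> coeff_bound z * ?w \<omega> a (c * 4 ^ j)" for a j
          using c by (intro weighted quad_trim_le[OF z re]) simp
        show "\<exists>a\<ge>1. \<forall>\<^sub>F n in sequentially. ?w \<omega> a n \<le> \<epsilon>" if "0 < \<epsilon>" for \<epsilon>
          using elim(1) that by simp
      qed (use elim(2) K filterlim_geometric[OF c] in simp_all)
    qed
  qed
  \<comment> \<open>The law of large numbers for the squares of \<open>X\<close>, with the distance
    \<open>a\<close> removed in the same way as for the transforms.\<close>
  have x2: "AE \<omega> in M. (\<lambda>j. (\<Sum>p\<in>triangle (c * 4 ^ j). (x p \<omega>)\<^sup>2 - (s p)\<^sup>2) / (real (c * 4 ^ j))\<^sup>2) \<longlonglongrightarrow> 0"
    if c: "0 < c" for c
  proof -
    have one: "\<bar>1 / (real n)\<^sup>2\<bar> \<le> 1 / (real n)\<^sup>2" for n by simp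
    have "AE \<omega> in M. \<forall>a. 1 \<le> a \<longrightarrow> (\<lambda>j. \<Sum>k\<in>triangle (c * 4 ^ j).
        1 / (real (c * 4 ^ j))\<^sup>2 * ((x k \<omega>)\<^sup>2 - (s k)\<^sup>2 - cond_var a k \<omega>)) \<longlonglongrightarrow> 0"
      unfolding AE_all_countable
    proof
      fix a
      show "AE \<omega> in M. 1 \<le> a \<longrightarrow> (\<lambda>j. \<Sum>k\<in>triangle (c * 4 ^ j).
          1 / (real (c * 4 ^ j))\<^sup>2 * ((x k \<omega>)\<^sup>2 - (s k)\<^sup>2 - cond_var a k \<omega>)) \<longlonglongrightarrow> 0"
      proof (cases "1 \<le> a")
        case True
        from AE_centered_square_sum[of a c 1 "\<lambda>n k \<omega>. 1 / (real n)\<^sup>2", OF True c zero_le_one borel_measurable_const one]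
        show ?thesis by eventually_elim blast
      qed simp
    qed
    with cv show ?thesis
    proof eventually_elim
      case (elim \<omega>)
      show ?case
      proof (rule tendsto_zero_of_approximations[where w = "?w \<omega>" and K = 1 and m = "\<lambda>j. c * 4 ^ j"
            and v = "\<lambda>a j. \<Sum>k\<in>triangle (c * 4 ^ j). 1 / (real (c * 4 ^ j))\<^sup>2 * cond_var a k \<omega>"])
        show "\<bar>\<Sum>k\<in>triangle (c * 4 ^ j). 1 / (real (c * 4 ^ j))\<^sup>2 * cond_var a k \<omega>\<bar> \<le> 1 * ?w \<omega> a (c * 4 ^ j)" for a j
          by (rule weighted) (rule one)
        show "\<exists>a\<ge>1. \<forall>\<^sub>F n in sequentially. ?w \<omega> a n \<le> \<epsilon>" if "0 < \<epsilon>" for \<epsilon>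
          using elim(1) that by simp
        fix a :: nat assume "1 \<le> a"
        then have "(\<lambda>j. \<Sum>k\<in>triangle (c * 4 ^ j).
            1 / (real (c * 4 ^ j))\<^sup>2 * ((x k \<omega>)\<^sup>2 - (s k)\<^sup>2 - cond_var a k \<omega>)) \<longlonglongrightarrow> 0" using elim(2) by blast
        moreover have "(\<Sum>k\<in>triangle n. 1 / (real n)\<^sup>2 * ((x k \<omega>)\<^sup>2 - (s k)\<^sup>2 - cond_var a k \<omega>))
            = (\<Sum>p\<in>triangle n. (x p \<omega>)\<^sup>2 - (s p)\<^sup>2) / (real n)\<^sup>2 - (\<Sum>k\<in>triangle n. 1 / (real n)\<^sup>2 * cond_var a k \<omega>)" for n
          by (simp only: right_diff_distrib sum_subtractf sum_divide_distrib diff_divide_distrib) simp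
        ultimately show "(\<lambda>j. (\<Sum>p\<in>triangle (c * 4 ^ j). (x p \<omega>)\<^sup>2 - (s p)\<^sup>2) / (real (c * 4 ^ j))\<^sup>2
            - (\<Sum>k\<in>triangle (c * 4 ^ j). 1 / (real (c * 4 ^ j))\<^sup>2 * cond_var a k \<omega>)) \<longlonglongrightarrow> 0" by (simp only:)
      qed (use filterlim_geometric[OF c] in simp_all)
    qed
  qed
  have y2: "AE \<omega> in M. (\<lambda>j. (\<Sum>p\<in>triangle (c * 4 ^ j). (Y p \<omega>)\<^sup>2 - (s p)\<^sup>2) / (real (c * 4 ^ j))\<^sup>2) \<longlonglongrightarrow> 0"
    if c: "0 < c" for c
  proof -
    have one: "\<bar>1 / (real n)\<^sup>2\<bar> \<le> 1 / (real n)\<^sup>2" for n by simp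
    show ?thesis
      using AE_square_Y[of c "\<lambda>n k \<omega>. 1 / (real n)\<^sup>2" 1, OF c borel_measurable_const one]
      by (simp add: sum_divide_distrib)
  qed
  have "AE \<omega> in M. \<forall>c. 0 < c \<longrightarrow>
      (\<lambda>j. Re (array_stieltjes (c * 4 ^ j) z (\<lambda>p. x p \<omega>)) - Re (array_stieltjes (c * 4 ^ j) z (\<lambda>p. Y p \<omega>))) \<longlonglongrightarrow> 0 \<and>
      (\<lambda>j. Im (array_stieltjes (c * 4 ^ j) z (\<lambda>p. x p \<omega>)) - Im (array_stieltjes (c * 4 ^ j) z (\<lambda>p. Y p \<omega>))) \<longlonglongrightarrow> 0 \<and>
      (\<lambda>j. (\<Sum>p\<in>triangle (c * 4 ^ j). (x p \<omega>)\<^sup>2 - (s p)\<^sup>2) / (real (c * 4 ^ j))\<^sup>2) \<longlonglongrightarrow> 0 \<and>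
      (\<lambda>j. (\<Sum>p\<in>triangle (c * 4 ^ j). (Y p \<omega>)\<^sup>2 - (s p)\<^sup>2) / (real (c * 4 ^ j))\<^sup>2) \<longlonglongrightarrow> 0"
    (is "AE \<omega> in M. \<forall>c. 0 < c \<longrightarrow> ?P c \<omega>")
    unfolding AE_all_countable
  proof
    fix c :: nat
    show "AE \<omega> in M. 0 < c \<longrightarrow> ?P c \<omega>"
    proof (cases "0 < c")
      case True
      show ?thesis
        using comp[OF bounded_linear_Re abs_Re_le_cmod True] comp[OF bounded_linear_Im abs_Im_le_cmod True] x2[OF True] y2[OF True]
        by eventually_elim blast
    qed simp
  qed
  then show ?thesis
  proof eventually_elim
    case (elim \<omega>)
    show ?case
    proof (rule tendsto_from_geometric_subsequences[where v = "\<lambda>p. (s p)\<^sup>2" and C = C, OF z s_le C_nonneg])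
      fix c :: nat assume c: "0 < c"
      show "(\<lambda>j. array_stieltjes (c * 4 ^ j) z (\<lambda>p. x p \<omega>) - array_stieltjes (c * 4 ^ j) z (\<lambda>p. Y p \<omega>)) \<longlonglongrightarrow> 0"
        unfolding tendsto_complex_iff using elim c by simp
    qed (use elim in blast)+
  qed
qed

end

section \<open>From the moment and variance conditions to the locale\<close>

lemma triangle_Sigma: "triangle n = Sigma {1..n} (\<lambda>i. {1..i})"
  by (auto simp: triangle_def)

theorem theorem2:
  fixes M :: "'a measure"
    and X :: "int \<times> int \<Rightarrow> 'a \<Rightarrow> real"
    and Y :: "nat \<times> nat \<Rightarrow> 'a \<Rightarrow> real"
    and \<sigma> :: "int \<times> int \<Rightarrow> real"
    and h :: "real \<Rightarrow> real"
    and C :: real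
    and z :: complex
  assumes "prob_space M"
    and X_measurable: "\<And>p. X p \<in> borel_measurable M"
    and X_square_integrable: "\<And>p. integrable M (\<lambda>\<omega>. (X p \<omega>)\<^sup>2)"
    and X_centered: "\<And>p. prob_space.expectation M (X p) = 0"
    and X_variance: "\<And>p. prob_space.expectation M (\<lambda>\<omega>. (X p \<omega>)\<^sup>2) = (\<sigma> p)\<^sup>2"
    and Y_measurable: "\<And>i j. 1 \<le> i \<Longrightarrow> 1 \<le> j \<Longrightarrow> Y (i, j) \<in> borel_measurable M"
    and Y_gaussian: "\<And>i j. 1 \<le> i \<Longrightarrow> 1 \<le> j \<Longrightarrow>
      distr M borel (Y (i, j)) = centered_gaussian ((\<sigma> (int i, int j))\<^sup>2)"
    and Y_indep: "prob_space.indep_vars M (\<lambda>_. borel) Y ({1..} \<times> {1..})"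
    and XY_indep: "prob_space.indep_set M
      (sets (generated_algebra M X UNIV)) (sets (generated_algebra M Y ({1..} \<times> {1..})))"
    and martingale: "\<And>i j :: nat. 1 \<le> j \<Longrightarrow> j \<le> i \<Longrightarrow>
      AE \<omega> in M. real_cond_exp M (past_algebra M X 1 (int i, int j)) (X (int i, int j)) \<omega> = 0"
    and h_ge_1: "\<And>x. 0 \<le> x \<Longrightarrow> 1 \<le> h x"
    and h_mono: "mono_on {0..} h"
    and h_antimono: "antimono_on {0<..} (\<lambda>x. h x / x)"
    and h_summable: "summable (\<lambda>n. 1 / (real (Suc n) * h (real (Suc n))))"
    and "0 < C"
    and moment: "(SUP p. \<integral>\<^sup>+ \<omega>. ennreal ((X p \<omega>)\<^sup>2 * h \<bar>X p \<omega>\<bar>) \<partial>M) \<le> ennreal C"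
    and cond_variance: "AE \<omega> in M.
      (\<lambda>a. limsup (\<lambda>n. ereal (1 / (real n)\<^sup>2 * (\<Sum>i = 1..n. \<Sum>j = 1..i.
        \<bar>real_cond_exp M (past_algebra M X a (int i, int j))
           (\<lambda>\<omega>'. (X (int i, int j) \<omega>')\<^sup>2 - (\<sigma> (int i, int j))\<^sup>2) \<omega>\<bar>))))
      \<longlonglongrightarrow> 0"
    and "0 < Im z"
  shows "AE \<omega> in M.
    (\<lambda>n. stieltjes (normalized_array_mat n (\<lambda>(i, j). X (int i, int j) \<omega>)) z
       - stieltjes (normalized_array_mat n (\<lambda>p. Y p \<omega>)) z) \<longlonglongrightarrow> 0"
proof -
  interpret prob_space M by fact
  have h_le: "h u \<le> h v" if "0 \<le> u" "u \<le> v" for u v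
    using h_mono that by (auto simp: monotone_on_def)
  have h_pos: "0 < h u" if "0 \<le> u" for u using h_ge_1[OF that] by simp
  have h_div: "h v / v \<le> h u / u" if "0 < u" "u \<le> v" for u v
    using h_antimono that by (auto simp: monotone_on_def)
  have mom: "(\<integral>\<^sup>+ \<omega>. ennreal ((X p \<omega>)\<^sup>2 * h \<bar>X p \<omega>\<bar>) \<partial>M) \<le> ennreal C" for p
    by (rule order_trans[OF SUP_upper moment]) simp
  \<comment> \<open>For \<open>\<bar>t\<bar> \<ge> sqrt n\<close> it is enough that \<open>h\<close>
    increases; below, the factor \<open>\<bar>t\<bar> / sqrt n\<close> is exchanged for
    \<open>h \<bar>t\<bar> / h (sqrt n)\<close>, as \<open>h x / x\<close> decreases. The case
    \<open>t = 0\<close> is apart because that ratio is controlled for positive arguments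
    only.\<close>
  have trunc_h: "trunc_square n t * h (sqrt (real n)) \<le> t\<^sup>2 * h \<bar>t\<bar>" if n: "0 < n" for n t
  proof (cases "sqrt (real n) \<le> \<bar>t\<bar>")
    case True
    then have "trunc_square n t * h (sqrt (real n)) \<le> t\<^sup>2 * h (sqrt (real n))"
      using h_pos[of "sqrt (real n)"] by (intro mult_right_mono trunc_square_le) simp
    also have "\<dots> \<le> t\<^sup>2 * h \<bar>t\<bar>" using True by (intro mult_left_mono h_le) simp_all
    finally show ?thesis .
  next
    case False
    show ?thesis
    proof (cases "t = 0")
      case True
      then show ?thesis by (simp add: trunc_square_def)
    next
      case t: False
      have "trunc_square n t \<le> t\<^sup>2 * (\<bar>t\<bar> / sqrt (real n))"
        unfolding trunc_square_def by (intro mult_left_mono) auto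
      then have "trunc_square n t * h (sqrt (real n)) \<le> t\<^sup>2 * (\<bar>t\<bar> / sqrt (real n)) * h (sqrt (real n))"
        using h_pos[of "sqrt (real n)"] by (intro mult_right_mono) simp_all
      also have "\<dots> = t\<^sup>2 * \<bar>t\<bar> * (h (sqrt (real n)) / sqrt (real n))" by simp
      also have "\<dots> \<le> t\<^sup>2 * \<bar>t\<bar> * (h \<bar>t\<bar> / \<bar>t\<bar>)"
        using t False by (intro mult_left_mono h_div) simp_all
      also have "\<dots> = t\<^sup>2 * h \<bar>t\<bar>" using t by simp
      finally show ?thesis .
    qed
  qed
  have trunc_int: "integrable M (\<lambda>\<omega>. trunc_square n (X p \<omega>))" for n p
    using X_measurable[of p]
    by (intro Bochner_Integration.integrable_bound[OF X_square_integrable[of p]])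
       (auto simp: trunc_square_nonneg trunc_square_le)
  \<comment> \<open>The choice of \<open>e n\<close> results from integrating \<open>trunc_h\<close>
    and dividing by \<open>h (sqrt n)\<close>.\<close>
  interpret array_pair M X Y \<sigma> C "\<lambda>n. C / h (sqrt (real n))"
  proof unfold_locales
    show "(\<sigma> p)\<^sup>2 \<le> C" for p
    proof -
      have "ennreal ((\<sigma> p)\<^sup>2) = (\<integral>\<^sup>+ \<omega>. ennreal ((X p \<omega>)\<^sup>2) \<partial>M)"
        unfolding X_variance[symmetric] by (rule nn_integral_eq_integral[OF X_square_integrable, symmetric]) simp
      also have "\<dots> \<le> (\<integral>\<^sup>+ \<omega>. ennreal ((X p \<omega>)\<^sup>2 * h \<bar>X p \<omega>\<bar>) \<partial>M)"
        by (intro nn_integral_mono ennreal_leI) (simp add: mult_left_le h_ge_1 mult_le_cancel_left1)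
      also have "\<dots> \<le> ennreal C" by (rule mom)
      finally show ?thesis using \<open>0 < C\<close> by (simp add: ennreal_le_iff)
    qed
    show "expectation (\<lambda>\<omega>. trunc_square n (X p \<omega>)) \<le> C / h (sqrt (real n))" if n: "0 < n" for n p
    proof -
      have hp: "0 < h (sqrt (real n))" by (rule h_pos) simp
      have i: "integrable M (\<lambda>\<omega>. trunc_square n (X p \<omega>) * h (sqrt (real n)))" using trunc_int by simp
      have "ennreal (expectation (\<lambda>\<omega>. trunc_square n (X p \<omega>) * h (sqrt (real n))))
          = (\<integral>\<^sup>+ \<omega>. ennreal (trunc_square n (X p \<omega>) * h (sqrt (real n))) \<partial>M)"
        using hp by (intro nn_integral_eq_integral[OF i, symmetric]) (simp add: trunc_square_nonneg)
      also have "\<dots> \<le> (\<integral>\<^sup>+ \<omega>. ennreal ((X p \<omega>)\<^sup>2 * h \<bar>X p \<omega>\<bar>) \<partial>M)"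
        by (intro nn_integral_mono ennreal_leI trunc_h[OF n])
      also have "\<dots> \<le> ennreal C" by (rule mom)
      finally have "expectation (\<lambda>\<omega>. trunc_square n (X p \<omega>) * h (sqrt (real n))) \<le> C"
        using \<open>0 < C\<close> by (simp add: ennreal_le_iff)
      then show ?thesis using hp by (simp add: pos_le_divide_eq)
    qed
    show "summable (\<lambda>j. C / h (sqrt (real (c * 4 ^ j))))" if c: "0 < c" for c
    proof -
      define f where "f n = 1 / (real n * h (real n))" for n
      have "summable f" using h_summable summable_Suc_iff[of f] by (simp add: f_def)
      \<comment> \<open>Cauchy condensation turns the series of \<open>1 / (n * h n)\<close> into
        that of \<open>1 / h (2 ^ n)\<close>.\<close>
      moreover have "summable f \<longleftrightarrow> summable (\<lambda>n. 2 ^ n * f (2 ^ n))"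
      proof (rule condensation_test)
        show "f (Suc m) \<le> f m" if "0 < m" for m
          unfolding f_def using that h_pos[of "real m"]
          by (intro divide_left_mono mult_mono h_le mult_pos_pos) (auto intro: h_pos less_imp_le)
        show "0 \<le> f n" for n unfolding f_def using h_pos[of "real n"] by simp
      qed
      moreover have "2 ^ n * f (2 ^ n) = 1 / h (2 ^ n)" for n by (simp add: f_def)
      ultimately have "summable (\<lambda>n. 1 / h (2 ^ n))" by simp
      then have "summable (\<lambda>n. C * (1 / h (2 ^ n)))" by (rule summable_mult)
      then show ?thesis
      proof (rule summable_comparison_test_ev[rotated], intro always_eventually allI)
        fix j
        \<comment> \<open>The square root of \<open>c * 4 ^ j\<close> is at least
          \<open>2 ^ j\<close>, the scale produced by condensation.\<close>
        have "(2::real) ^ j = sqrt (4 ^ j)" using real_sqrt_power[of 4 j] by simp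
        also have "\<dots> \<le> sqrt (real (c * 4 ^ j))" using c by simp
        finally have "h (2 ^ j) \<le> h (sqrt (real (c * 4 ^ j)))" by (intro h_le) simp_all
        then have "C / h (sqrt (real (c * 4 ^ j))) \<le> C / h (2 ^ j)"
          using \<open>0 < C\<close> by (intro divide_left_mono mult_pos_pos h_pos) simp_all
        then show "norm (C / h (sqrt (real (c * 4 ^ j)))) \<le> C * (1 / h (2 ^ j))"
          using \<open>0 < C\<close> h_pos[of "sqrt (real (c * 4 ^ j))"] by simp
      qed
    qed
  qed (fact X_measurable X_square_integrable X_variance Y_measurable Y_gaussian Y_indep XY_indep martingale)+
  \<comment> \<open>A strict bound on the upper limit, which is an extended real, becomes an
    eventual bound on the real averages; since it holds for all large \<open>a\<close>, one may take
    \<open>a \<ge> 1\<close>.\<close>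
  have "AE \<omega> in M. \<forall>\<epsilon>>0. \<exists>a\<ge>1. \<forall>\<^sub>F n in sequentially. (\<Sum>k\<in>triangle n. \<bar>cond_var a k \<omega>\<bar>) / (real n)\<^sup>2 \<le> \<epsilon>"
    using cond_variance
  proof eventually_elim
    case (elim \<omega>)
    have eq: "1 / (real n)\<^sup>2 * (\<Sum>i = 1..n. \<Sum>j = 1..i.
        \<bar>real_cond_exp M (past_algebra M X a (int i, int j))
           (\<lambda>\<omega>'. (X (int i, int j) \<omega>')\<^sup>2 - (\<sigma> (int i, int j))\<^sup>2) \<omega>\<bar>)
        = (\<Sum>k\<in>triangle n. \<bar>cond_var a k \<omega>\<bar>) / (real n)\<^sup>2" for a n
      unfolding triangle_Sigma cond_var_def past_def x_def s_def
      by (subst sum.Sigma) (auto simp: case_prod_unfold)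
    show ?case
    proof (intro allI impI)
      fix \<epsilon> :: real assume "0 < \<epsilon>"
      then have "\<forall>\<^sub>F a in sequentially. limsup (\<lambda>n. ereal ((\<Sum>k\<in>triangle n. \<bar>cond_var a k \<omega>\<bar>) / (real n)\<^sup>2)) < ereal \<epsilon>"
        using order_tendstoD(2)[OF elim[unfolded eq], of "ereal \<epsilon>"] by simp
      then have "\<forall>\<^sub>F a in sequentially. limsup (\<lambda>n. ereal ((\<Sum>k\<in>triangle n. \<bar>cond_var a k \<omega>\<bar>) / (real n)\<^sup>2)) < ereal \<epsilon> \<and> 1 \<le> a"
        using eventually_ge_at_top[of "1::nat"] by eventually_elim simp
      from eventually_happens'[OF sequentially_bot this] obtain a where a: "1 \<le> a" "limsup (\<lambda>n. ereal ((\<Sum>k\<in>triangle n. \<bar>cond_var a k \<omega>\<bar>) / (real n)\<^sup>2)) < ereal \<epsilon>"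
        by blast
      have "\<forall>\<^sub>F n in sequentially. (\<Sum>k\<in>triangle n. \<bar>cond_var a k \<omega>\<bar>) / (real n)\<^sup>2 \<le> \<epsilon>"
        using Limsup_lessD[OF a(2)] by eventually_elim simp
      with a(1) show "\<exists>a\<ge>1. \<forall>\<^sub>F n in sequentially. (\<Sum>k\<in>triangle n. \<bar>cond_var a k \<omega>\<bar>) / (real n)\<^sup>2 \<le> \<epsilon>" by blast
    qed
  qed
  then have "AE \<omega> in M. (\<lambda>n. array_stieltjes n z (\<lambda>p. x p \<omega>) - array_stieltjes n z (\<lambda>p. Y p \<omega>)) \<longlonglongrightarrow> 0"
    by (rule AE_stieltjes_tendsto[OF \<open>0 < Im z\<close>])
  then show ?thesis
    by (simp add: array_stieltjes_def x_def case_prod_unfold)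
qed

end
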